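(* Let $d\ge1$. There is a constant $C$ depending only on $d$ such that for every $t\in\mathbb{R}$, $t\ne0$, and every $u_0\in W(\mathcal{F}L^\infty,L^1)(\mathbb{R}^d)$, $$\|e^{it\Delta}u_0\|_{W(\mathcal{F}L^1,L^\infty)}\le C\left(\frac{1+|t|}{t^{2}}\right)^{\frac d2}\|u_0\|_{W(\mathcal{F}L^\infty,L^1)} .$$
   Context: The Fourier transform is $\mathcal{F}f(\omega)=\hat f(\omega)=\int f(x)e^{-2\pi i x\cdot\omega}\,dx$, extended to tempered distributions; $\mathcal{F}L^p$ is the space of tempered distributions $f$ with $\hat f\in L^p$, with $\|f\|_{\mathcal{F}L^p}=\|\hat f\|_{L^p}$. $T_xg(y)=g(y-x)$. $e^{it\Delta}$ is the Schrödinger propagator on $\mathbb{R}^d$ (solution operator of $i\partial_t u+\Delta u=0$, $u(0)=u_0$): $\mathcal{F}(e^{it\Delta}u_0)(\omega)=e^{-4\pi^2 i t|\omega|^2}\hat u_0(\omega)$; equivalently, for $t\neq 0$, $e^{it\Delta}u_0=K_t*u_0$ with $K_t(x)=(4\pi i t)^{-d/2}e^{i|x|^2/(4t)}$. Wiener amalgam spaces: fix a window $g\in C_0^\infty(\mathbb{R}^d)$ with $\|g\|_{L^2}=1$. For a local component $B$ (e.g. $\mathcal{F}L^p$) and a global component $C$ (e.g. $L^q$), $W(B,C)$ is the space of functions (distributions) $f$ that are locally in $B$ (i.e. $hf\in B$ for all $h\in C_0^\infty$) such that $x\mapsto \|f\,T_xg\|_B$ belongs to $C$, with norm $\|f\|_{W(B,C)}=\big\|\,\|f\,T_xg\|_B\,\big\|_{C_x}$.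 Different windows give equivalent norms. *)

theory Defs
  imports "HOL-Analysis.Analysis" "HOL-Probability.Essential_Supremum"
begin

section \<open>Smooth functions, test functions, Schwartz functions\<close>

primrec iter_partial :: "'a::euclidean_space list \<Rightarrow> ('a \<Rightarrow> complex) \<Rightarrow> 'a \<Rightarrow> complex" where
  "iter_partial [] f = f"
| "iter_partial (b # bs) f = (\<lambda>x. frechet_derivative (iter_partial bs f) (at x) b)"

definition smooth :: "('a::euclidean_space \<Rightarrow> complex) \<Rightarrow> bool" where
  "smooth f \<longleftrightarrow> (\<forall>bs x. set bs \<subseteq> Basis \<longrightarrow> iter_partial bs f differentiable (at x))"

definition test_function :: "('a::euclidean_space \<Rightarrow> complex) \<Rightarrow> bool" where
  "test_function f \<longleftrightarrow> smooth f \<and> compact (closure {x. f x \<noteq> 0})"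

definition schwartz :: "('a::euclidean_space \<Rightarrow> complex) \<Rightarrow> bool" where
  "schwartz f \<longleftrightarrow> smooth f \<and>
     (\<forall>k bs. set bs \<subseteq> Basis \<longrightarrow>
        bounded (range (\<lambda>x. complex_of_real (norm x ^ k) * iter_partial bs f x)))"

definition schwartz_norm :: "nat \<Rightarrow> ('a::euclidean_space \<Rightarrow> complex) \<Rightarrow> real" where
  "schwartz_norm N f =
     (\<Sum>k\<le>N. \<Sum>bs | set bs \<subseteq> Basis \<and> length bs \<le> N.
        SUP x. norm x ^ k * cmod (iter_partial bs f x))"

section \<open>Tempered distributions\<close>

text \<open>
  A tempered distribution is represented by a functional that is defined on all functions but
  constrained, and ever evaluated, on Schwartz functions only; two functionals that agree on
  Schwartz functions represent the same distribution.
\<close>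

type_synonym 'a distr = "('a \<Rightarrow> complex) \<Rightarrow> complex"

definition tempered :: "'a::euclidean_space distr \<Rightarrow> bool" where
  "tempered u \<longleftrightarrow>
     (\<forall>\<phi> \<psi>. schwartz \<phi> \<longrightarrow> schwartz \<psi> \<longrightarrow> u (\<lambda>x. \<phi> x + \<psi> x) = u \<phi> + u \<psi>) \<and>
     (\<forall>c \<phi>. schwartz \<phi> \<longrightarrow> u (\<lambda>x. c * \<phi> x) = c * u \<phi>) \<and>
     (\<exists>K N. \<forall>\<phi>. schwartz \<phi> \<longrightarrow> cmod (u \<phi>) \<le> K * schwartz_norm N \<phi>)"

text \<open>
  Product with a smooth function of polynomial growth together with all its derivatives.
\<close>

definition mult_distr :: "('a \<Rightarrow> complex) \<Rightarrow> 'a distr \<Rightarrow> 'a distr" where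
  "mult_distr h u = (\<lambda>\<phi>. u (\<lambda>x. h x * \<phi> x))"

definition fourier :: "('a::euclidean_space \<Rightarrow> complex) \<Rightarrow> 'a \<Rightarrow> complex" where
  "fourier f \<omega> = (LINT x|lborel. f x * exp (- 2 * pi * \<i> * complex_of_real (x \<bullet> \<omega>)))"

definition inv_fourier :: "('a::euclidean_space \<Rightarrow> complex) \<Rightarrow> 'a \<Rightarrow> complex" where
  "inv_fourier f x = (LINT \<omega>|lborel. f \<omega> * exp (2 * pi * \<i> * complex_of_real (x \<bullet> \<omega>)))"

definition fourier_distr :: "'a::euclidean_space distr \<Rightarrow> 'a distr" where
  "fourier_distr u = (\<lambda>\<phi>. u (fourier \<phi>))"

definition inv_fourier_distr :: "'a::euclidean_space distr \<Rightarrow> 'a distr" where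
  "inv_fourier_distr u = (\<lambda>\<phi>. u (inv_fourier \<phi>))"

section \<open>Lebesgue and Fourier--Lebesgue norms\<close>

text \<open>Power of an extended nonnegative real with exponent \<open>r > 0\<close>.\<close>

definition ennreal_powr :: "ennreal \<Rightarrow> real \<Rightarrow> ennreal" where
  "ennreal_powr x r = (if x = \<infinity> then \<infinity> else ennreal (enn2real x powr r))"

text \<open>The exponent ranges over \<open>1 \<le> p \<le> \<infinity>\<close>.\<close>

definition Lp_norm :: "ennreal \<Rightarrow> ('a::euclidean_space \<Rightarrow> ennreal) \<Rightarrow> ennreal" where
  "Lp_norm p F =
     (if p = \<infinity> then esssup lborel F
      else ennreal_powr (\<integral>\<^sup>+ x. ennreal_powr (F x) (enn2real p) \<partial>lborel) (1 / enn2real p))"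

definition Lp_space :: "ennreal \<Rightarrow> ('a::euclidean_space \<Rightarrow> complex) set" where
  "Lp_space p = {h \<in> borel_measurable lborel. Lp_norm p (\<lambda>x. ennreal (cmod (h x))) < \<infinity>}"

definition fourier_densities ::
    "ennreal \<Rightarrow> 'a::euclidean_space distr \<Rightarrow> ('a \<Rightarrow> complex) set" where
  "fourier_densities p u =
     {h \<in> Lp_space p. \<forall>\<phi>. schwartz \<phi> \<longrightarrow> fourier_distr u \<phi> = (LINT \<omega>|lborel. h \<omega> * \<phi> \<omega>)}"

definition FL :: "ennreal \<Rightarrow> 'a::euclidean_space distr set" where
  "FL p = {u. tempered u \<and> fourier_densities p u \<noteq> {}}"

text \<open>
  The elements of \<^term>\<open>fourier_densities p u\<close> agree almost everywhere, so the infimum is their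
  common norm; it is \<open>\<infinity>\<close> if \<open>u\<close> is not in the space.
\<close>

definition FL_norm :: "ennreal \<Rightarrow> 'a::euclidean_space distr \<Rightarrow> ennreal" where
  "FL_norm p u = (INF h \<in> fourier_densities p u. Lp_norm p (\<lambda>\<omega>. ennreal (cmod (h \<omega>))))"

section \<open>Wiener amalgam spaces with Fourier--Lebesgue local component\<close>

definition window :: "('a::euclidean_space \<Rightarrow> complex) \<Rightarrow> bool" where
  "window g \<longleftrightarrow> test_function g \<and> Lp_norm 2 (\<lambda>x. ennreal (cmod (g x))) = 1"

definition translate :: "'a::euclidean_space \<Rightarrow> ('a \<Rightarrow> complex) \<Rightarrow> 'a \<Rightarrow> complex" where
  "translate x g = (\<lambda>y. g (y - x))"

definition local_FL_norm ::
    "('a::euclidean_space \<Rightarrow> complex) \<Rightarrow> ennreal \<Rightarrow> 'a distr \<Rightarrow> 'a \<Rightarrow> ennreal" where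
  "local_FL_norm g p u x = FL_norm p (mult_distr (translate x g) u)"

text \<open>The norm of \<open>W(FL\<^sup>p, L\<^sup>q)\<close> with respect to the window \<open>g\<close>.\<close>

definition amalgam_norm ::
    "('a::euclidean_space \<Rightarrow> complex) \<Rightarrow> ennreal \<Rightarrow> ennreal \<Rightarrow> 'a distr \<Rightarrow> ennreal" where
  "amalgam_norm g p q u = Lp_norm q (local_FL_norm g p u)"

definition amalgam ::
    "('a::euclidean_space \<Rightarrow> complex) \<Rightarrow> ennreal \<Rightarrow> ennreal \<Rightarrow> 'a distr set" where
  "amalgam g p q =
     {u. tempered u \<and>
         (\<forall>h. test_function h \<longrightarrow> mult_distr h u \<in> FL p) \<and>
         local_FL_norm g p u \<in> borel_measurable lborel \<and>
         amalgam_norm g p q u < \<infinity>}"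

section \<open>The free Schroedinger propagator\<close>

definition schroedinger :: "real \<Rightarrow> 'a::euclidean_space distr \<Rightarrow> 'a distr" where
  "schroedinger t u =
     inv_fourier_distr
       (mult_distr (\<lambda>\<omega>. exp (- 4 * pi\<^sup>2 * \<i> * t * complex_of_real ((norm \<omega>)\<^sup>2))) (fourier_distr u))"

end

theory Submission
  imports Defs "HOL-Probability.Characteristic_Functions" "HOL-Probability.Sinc_Integral"
begin

text \<open>
  Write \<open>V\<^sub>k f\<close> for a short-time Fourier transform. A distribution \<open>u\<close> in \<open>W(FL\<^sup>\<infinity>, L\<^sup>1)\<close> is recovered from the
  function \<open>W(y, z) = u(T\<^sub>y(g \<cdot> e\<^sub>-\<^sub>z))\<close>, \<open>e\<^sub>z(x) = exp(2 \<pi> i x \<bullet> z)\<close>, which is dominated by the local norm at \<open>y\<close> uniformly in \<open>z\<close>: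
  \<open>u\<close> applied to the Fourier transform of \<open>f\<close> is the integral of \<open>W\<close> against \<open>V\<^sub>k f\<close>.
  Hence the Fourier transform at \<open>w\<close> of the evolved distribution times \<open>T\<^sub>x g\<close> is the integral of \<open>W\<close>
  against the short-time Fourier transform of a translated Schwartz function times the chirp
  \<open>exp(- 4 \<pi>\<^sup>2 i t \<bar>\<xi>\<bar>\<^sup>2)\<close>.
  Translating by \<open>w\<close> under the chirp is a modulation by \<open>4 \<pi> t w\<close>, so integrating in \<open>w\<close> gives a Jacobian
  \<open>\<bar>t\<bar>\<^sup>-\<^sup>d\<close> times the \<open>L\<^sup>1\<close> norm of the short-time Fourier transform of a chirped Schwartz function.
  By Plancherel and a weighted AM-GM inequality at frequency scale \<open>1 + \<bar>t\<bar>\<close> the latter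
  is at most a constant times \<open>(1 + \<bar>t\<bar>)\<^sup>d\<^sup>/\<^sup>2\<close>, and \<open>\<bar>t\<bar>\<^sup>-\<^sup>d (1 + \<bar>t\<bar>)\<^sup>d\<^sup>/\<^sup>2\<close> is the claimed factor.
\<close>

text \<open>The obstacle is that \<open>u\<close> itself has no known Fourier density: only its
  products with compactly supported functions do. So \<open>u\<close> is cut off by dilates of one
  bump, Fubini is used there, and the cut-off is removed by dominated convergence. The bound on
  \<open>W\<close> survives the limit because multiplying by a dilated bump is, on the Fourier side,
  convolution with a function whose L^1 norm does not depend on the dilation. A modulation by
  \<open>z\<close> merely translates a bounded density, so the bound on \<open>W\<close> has no
  decay in \<open>z\<close>; integrability in \<open>z\<close> must come from the short-time Fourier
  transform of the test function. The exponents then fit: the local norm is integrated over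
  \<open>y\<close>, and for each fixed \<open>y\<close> the integral over \<open>z\<close> and
  \<open>w\<close> is one and the same number. The position \<open>x\<close> of the target window
  enters only as a modulation, which leaves this number unchanged; hence a supremum over
  \<open>x\<close> costs nothing. Membership in the target space also asks for measurability of the
  local norm in \<open>x\<close>. That norm is an infimum over densities, so integrable densities
  are shown to be unique and the local norm becomes an explicit integral.\<close>

definition ee :: "real \<Rightarrow> complex" where
  "ee a = cis (2 * pi * a)"

text \<open>The direction \<open>b\<close> is any vector, so the full derivative of \<open>f\<close>
  at \<open>x\<close> is \<open>\<lambda>b. pd b f x\<close>; derivative rules can then be stated
  with \<open>pd\<close> alone.\<close>

definition pd :: "'a::euclidean_space \<Rightarrow> ('a \<Rightarrow> complex) \<Rightarrow> 'a \<Rightarrow> complex" where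
  "pd b f = (\<lambda>x. frechet_derivative f (at x) b)"

lemma norm_ee [simp]: "norm (ee a) = 1"
  by (simp add: ee_def)

lemma ee_add: "ee (a + b) = ee a * ee b"
  by (simp add: ee_def cis_mult distrib_left)

lemma ee_0 [simp]: "ee 0 = 1"
  by (simp add: ee_def)

lemma ee_minus: "ee (- a) = cnj (ee a)"
  by (simp add: ee_def cis_cnj)

lemma continuous_ee [continuous_intros]:
  "continuous_on S f \<Longrightarrow> continuous_on S (\<lambda>x. ee (f x))"
  unfolding ee_def by (intro continuous_intros)

lemma measurable_ee [measurable]: "ee \<in> borel_measurable borel"
  by (intro borel_measurable_continuous_onI continuous_intros)

lemma has_derivative_ee [derivative_intros]:
  assumes "(f has_derivative f') (at x within S)"
  shows "((\<lambda>x. ee (f x)) has_derivative (\<lambda>v. (2 * of_real pi * \<i> * of_real (f' v)) * ee (f x))) (at x within S)"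
proof -
  have g: "((\<lambda>x. \<i> * complex_of_real (2 * pi * f x)) has_derivative (\<lambda>v. \<i> * complex_of_real (2 * pi * f' v))) (at x within S)"
    by (intro has_derivative_mult_right has_derivative_of_real assms)
  have "((\<lambda>x. exp (\<i> * complex_of_real (2 * pi * f x))) has_derivative
      (\<lambda>v. exp (\<i> * complex_of_real (2 * pi * f x)) * (\<i> * complex_of_real (2 * pi * f' v)))) (at x within S)"
    by (rule has_derivative_compose[OF g]) (use DERIV_exp in \<open>simp add: has_field_derivative_def\<close>)
  moreover have "(\<lambda>v. exp (\<i> * complex_of_real (2 * pi * f x)) * (\<i> * complex_of_real (2 * pi * f' v)))
      = (\<lambda>v. (2 * of_real pi * \<i> * of_real (f' v)) * exp (\<i> * complex_of_real (2 * pi * f x)))"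
    by (simp add: mult_ac)
  ultimately have "((\<lambda>x. exp (\<i> * complex_of_real (2 * pi * f x))) has_derivative
      (\<lambda>v. (2 * of_real pi * \<i> * of_real (f' v)) * exp (\<i> * complex_of_real (2 * pi * f x)))) (at x within S)"
    by (simp only:)
  then show ?thesis by (simp add: ee_def cis_conv_exp)
qed

lemma fourier_eq: "fourier f w = (LINT x|lborel. f x * ee (- (x \<bullet> w)))"
  unfolding fourier_def ee_def cis_conv_exp by (simp add: algebra_simps)

lemma inv_fourier_eq_fourier: "inv_fourier f x = fourier f (- x)"
  unfolding fourier_def inv_fourier_def by (simp add: inner_commute)

lemma chirp_eq:
  "exp (- 4 * pi\<^sup>2 * \<i> * t * complex_of_real ((norm x)\<^sup>2)) = ee (- 2 * pi * t * (norm x)\<^sup>2)"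
  unfolding ee_def cis_conv_exp by (simp add: power2_eq_square algebra_simps)

section \<open>Closure properties of Schwartz functions\<close>

text \<open>The recursion of \<open>iter_partial\<close> exposes the outermost derivative. Exposing
  the innermost one turns statements about all iterated derivatives of \<open>f\<close> into
  statements about \<open>pd b f\<close>.\<close>

lemma iter_partial_snoc: "iter_partial (bs @ [b]) f = iter_partial bs (pd b f)"
  by (induction bs) (auto simp: pd_def)

lemma pd_eqI:
  assumes "\<And>x. (f has_derivative f' x) (at x)"
  shows "pd b f = (\<lambda>x. f' x b)"
  using assms frechet_derivative_at[OF assms] by (auto simp: pd_def)

text \<open>The order-zero part of the Schwartz condition. With \<open>schwartz_alt\<close> decay is
  checked separately from smoothness, one function at a time.\<close>

definition rapid :: "('a::real_normed_vector \<Rightarrow> complex) \<Rightarrow> bool" where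
  "rapid f \<longleftrightarrow> (\<forall>k. \<exists>C. \<forall>x. norm x ^ k * norm (f x) \<le> C)"

lemma rapidD:
  assumes "rapid f"
  obtains C where "0 < C" "\<And>x. norm x ^ k * norm (f x) \<le> C"
proof -
  obtain C where C: "\<And>x. norm x ^ k * norm (f x) \<le> C"
    using assms unfolding rapid_def by meson
  then have "norm x ^ k * norm (f x) \<le> max 1 C" for x
    using max.coboundedI2 by blast
  then show thesis using that[of "max 1 C"] by auto
qed

text \<open>Coinduction: a class of differentiable functions that is stable under partial
  derivatives contains only smooth ones. Choosing the class well replaces every formula for higher
  derivatives of products and compositions.\<close>

lemma smooth_coinduct:
  assumes "Q f"
    and diff: "\<And>f x. Q f \<Longrightarrow> f differentiable (at x)"
    and pd: "\<And>f b. Q f \<Longrightarrow> b \<in> Basis \<Longrightarrow> Q (pd b f)"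
  shows "smooth f"
proof -
  have "Q (iter_partial bs f)" if "set bs \<subseteq> Basis" for bs
    using that \<open>Q f\<close> by (induction bs) (auto dest: pd simp: pd_def)
  then show ?thesis unfolding smooth_def using diff by blast
qed

lemma smooth_differentiable: "smooth f \<Longrightarrow> f differentiable (at x)"
  unfolding smooth_def by (metis iter_partial.simps(1) empty_subsetI list.set(1))

lemma smooth_pd: "smooth f \<Longrightarrow> b \<in> Basis \<Longrightarrow> smooth (pd b f)"
  unfolding smooth_def iter_partial_snoc[symmetric] by simp

lemma schwartz_alt:
  "schwartz f \<longleftrightarrow> smooth f \<and> (\<forall>bs. set bs \<subseteq> Basis \<longrightarrow> rapid (iter_partial bs f))"
  unfolding schwartz_def rapid_def bounded_iff by (auto simp: norm_mult norm_power)

lemma schwartz_coinduct: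
  assumes "Q f"
    and diff: "\<And>f x. Q f \<Longrightarrow> f differentiable (at x)"
    and pd: "\<And>f b. Q f \<Longrightarrow> b \<in> Basis \<Longrightarrow> Q (pd b f)"
    and rapid: "\<And>f. Q f \<Longrightarrow> rapid f"
  shows "schwartz f"
proof -
  have "Q (iter_partial bs f)" if "set bs \<subseteq> Basis" for bs
    using that \<open>Q f\<close> by (induction bs) (auto dest: pd simp: pd_def)
  then show ?thesis
    unfolding schwartz_alt using smooth_coinduct[OF \<open>Q f\<close> diff pd] rapid by blast
qed

text \<open>The form used in practice: the derivative is given as a \<open>has_derivative\<close>
  fact, so it can be assembled by the derivative rules.\<close>

lemma schwartz_coinduct_deriv:
  assumes "Q f"
    and deriv: "\<And>f. Q f \<Longrightarrow> \<exists>f'. (\<forall>x. (f has_derivative f' x) (at x)) \<and> (\<forall>b\<in>Basis. Q (\<lambda>x. f' x b))"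
    and rapid: "\<And>f. Q f \<Longrightarrow> rapid f"
  shows "schwartz f"
proof (rule schwartz_coinduct[where Q = Q])
  show "f differentiable (at x)" if "Q f" for f x
    using deriv[OF that] by (auto simp: differentiable_def)
  show "Q (pd b f)" if Qf: "Q f" and b: "b \<in> Basis" for f b
  proof -
    obtain f' where "\<And>x. (f has_derivative f' x) (at x)" "\<forall>b\<in>Basis. Q (\<lambda>x. f' x b)"
      using deriv[OF Qf] by blast
    then show ?thesis using b pd_eqI[of f f' b] by simp
  qed
qed (use assms in auto)

lemma schwartz_smooth: "schwartz f \<Longrightarrow> smooth f"
  by (simp add: schwartz_alt)

lemma schwartz_rapid: "schwartz f \<Longrightarrow> rapid f"
  unfolding schwartz_alt by (metis iter_partial.simps(1) empty_subsetI list.set(1))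

lemma schwartz_pd: "schwartz f \<Longrightarrow> b \<in> Basis \<Longrightarrow> schwartz (pd b f)"
  unfolding schwartz_alt by (auto simp: iter_partial_snoc[symmetric] smooth_pd)

lemma schwartz_differentiable: "schwartz f \<Longrightarrow> f differentiable (at x)"
  by (simp add: schwartz_smooth smooth_differentiable)

lemma smooth_has_derivative:
  "smooth f \<Longrightarrow> (f has_derivative (frechet_derivative f (at x))) (at x)"
  using smooth_differentiable frechet_derivative_works by blast

lemma schwartz_has_derivative:
  "schwartz f \<Longrightarrow> (f has_derivative (frechet_derivative f (at x))) (at x)"
  by (simp add: schwartz_smooth smooth_has_derivative)

lemma smooth_continuous: "smooth f \<Longrightarrow> continuous_on S f"
  by (meson continuous_at_imp_continuous_on differentiable_imp_continuous_within smooth_differentiable)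

lemma schwartz_continuous: "schwartz f \<Longrightarrow> continuous_on S f"
  by (simp add: schwartz_smooth smooth_continuous)

lemma schwartz_measurable: "schwartz f \<Longrightarrow> f \<in> borel_measurable borel"
  by (intro borel_measurable_continuous_onI schwartz_continuous)

lemma frechet_eq_pd: "frechet_derivative f (at x) b = pd b f x"
  by (simp add: pd_def)

lemma rapid_add: assumes "rapid f" "rapid g" shows "rapid (\<lambda>x. f x + g x)"
  unfolding rapid_def
proof
  fix k
  obtain C D where "\<And>x. norm x ^ k * norm (f x) \<le> C" "\<And>x. norm x ^ k * norm (g x) \<le> D"
    using assms unfolding rapid_def by meson
  then have "norm x ^ k * norm (f x + g x) \<le> C + D" for x
    using mult_left_mono[OF norm_triangle_ineq[of "f x" "g x"], of "norm x ^ k"]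
    by (smt (verit) distrib_left norm_ge_zero zero_le_power)
  then show "\<exists>C. \<forall>x. norm x ^ k * norm (f x + g x) \<le> C" by blast
qed

lemma rapid_mult_bounded:
  assumes "rapid f" "\<And>x. norm (g x) \<le> C"
  shows "rapid (\<lambda>x. g x * f x)"
  unfolding rapid_def
proof
  fix k
  obtain D where D: "\<And>x. norm x ^ k * norm (f x) \<le> D"
    using assms unfolding rapid_def by meson
  have "norm x ^ k * norm (g x * f x) \<le> C * D" for x
    using mult_mono[OF assms(2)[of x] D[of x]] order_trans[OF norm_ge_zero assms(2)]
    by (simp add: norm_mult mult_ac)
  then show "\<exists>C. \<forall>x. norm x ^ k * norm (g x * f x) \<le> C" by blast
qed

lemma schwartz_add:
  assumes "schwartz f" "schwartz g"
  shows "schwartz (\<lambda>x. f x + g x)"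
proof (rule schwartz_coinduct_deriv[where Q = "\<lambda>h. \<exists>f g. schwartz f \<and> schwartz g \<and> h = (\<lambda>x. f x + g x)"])
  fix h :: "'a \<Rightarrow> complex"
  assume "\<exists>f g. schwartz f \<and> schwartz g \<and> h = (\<lambda>x. f x + g x)"
  then obtain f g where f: "schwartz f" "schwartz g" and h: "h = (\<lambda>x. f x + g x)" by blast
  show "rapid h" unfolding h using f by (intro rapid_add schwartz_rapid)
  have "(h has_derivative (\<lambda>b. pd b f x + pd b g x)) (at x)" for x
    unfolding h frechet_eq_pd[symmetric]
    by (intro has_derivative_add schwartz_has_derivative f)
  then show "\<exists>h'. (\<forall>x. (h has_derivative h' x) (at x)) \<and> (\<forall>b\<in>Basis. \<exists>f g. schwartz f \<and> schwartz g \<and> (\<lambda>x. h' x b) = (\<lambda>x. f x + g x))"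
    using f schwartz_pd by (intro exI[of _ "\<lambda>x b. pd b f x + pd b g x"]) blast
qed (use assms in blast)

text \<open>If the derivative of \<open>T f\<close> in direction \<open>v\<close> is
  \<open>T\<close> applied to another Schwartz function \<open>S v f\<close>, then the range of
  \<open>T\<close> is a class stable under differentiation. This covers conjugation, affine
  substitution, phases and the Fourier transform.\<close>

lemma schwartz_mapI:
  assumes "\<And>f. schwartz f \<Longrightarrow> rapid (T f)"
    and "\<And>f x. schwartz f \<Longrightarrow> (T f has_derivative (\<lambda>v. T (S v f) x)) (at x)"
    and "\<And>f b. schwartz f \<Longrightarrow> b \<in> Basis \<Longrightarrow> schwartz (S b f)"
    and "schwartz f"
  shows "schwartz (T f)"
proof (rule schwartz_coinduct_deriv[where Q = "\<lambda>h. \<exists>f. schwartz f \<and> h = T f"])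
  fix h assume "\<exists>f. schwartz f \<and> h = T f"
  then obtain f where f: "schwartz f" "h = T f" by blast
  show "rapid h" using f assms(1) by blast
  show "\<exists>h'. (\<forall>x. (h has_derivative h' x) (at x)) \<and> (\<forall>b\<in>Basis. \<exists>f. schwartz f \<and> (\<lambda>x. h' x b) = T f)"
    using f assms(2,3) by (intro exI[of _ "\<lambda>x v. T (S v f) x"]) blast
qed (use assms(4) in blast)

lemma schwartz_cmult: "schwartz f \<Longrightarrow> schwartz (\<lambda>x. c * f x)"
proof (rule schwartz_mapI[where T = "\<lambda>f x. c * f x" and S = pd])
  fix f :: "'a \<Rightarrow> complex" assume f: "schwartz f"
  show "rapid (\<lambda>x. c * f x)" using f by (intro rapid_mult_bounded[where C="norm c"] schwartz_rapid) auto
  show "((\<lambda>x. c * f x) has_derivative (\<lambda>b. c * pd b f x)) (at x)" for x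
    unfolding frechet_eq_pd[symmetric] by (intro has_derivative_mult_right schwartz_has_derivative f)
qed (auto intro: schwartz_pd)

lemma schwartz_diff:
  "schwartz f \<Longrightarrow> schwartz g \<Longrightarrow> schwartz (\<lambda>x. f x - g x)"
  using schwartz_add[OF _ schwartz_cmult[of g "-1"]] by simp

lemma schwartz_cnj: "schwartz f \<Longrightarrow> schwartz (\<lambda>x. cnj (f x))"
proof (rule schwartz_mapI[where T = "\<lambda>f x. cnj (f x)" and S = pd])
  fix f :: "'a \<Rightarrow> complex" assume f: "schwartz f"
  show "rapid (\<lambda>x. cnj (f x))" using schwartz_rapid[OF f] unfolding rapid_def by simp
  show "((\<lambda>x. cnj (f x)) has_derivative (\<lambda>b. cnj (pd b f x))) (at x)" for x
    unfolding frechet_eq_pd[symmetric] by (intro has_derivative_cnj schwartz_has_derivative f)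
qed (auto intro: schwartz_pd)

text \<open>Products alone are not stable under differentiation because of the Leibniz rule; their
  finite sums are, and this is the class to which the coinduction is applied.\<close>

inductive prod_sum :: "('a::euclidean_space \<Rightarrow> complex) \<Rightarrow> bool" where
  prod: "schwartz f \<Longrightarrow> schwartz g \<Longrightarrow> prod_sum (\<lambda>x. f x * g x)"
| sum: "prod_sum f \<Longrightarrow> prod_sum g \<Longrightarrow> prod_sum (\<lambda>x. f x + g x)"

lemma schwartz_mult:
  assumes "schwartz f" "schwartz g"
  shows "schwartz (\<lambda>x. f x * g x)"
proof -
  have *: "(\<exists>h'. (\<forall>x. (h has_derivative h' x) (at x)) \<and> (\<forall>b\<in>Basis. prod_sum (\<lambda>x. h' x b))) \<and> rapid h"
    if "prod_sum h" for h :: "'a \<Rightarrow> complex"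
    using that
  proof induction
    case (prod f g)
    have "((\<lambda>x. f x * g x) has_derivative (\<lambda>b. f x * pd b g x + pd b f x * g x)) (at x)" for x
      unfolding frechet_eq_pd[symmetric]
      by (intro has_derivative_mult schwartz_has_derivative prod)
    moreover have "prod_sum (\<lambda>x. f x * pd b g x + pd b f x * g x)" if "b \<in> Basis" for b
      by (intro prod_sum.intros prod schwartz_pd that)
    moreover obtain C where "\<And>x. norm x ^ 0 * norm (f x) \<le> C"
      using rapidD[OF schwartz_rapid[OF prod(1)]] by metis
    then have "rapid (\<lambda>x. f x * g x)"
      by (intro rapid_mult_bounded[where C=C] schwartz_rapid prod) auto
    ultimately show ?case by (intro conjI exI[of _ "\<lambda>x b. f x * pd b g x + pd b f x * g x"]) auto
  next
    case (sum f g)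
    then obtain f' g' where "\<forall>x. (f has_derivative f' x) (at x)" "\<forall>b\<in>Basis. prod_sum (\<lambda>x. f' x b)"
      "\<forall>x. (g has_derivative g' x) (at x)" "\<forall>b\<in>Basis. prod_sum (\<lambda>x. g' x b)" by blast
    then show ?case using sum
      by (intro conjI exI[of _ "\<lambda>x b. f' x b + g' x b"]) (auto intro: has_derivative_add rapid_add prod_sum.sum)
  qed
  show ?thesis
    by (rule schwartz_coinduct_deriv[where Q = prod_sum]) (use * assms in \<open>auto intro: prod_sum.prod\<close>)
qed

lemma rapid_coord: assumes "rapid f" shows "rapid (\<lambda>x::'a::euclidean_space. of_real (x \<bullet> v) * f x)"
  unfolding rapid_def
proof
  fix k
  obtain D where D: "\<And>x. norm x ^ Suc k * norm (f x) \<le> D"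
    using assms unfolding rapid_def by meson
  have "norm x ^ k * norm (of_real (x \<bullet> v) * f x) \<le> norm v * D" for x
  proof -
    have "norm x ^ k * norm (of_real (x \<bullet> v) * f x) = \<bar>x \<bullet> v\<bar> * (norm x ^ k * norm (f x))"
      by (simp add: norm_mult)
    also have "\<dots> \<le> (norm x * norm v) * (norm x ^ k * norm (f x))"
      by (intro mult_right_mono Cauchy_Schwarz_ineq2) auto
    also have "\<dots> \<le> norm v * D" using mult_left_mono[OF D[of x], of "norm v"] by (simp add: mult_ac)
    finally show ?thesis .
  qed
  then show "\<exists>C. \<forall>x. norm x ^ k * norm (of_real (x \<bullet> v) * f x) \<le> C" by blast
qed

lemma schwartz_coord:
  assumes "schwartz f"
  shows "schwartz (\<lambda>x. of_real (x \<bullet> v) * f x)"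
proof -
  \<comment> \<open>The summand \<open>g\<close> absorbs the term \<open>(b \<bullet> v) f\<close>
    that appears when the coordinate factor is differentiated.\<close>
  let ?Q = "\<lambda>h. \<exists>f g. schwartz f \<and> schwartz g \<and> h = (\<lambda>x. of_real (x \<bullet> v) * f x + g x)"
  show ?thesis
  proof (rule schwartz_coinduct_deriv[where Q = ?Q])
    fix h :: "'a \<Rightarrow> complex"
    assume "?Q h"
    then obtain f g where f: "schwartz f" "schwartz g" and h: "h = (\<lambda>x. of_real (x \<bullet> v) * f x + g x)" by blast
    show "rapid h" unfolding h using f by (intro rapid_add rapid_coord schwartz_rapid)
    let ?h' = "\<lambda>x b. (of_real (x \<bullet> v) * pd b f x + of_real (b \<bullet> v) * f x) + pd b g x"
    have "(h has_derivative ?h' x) (at x)" for x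
      unfolding h frechet_eq_pd[symmetric]
      by (intro has_derivative_add has_derivative_mult schwartz_has_derivative f has_derivative_of_real
           has_derivative_inner_left has_derivative_ident)
    moreover have "?Q (\<lambda>x. ?h' x b)" if "b \<in> Basis" for b
    proof (intro exI conjI)
      show "schwartz (pd b f)" using that f by (simp add: schwartz_pd)
      show "schwartz (\<lambda>x. of_real (b \<bullet> v) * f x + pd b g x)"
        using that f by (intro schwartz_add schwartz_cmult schwartz_pd)
    qed (simp add: algebra_simps)
    ultimately show "\<exists>h'. (\<forall>x. (h has_derivative h' x) (at x)) \<and> (\<forall>b\<in>Basis. ?Q (\<lambda>x. h' x b))"
      by (intro exI[of _ ?h']) blast
  next
    show "?Q (\<lambda>x. of_real (x \<bullet> v) * f x)"
      by (rule exI[of _ f], rule exI[of _ "\<lambda>x. 0 * f x"]) (use assms schwartz_cmult[of f 0] in auto)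
  qed
qed

text \<open>Differentiating a quadratic phase only produces a factor of degree at most one in
  \<open>x\<close>, which keeps the other factor Schwartz. Modulations and chirps are the two
  special cases.\<close>

lemma schwartz_phase: "schwartz f \<Longrightarrow> schwartz (\<lambda>x. ee (x \<bullet> v + a * (norm x)\<^sup>2) * f x)"
proof (rule schwartz_mapI[where T = "\<lambda>f x. ee (x \<bullet> v + a * (norm x)\<^sup>2) * f x"
      and S = "\<lambda>b f x. pd b f x + ((2 * of_real pi * \<i> * of_real (b \<bullet> v)) * f x + (4 * of_real pi * \<i> * of_real a) * (of_real (x \<bullet> b) * f x))"])
  fix f :: "'a \<Rightarrow> complex" assume f: "schwartz f"
  show "rapid (\<lambda>x. ee (x \<bullet> v + a * (norm x)\<^sup>2) * f x)"
    using f by (intro rapid_mult_bounded[where C=1] schwartz_rapid) auto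
  show "((\<lambda>x. ee (x \<bullet> v + a * (norm x)\<^sup>2) * f x) has_derivative
      (\<lambda>b. ee (x \<bullet> v + a * (norm x)\<^sup>2) * (pd b f x + ((2 * of_real pi * \<i> * of_real (b \<bullet> v)) * f x
        + (4 * of_real pi * \<i> * of_real a) * (of_real (x \<bullet> b) * f x))))) (at x)" for x
    unfolding frechet_eq_pd[symmetric] power2_norm_eq_inner
    by (auto intro!: derivative_eq_intros schwartz_has_derivative f simp: algebra_simps inner_commute)
qed (intro schwartz_add schwartz_cmult schwartz_coord schwartz_pd)

lemma schwartz_ee: "schwartz f \<Longrightarrow> schwartz (\<lambda>x. ee (x \<bullet> v) * f x)"
  using schwartz_phase[of f v 0] by simp

lemma schwartz_chirp: "schwartz f \<Longrightarrow> schwartz (\<lambda>x. ee (a * (norm x)\<^sup>2) * f x)"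
  using schwartz_phase[of f 0 a] by simp

lemma rapid_affine:
  fixes f :: "'a::real_normed_vector \<Rightarrow> complex"
  assumes "rapid f" "s \<noteq> 0"
  shows "rapid (\<lambda>x. f (s *\<^sub>R x + a))"
  unfolding rapid_def
proof
  fix k
  obtain C where C: "\<And>x. norm x ^ k * norm (f x) \<le> C" using assms unfolding rapid_def by meson
  obtain D where D: "\<And>x. norm x ^ 0 * norm (f x) \<le> D" using assms unfolding rapid_def by meson
  have "norm x ^ k * norm (f (s *\<^sub>R x + a)) \<le> (2 / \<bar>s\<bar>) ^ k * (C + norm a ^ k * D)" for x
  proof -
    let ?z = "s *\<^sub>R x + a"
    \<comment> \<open>Powers of \<open>norm x\<close> are traded for powers of
      \<open>norm ?z\<close>, where the decay of \<open>f\<close> is known, and of the constant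
      \<open>norm a\<close>.\<close>
    have "\<bar>s\<bar> * norm x = norm (?z - a)" by simp
    also have "\<dots> \<le> norm ?z + norm a" by (rule norm_triangle_ineq4)
    also have "\<dots> \<le> 2 * max (norm ?z) (norm a)" by simp
    finally have "norm x \<le> 2 / \<bar>s\<bar> * max (norm ?z) (norm a)" using assms(2) by (simp add: field_simps)
    then have "norm x ^ k \<le> (2 / \<bar>s\<bar>) ^ k * max (norm ?z) (norm a) ^ k"
      unfolding power_mult_distrib[symmetric] by (intro power_mono) auto
    also have "max (norm ?z) (norm a) ^ k \<le> norm ?z ^ k + norm a ^ k" by (simp add: max_def)
    finally have "norm x ^ k * norm (f ?z) \<le> (2 / \<bar>s\<bar>) ^ k * (norm ?z ^ k + norm a ^ k) * norm (f ?z)"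
      by (simp add: mult_left_mono mult_right_mono)
    also have "\<dots> = (2 / \<bar>s\<bar>) ^ k * (norm ?z ^ k * norm (f ?z) + norm a ^ k * norm (f ?z))"
      by (simp only: algebra_simps)
    also have "\<dots> \<le> (2 / \<bar>s\<bar>) ^ k * (C + norm a ^ k * D)"
      using C[of ?z] D[of ?z] by (intro mult_left_mono add_mono) auto
    finally show ?thesis .
  qed
  then show "\<exists>C. \<forall>x. norm x ^ k * norm (f (s *\<^sub>R x + a)) \<le> C" by blast
qed

lemma has_derivative_affine:
  assumes "smooth f"
  shows "((\<lambda>x. f (s *\<^sub>R x + a)) has_derivative (\<lambda>b. of_real s * pd b f (s *\<^sub>R x + a))) (at x)"
proof -
  have "((\<lambda>x. f (s *\<^sub>R x + a)) has_derivative (\<lambda>b. frechet_derivative f (at (s *\<^sub>R x + a)) (s *\<^sub>R b))) (at x)"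
    by (rule has_derivative_compose[where g = f])
       (auto intro!: derivative_eq_intros smooth_has_derivative assms)
  moreover have "frechet_derivative f (at (s *\<^sub>R x + a)) (s *\<^sub>R b) = of_real s * pd b f (s *\<^sub>R x + a)" for b
    using linear_scale[OF linear_frechet_derivative[OF smooth_differentiable[OF assms]]]
    by (simp add: pd_def scaleR_conv_of_real)
  ultimately show ?thesis by simp
qed

lemma schwartz_affine:
  assumes "schwartz f" "s \<noteq> 0"
  shows "schwartz (\<lambda>x. f (s *\<^sub>R x + a))"
proof (rule schwartz_mapI[where T = "\<lambda>f x. f (s *\<^sub>R x + a)" and S = "\<lambda>b f x. of_real s * pd b f x"])
  show "((\<lambda>x. f (s *\<^sub>R x + a)) has_derivative (\<lambda>b. of_real s * pd b f (s *\<^sub>R x + a))) (at x)"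
    if "schwartz f" for f :: "'a \<Rightarrow> complex" and x
    using that by (intro has_derivative_affine schwartz_smooth)
qed (use assms in \<open>auto intro: rapid_affine schwartz_rapid schwartz_cmult schwartz_pd\<close>)

lemma schwartz_shift: "schwartz f \<Longrightarrow> schwartz (\<lambda>x. f (x - a))"
  using schwartz_affine[of f 1 "- a"] by simp

lemma schwartz_reflect: "schwartz f \<Longrightarrow> schwartz (\<lambda>x. f (a - x))"
  using schwartz_affine[of f "-1" a] by simp

lemma schwartz_scale: "schwartz f \<Longrightarrow> s \<noteq> 0 \<Longrightarrow> schwartz (\<lambda>x. f (s *\<^sub>R x))"
  using schwartz_affine[of f s 0] by simp

section \<open>Test functions are Schwartz functions\<close>

lemma test_function_pd:
  assumes "test_function f" "b \<in> Basis"
  shows "test_function (pd b f)"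
proof -
  have sm: "smooth f" and K: "compact (closure {x. f x \<noteq> 0})" using assms by (auto simp: test_function_def)
  \<comment> \<open>Outside its closed support \<open>f\<close> agrees with the zero function on an
    open set, so differentiation cannot enlarge the support.\<close>
  have "pd b f x = 0" if "x \<notin> closure {x. f x \<noteq> 0}" for x
  proof -
    have z: "0 = f y" if "y \<in> - closure {x. f x \<noteq> 0}" for y
      using that closure_subset[of "{x. f x \<noteq> 0}"] by auto
    have "(f has_derivative (\<lambda>_. 0)) (at x)"
    proof (rule has_derivative_transform_within_open[OF has_derivative_const[of 0] _ _ z])
      show "open (- closure {x. f x \<noteq> 0})" by (simp add: open_Compl)
    qed (use that in simp_all)
    then show ?thesis unfolding pd_def by (metis frechet_derivative_at)
  qed
  then have "{x. pd b f x \<noteq> 0} \<subseteq> closure {x. f x \<noteq> 0}" by auto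
  then have "closure {x. pd b f x \<noteq> 0} \<subseteq> closure {x. f x \<noteq> 0}"
    by (simp add: closure_minimal)
  then have "compact (closure {x. pd b f x \<noteq> 0})"
    using K compact_Int_closed[OF K closed_closure[of "{x. pd b f x \<noteq> 0}"]] by (simp add: Int_absorb1)
  then show ?thesis using smooth_pd[OF sm assms(2)] by (simp add: test_function_def)
qed

lemma test_function_rapid:
  assumes "test_function f"
  shows "rapid f"
  unfolding rapid_def
proof
  fix k
  let ?K = "closure {x. f x \<noteq> 0}"
  have "continuous_on ?K (\<lambda>x. norm x ^ k * norm (f x))"
    using assms by (intro continuous_intros smooth_continuous) (auto simp: test_function_def)
  then have "bounded ((\<lambda>x. norm x ^ k * norm (f x)) ` ?K)"
    using assms by (intro compact_imp_bounded compact_continuous_image) (auto simp: test_function_def)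
  then obtain C where C: "\<And>x. x \<in> ?K \<Longrightarrow> norm x ^ k * norm (f x) \<le> C"
    unfolding bounded_iff by fastforce
  have "norm x ^ k * norm (f x) \<le> max C 0" for x
  proof (cases "x \<in> ?K")
    case False
    then have "f x = 0" using closure_subset by force
    then show ?thesis by simp
  qed (use C[of x] in auto)
  then show "\<exists>C. \<forall>x. norm x ^ k * norm (f x) \<le> C" by blast
qed

lemma test_function_schwartz:
  assumes "test_function f"
  shows "schwartz f"
proof (rule schwartz_coinduct[where Q = test_function])
  show "f differentiable (at x)" if "test_function f" for f :: "'a \<Rightarrow> complex" and x
    using that by (simp add: test_function_def smooth_differentiable)
qed (use assms test_function_pd test_function_rapid in auto)

lemma smooth_affine:
  assumes "smooth f"
  shows "smooth (\<lambda>x. c * f (s *\<^sub>R x + a))"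
proof -
  let ?Q = "\<lambda>h. \<exists>f c. smooth f \<and> h = (\<lambda>x. c * f (s *\<^sub>R x + a))"
  have D: "((\<lambda>x. c * f (s *\<^sub>R x + a)) has_derivative (\<lambda>b. c * (of_real s * pd b f (s *\<^sub>R x + a)))) (at x)"
    if "smooth f" for x f c
    by (intro has_derivative_mult_right has_derivative_affine that)
  show ?thesis
  proof (rule smooth_coinduct[where Q = ?Q])
    show "?Q (\<lambda>x. c * f (s *\<^sub>R x + a))" using assms by blast
    show "h differentiable (at x)" if "?Q h" for h x
      using that D by (auto simp: differentiable_def)
    show "?Q (pd b h)" if hQ: "?Q h" and b: "b \<in> Basis" for h b
    proof -
      from hQ obtain f c where f: "smooth f" and h: "h = (\<lambda>x. c * f (s *\<^sub>R x + a))" by blast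
      have "pd b h = (\<lambda>x. (c * of_real s) * pd b f (s *\<^sub>R x + a))"
        unfolding h pd_eqI[OF D[OF f]] by (simp add: mult_ac)
      then show ?thesis using smooth_pd[OF f b] by blast
    qed
  qed
qed

lemma test_function_affine:
  assumes "test_function f" "s \<noteq> 0"
  shows "test_function (\<lambda>x. c * f (s *\<^sub>R x + a))"
proof -
  have "bounded {x. f x \<noteq> 0}"
    using assms by (simp add: test_function_def)
  then obtain B where B: "\<And>x. f x \<noteq> 0 \<Longrightarrow> norm x \<le> B" unfolding bounded_iff by auto
  have "norm x \<le> (B + norm a) / \<bar>s\<bar>" if "c * f (s *\<^sub>R x + a) \<noteq> 0" for x
  proof -
    have "\<bar>s\<bar> * norm x = norm ((s *\<^sub>R x + a) - a)" by simp
    also have "\<dots> \<le> B + norm a"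
      using B[of "s *\<^sub>R x + a"] that norm_triangle_ineq4[of "s *\<^sub>R x + a" a] by auto
    finally show ?thesis using assms(2) by (simp add: field_simps)
  qed
  then have "bounded {x. c * f (s *\<^sub>R x + a) \<noteq> 0}" unfolding bounded_iff by blast
  then show ?thesis using assms smooth_affine[of f c s a] by (simp add: test_function_def)
qed

section \<open>Integrability\<close>

lemma nn_integral_lborel_affine:
  fixes f :: "'a::euclidean_space \<Rightarrow> ennreal"
  assumes [measurable]: "f \<in> borel_measurable borel" and c: "c \<noteq> 0"
  shows "(\<integral>\<^sup>+x. f x \<partial>lborel) = ennreal (\<bar>c\<bar> ^ DIM('a)) * (\<integral>\<^sup>+x. f (t + c *\<^sub>R x) \<partial>lborel)"
  by (subst lborel_affine[OF c, of t])
     (simp add: nn_integral_density nn_integral_distr nn_integral_cmult)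

lemma integral_lborel_affine:
  fixes f :: "'a::euclidean_space \<Rightarrow> 'b::{banach, second_countable_topology}"
  assumes [measurable]: "f \<in> borel_measurable borel" and c: "c \<noteq> 0"
  shows "(\<integral>x. f x \<partial>lborel) = \<bar>c\<bar> ^ DIM('a) *\<^sub>R (\<integral>x. f (t + c *\<^sub>R x) \<partial>lborel)"
  by (subst lborel_affine[OF c, of t])
     (simp add: integral_density integral_distr)

lemma integral_lborel_shift:
  fixes f :: "'a::euclidean_space \<Rightarrow> 'b::{banach, second_countable_topology}"
  assumes "f \<in> borel_measurable borel"
  shows "(\<integral>x. f (x + t) \<partial>lborel) = (\<integral>x. f x \<partial>lborel)" "(\<integral>x. f (x - t) \<partial>lborel) = (\<integral>x. f x \<partial>lborel)"
  using integral_lborel_affine[OF assms, of 1 t] integral_lborel_affine[OF assms, of 1 "- t"]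
  by (simp_all add: add.commute)

lemma integral_lborel_reflect:
  fixes f :: "'a::euclidean_space \<Rightarrow> 'b::{banach, second_countable_topology}"
  assumes "f \<in> borel_measurable borel"
  shows "(\<integral>x. f (t - x) \<partial>lborel) = (\<integral>x. f x \<partial>lborel)"
  using integral_lborel_affine[OF assms, of "-1" t] by simp

lemma nn_integral_lborel_shift:
  fixes f :: "'a::euclidean_space \<Rightarrow> ennreal"
  assumes "f \<in> borel_measurable borel"
  shows "(\<integral>\<^sup>+x. f (x + t) \<partial>lborel) = (\<integral>\<^sup>+x. f x \<partial>lborel)" "(\<integral>\<^sup>+x. f (x - t) \<partial>lborel) = (\<integral>\<^sup>+x. f x \<partial>lborel)"
  using nn_integral_lborel_affine[OF assms, of 1 t] nn_integral_lborel_affine[OF assms, of 1 "- t"]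
  by (simp_all add: add.commute)

text \<open>A product of one-dimensional Lorentzians in place of a power of
  \<open>1 + norm x\<close>: its integral factors over the coordinates, even after scaling, and
  \<open>wgt_mult_le\<close> holds coordinate by coordinate.\<close>

definition wgt :: "'a::euclidean_space \<Rightarrow> real" where
  "wgt x = (\<Prod>b\<in>Basis. 1 / (1 + (x \<bullet> b)\<^sup>2))"

lemma one_plus_square_pos [simp]: "0 < 1 + (r::real)\<^sup>2"
  by (simp add: add_pos_nonneg)

lemma wgt_pos [simp]: "0 < wgt x"
  unfolding wgt_def by (intro prod_pos) simp

lemma wgt_nonneg [simp]: "0 \<le> wgt x"
  by (simp add: less_imp_le)

lemma wgt_le_1 [simp]: "wgt x \<le> 1"
  unfolding wgt_def by (intro prod_le_1) auto

lemma wgt_measurable [measurable]: "wgt \<in> borel_measurable borel"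
  unfolding wgt_def[abs_def] by measurable

text \<open>A Peetre-type inequality, with one factor 2 for each coordinate. It turns decay of two
  functions into decay in their relative displacement \<open>z\<close>.\<close>

lemma wgt_mult_le:
  fixes x z :: "'a::euclidean_space"
  shows "wgt x * wgt (z - x) \<le> 2 ^ DIM('a) * wgt z"
proof -
  have *: "1 / (1 + a\<^sup>2) * (1 / (1 + (c - a)\<^sup>2)) \<le> 2 * (1 / (1 + c\<^sup>2))" for a c :: real
  proof -
    \<comment> \<open>This sum of squares is exactly the difference of the two sides of the next
      line.\<close>
    have "0 \<le> (2 * a - c)\<^sup>2 + (a * (c - a) )\<^sup>2 * 2 + 1" by simp
    then have "1 + c\<^sup>2 \<le> 2 * ((1 + a\<^sup>2) * (1 + (c - a)\<^sup>2))"
      by (simp add: power2_eq_square algebra_simps)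
    then show ?thesis by (simp add: divide_simps)
  qed
  have "wgt x * wgt (z - x) = (\<Prod>b\<in>Basis. 1 / (1 + (x \<bullet> b)\<^sup>2) * (1 / (1 + (z \<bullet> b - x \<bullet> b)\<^sup>2)))"
    unfolding wgt_def by (simp only: prod.distrib inner_diff_left)
  also have "\<dots> \<le> (\<Prod>b\<in>(Basis::'a set). 2 * (1 / (1 + (z \<bullet> b)\<^sup>2)))"
    by (intro prod_mono conjI *) simp
  also have "\<dots> = 2 ^ DIM('a) * wgt z"
    unfolding wgt_def by (simp only: prod.distrib prod_constant)
  finally show ?thesis .
qed

text \<open>\<open>K\<close> is the integral of \<open>1 / (1 + x^2)\<close> over the line, and
  scaling divides it by \<open>c\<close> in each coordinate. With \<open>c\<close> of size
  \<open>1 / (1 + \<bar>t\<bar>)\<close> this is where the power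
  \<open>(1 + \<bar>t\<bar>)^d\<close> originates.\<close>

lemma nn_integral_wgt_scaled:
  obtains K where "0 < K"
    "\<And>c. 0 < c \<Longrightarrow> (\<integral>\<^sup>+x. ennreal (\<Prod>b\<in>Basis. 1 / (1 + (c * ((x::'a::euclidean_space) \<bullet> b))\<^sup>2)) \<partial>lborel) = ennreal ((K / c) ^ DIM('a))"
proof -
  have int: "integrable lborel (\<lambda>x::real. 1 / (1 + x\<^sup>2))"
    using integrable_inverse_1_plus_square
    by (simp add: set_integrable_def einterval_def divide_inverse)
  define K where "K = (\<integral>x. 1 / (1 + (x::real)\<^sup>2) \<partial>lborel)"
  have K: "0 \<le> K" "(\<integral>\<^sup>+x. ennreal (1 / (1 + (x::real)\<^sup>2)) \<partial>lborel) = ennreal K"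
    unfolding K_def using nn_integral_eq_integral[OF int]
    by (auto intro!: Bochner_Integration.integral_nonneg)
  have "K \<noteq> 0"
  proof
    assume "K = 0"
    then have "AE x::real in lborel. ennreal (1 / (1 + x\<^sup>2)) = 0"
      using K nn_integral_0_iff_AE[of "\<lambda>x::real. ennreal (1 / (1 + x\<^sup>2))" lborel] by simp
    moreover have "ennreal (1 / (1 + x\<^sup>2)) \<noteq> 0" for x :: real
      by (simp add: ennreal_eq_0_iff not_le)
    ultimately have "AE x::real in lborel. False" by simp
    then show False by (simp add: eventually_False ae_filter_eq_bot_iff)
  qed
  have s: "(\<integral>\<^sup>+x. ennreal (1 / (1 + (c * (x::real))\<^sup>2)) \<partial>lborel) = ennreal (K / c)" if "0 < c" for c
  proof -
    let ?I = "\<integral>\<^sup>+x. ennreal (1 / (1 + (c * (x::real))\<^sup>2)) \<partial>lborel"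
    have "ennreal K = ennreal c * ?I"
      using nn_integral_real_affine[of "\<lambda>x. ennreal (1 / (1 + x\<^sup>2))" c 0] K that by simp
    then have "ennreal (1 / c) * ennreal K = (ennreal (1 / c) * ennreal c) * ?I" by (simp only: mult.assoc)
    moreover have "ennreal (1 / c) * ennreal c = 1" using that by (simp add: ennreal_mult'[symmetric])
    ultimately show ?thesis using that K by (simp add: ennreal_mult'[symmetric])
  qed
  show thesis
  proof (rule that)
    show "0 < K" using K \<open>K \<noteq> 0\<close> by simp
    fix c :: real assume c: "0 < c"
    have "(\<integral>\<^sup>+x. ennreal (\<Prod>b\<in>Basis. 1 / (1 + (c * ((x::'a) \<bullet> b))\<^sup>2)) \<partial>lborel)
        = (\<integral>\<^sup>+x. (\<Prod>b\<in>Basis. ennreal (1 / (1 + (c * ((x::'a) \<bullet> b))\<^sup>2))) \<partial>lborel)"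
      by (simp add: prod_ennreal)
    also have "\<dots> = (\<Prod>b\<in>(Basis::'a set). ennreal (K / c))"
      by (subst nn_integral_lborel_prod[of "\<lambda>b x. ennreal (1 / (1 + (c * x)\<^sup>2))"]) (use s c in auto)
    also have "\<dots> = ennreal ((K / c) ^ DIM('a))"
      using c K by (simp add: ennreal_power)
    finally show "(\<integral>\<^sup>+x. ennreal (\<Prod>b\<in>Basis. 1 / (1 + (c * ((x::'a) \<bullet> b))\<^sup>2)) \<partial>lborel) = ennreal ((K / c) ^ DIM('a))" .
  qed
qed

lemma integrable_wgt: "integrable lborel wgt"
proof (rule integrableI_nonneg)
  obtain K where K: "0 < K" "\<And>c. 0 < c \<Longrightarrow> (\<integral>\<^sup>+x. ennreal (\<Prod>b\<in>Basis. 1 / (1 + (c * ((x::'a) \<bullet> b))\<^sup>2)) \<partial>lborel) = ennreal ((K / c) ^ DIM('a))"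
    using nn_integral_wgt_scaled[where 'a='a] by metis
  show "(\<integral>\<^sup>+ x. ennreal (wgt (x::'a)) \<partial>lborel) < \<infinity>"
    using K(2)[of 1] by (simp add: wgt_def)
qed auto

text \<open>Each coordinate is at most \<open>norm x\<close>, so \<open>1 / wgt x\<close> is at most
  \<open>(1 + norm x ^ 2) ^ d\<close>. Hence bounds with the powers 0 and \<open>2 * m * d\<close>
  of the norm suffice for decay like \<open>wgt ^ m\<close>.\<close>

lemma decay_wgt:
  fixes x :: "'a::euclidean_space"
  assumes "r \<le> A" "norm x ^ (2 * (m * DIM('a))) * r \<le> B" "0 \<le> r"
  shows "r \<le> 2 ^ (m * DIM('a)) * (A + B) * wgt x ^ m"
proof -
  let ?n = "m * DIM('a)"
  have "1 / wgt x = (\<Prod>b\<in>Basis. 1 + (x \<bullet> b)\<^sup>2)" by (simp add: wgt_def prod_dividef)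
  also have "\<dots> \<le> (\<Prod>b\<in>(Basis::'a set). 1 + (norm x)\<^sup>2)"
    by (intro prod_mono conjI add_left_mono) (auto simp: Basis_le_norm abs_le_square_iff[symmetric])
  also have "\<dots> = (1 + (norm x)\<^sup>2) ^ DIM('a)" by simp
  finally have "(1 / wgt x) ^ m \<le> ((1 + (norm x)\<^sup>2) ^ DIM('a)) ^ m" by (intro power_mono) auto
  also have "\<dots> = (1 + (norm x)\<^sup>2) ^ ?n" by (simp add: power_mult[symmetric] mult.commute)
  also have "\<dots> \<le> (2 * max 1 ((norm x)\<^sup>2)) ^ ?n" by (intro power_mono) auto
  also have "\<dots> \<le> 2 ^ ?n * (1 + norm x ^ (2 * ?n))"
    by (simp add: power_mult_distrib max_def power_mult[symmetric])
  finally have "(1 / wgt x) ^ m * r \<le> 2 ^ ?n * (1 + norm x ^ (2 * ?n)) * r"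
    using assms(3) by (rule mult_right_mono)
  also have "\<dots> = 2 ^ ?n * (r + norm x ^ (2 * ?n) * r)" by (simp add: algebra_simps)
  also have "\<dots> \<le> 2 ^ ?n * (A + B)" using assms by (intro mult_left_mono add_mono) auto
  finally show ?thesis by (simp add: power_divide field_simps)
qed

lemma rapid_wgt:
  fixes f :: "'a::euclidean_space \<Rightarrow> complex"
  assumes "rapid f"
  obtains C where "0 < C" "\<And>x. norm (f x) \<le> C * wgt x ^ m"
proof -
  obtain A B where "0 < A" "\<And>x. norm x ^ 0 * norm (f x) \<le> A"
    "0 < B" "\<And>x. norm x ^ (2 * (m * DIM('a))) * norm (f x) \<le> B"
    using rapidD[OF assms, of 0] rapidD[OF assms, of "2 * (m * DIM('a))"] by metis
  then show thesis by (intro that[of "2 ^ (m * DIM('a)) * (A + B)"] decay_wgt) auto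
qed

lemma schwartz_bounded:
  assumes "schwartz f"
  obtains C where "0 < C" "\<And>x. norm (f x) \<le> C"
  using rapidD[OF schwartz_rapid[OF assms], of 0] by auto

lemma schwartz_integrable:
  assumes "schwartz f"
  shows "integrable lborel f"
proof -
  obtain C where C: "\<And>x. norm (f x) \<le> C * wgt x ^ 1" using rapid_wgt[OF schwartz_rapid[OF assms]] by metis
  have "norm (f x) \<le> norm (C * wgt x)" for x
    using C[of x] by simp
  then show ?thesis
    using schwartz_measurable[OF assms]
    by (intro Bochner_Integration.integrable_bound[where f = "\<lambda>x. C * wgt x", OF integrable_mult_right[OF integrable_wgt]]) simp_all
qed

section \<open>Schwartz seminorms\<close>

lemma finite_multiindices: "finite {bs :: 'a::euclidean_space list. set bs \<subseteq> Basis \<and> length bs \<le> N}"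
  by (rule finite_lists_length_le) simp

text \<open>The suprema in \<open>schwartz_norm\<close> are real-valued, so they are meaningful only
  once boundedness is established; then one nonnegative term is at most the finite sum.\<close>

lemma schwartz_norm_ge:
  fixes f :: "'a::euclidean_space \<Rightarrow> complex"
  assumes "schwartz f" "k \<le> N" "set bs \<subseteq> Basis" "length bs \<le> N"
  shows "norm x ^ k * cmod (iter_partial bs f x) \<le> schwartz_norm N f"
proof -
  have bdd: "bdd_above (range (\<lambda>x. norm x ^ k * cmod (iter_partial bs f x)))" if "set bs \<subseteq> Basis" for bs k
  proof -
    have "rapid (iter_partial bs f)" using assms(1) that by (simp add: schwartz_alt)
    then show ?thesis unfolding rapid_def bdd_above_def by auto
  qed
  have nn: "0 \<le> (SUP x. norm x ^ k * cmod (iter_partial bs f x))" if "set bs \<subseteq> Basis" for bs k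
    by (rule cSUP_upper2[OF bdd[OF that], of undefined]) auto
  have "norm x ^ k * cmod (iter_partial bs f x) \<le> (SUP x. norm x ^ k * cmod (iter_partial bs f x))"
    by (rule cSUP_upper[OF _ bdd]) (use assms in auto)
  also have "\<dots> \<le> (\<Sum>bs | set bs \<subseteq> Basis \<and> length bs \<le> N. SUP x. norm x ^ k * cmod (iter_partial bs f x))"
    by (rule member_le_sum[of bs]) (use assms nn finite_multiindices in auto)
  also have "\<dots> \<le> schwartz_norm N f"
    unfolding schwartz_norm_def
    by (rule member_le_sum[of k _ "\<lambda>k. \<Sum>bs | set bs \<subseteq> Basis \<and> length bs \<le> N. SUP x. norm x ^ k * cmod (iter_partial bs f x)"])
       (use assms nn in \<open>auto intro!: sum_nonneg\<close>)
  finally show ?thesis .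
qed

lemma schwartz_norm_nonneg: "schwartz f \<Longrightarrow> 0 \<le> schwartz_norm N f"
  using schwartz_norm_ge[of f 0 N "[]" undefined] by (auto intro: order_trans[rotated])

lemma schwartz_norm_le:
  fixes f :: "'a::euclidean_space \<Rightarrow> complex"
  assumes "\<And>k bs x. k \<le> N \<Longrightarrow> set bs \<subseteq> Basis \<Longrightarrow> length bs \<le> N \<Longrightarrow> norm x ^ k * cmod (iter_partial bs f x) \<le> C"
  shows "schwartz_norm N f \<le> (\<Sum>k\<le>N. \<Sum>bs | set bs \<subseteq> (Basis::'a set) \<and> length bs \<le> N. C)"
  unfolding schwartz_norm_def by (intro sum_mono cSUP_least) (use assms in auto)

lemma schwartz_norm_mono:
  fixes N M :: nat
  assumes "N \<le> M"
  obtains K where "0 \<le> K" "\<And>f::'a::euclidean_space \<Rightarrow> complex. schwartz f \<Longrightarrow> schwartz_norm N f \<le> K * schwartz_norm M f"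
proof -
  \<comment> \<open>The number of terms in \<open>schwartz_norm N\<close>.\<close>
  let ?K = "\<Sum>k\<le>N. \<Sum>bs | set bs \<subseteq> (Basis::'a set) \<and> length bs \<le> N. 1 :: real"
  show thesis
  proof (rule that[of ?K])
    show "schwartz_norm N f \<le> ?K * schwartz_norm M f" if "schwartz f" for f :: "'a \<Rightarrow> complex"
      using schwartz_norm_le[of N f "schwartz_norm M f"] schwartz_norm_ge[OF that] assms
      by (simp add: sum_distrib_right)
  qed (auto intro!: sum_nonneg)
qed

lemma schwartz_norm_pd:
  obtains K where "0 \<le> K" "\<And>f b. schwartz f \<Longrightarrow> b \<in> (Basis::'a::euclidean_space set) \<Longrightarrow> schwartz_norm N (pd b f) \<le> K * schwartz_norm (Suc N) f"
proof -
  let ?K = "\<Sum>k\<le>N. \<Sum>bs | set bs \<subseteq> (Basis::'a set) \<and> length bs \<le> N. 1 :: real"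
  show thesis
  proof (rule that[of ?K])
    fix f :: "'a \<Rightarrow> complex" and b :: 'a
    assume f: "schwartz f" "b \<in> Basis"
    have "norm x ^ k * cmod (iter_partial bs (pd b f) x) \<le> schwartz_norm (Suc N) f"
      if "k \<le> N" "set bs \<subseteq> Basis" "length bs \<le> N" for k bs x
      unfolding iter_partial_snoc[symmetric]
      by (rule schwartz_norm_ge) (use f that in auto)
    then show "schwartz_norm N (pd b f) \<le> ?K * schwartz_norm (Suc N) f"
      using schwartz_norm_le[of N "pd b f" "schwartz_norm (Suc N) f"] by (simp add: sum_distrib_right)
  qed (auto intro!: sum_nonneg)
qed

text \<open>Integrability with a constant uniform in \<open>f\<close>; the continuity clause of
  \<open>tempered\<close> needs this quantitative form. The order \<open>2 * d\<close> is what
  \<open>decay_wgt\<close> asks for with \<open>m = 1\<close>.\<close>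

lemma integral_norm_schwartz_le:
  "\<exists>K N. 0 \<le> K \<and> (\<forall>f::'a::euclidean_space \<Rightarrow> complex. schwartz f \<longrightarrow> (LINT x|lborel. norm (f x)) \<le> K * schwartz_norm N f)"
proof -
  let ?n = "DIM('a)" and ?W = "LINT x|lborel. wgt (x::'a)"
  have W: "0 \<le> ?W" by (intro Bochner_Integration.integral_nonneg) auto
  show ?thesis
  proof (rule exI[of _ "2 ^ ?n * 2 * ?W"], rule exI[of _ "2 * ?n"], intro conjI allI impI)
    fix f :: "'a \<Rightarrow> complex" assume f: "schwartz f"
    let ?S = "schwartz_norm (2 * ?n) f"
    have "norm (f x) \<le> 2 ^ (1 * ?n) * (?S + ?S) * wgt x ^ 1" for x
      using schwartz_norm_ge[OF f, of 0 "2 * ?n" "[]" x] schwartz_norm_ge[OF f, of "2 * ?n" "2 * ?n" "[]" x]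
      by (intro decay_wgt) auto
    then have "(LINT x|lborel. norm (f x)) \<le> (LINT x|lborel. 2 ^ ?n * (?S + ?S) * wgt (x::'a))"
      using schwartz_integrable[OF f] integrable_wgt by (intro integral_mono_AE) auto
    then show "(LINT x|lborel. norm (f x)) \<le> (2 ^ ?n * 2 * ?W) * ?S" by (simp add: algebra_simps)
  qed (use W in auto)
qed

section \<open>Fourier transform of Schwartz functions\<close>

lemma ee_inner_measurable [measurable]:
  "(\<lambda>x. ee (- (x \<bullet> w))) \<in> borel_measurable borel" "(\<lambda>x. ee (x \<bullet> w)) \<in> borel_measurable borel"
  by (intro borel_measurable_continuous_onI continuous_intros)+

lemma integrable_mult_ee:
  assumes "integrable lborel f"
  shows "integrable lborel (\<lambda>x. f x * ee (- (x \<bullet> w)))" "integrable lborel (\<lambda>x. f x * ee (x \<bullet> w))"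
proof -
  have [measurable]: "f \<in> borel_measurable borel" using assms by auto
  show "integrable lborel (\<lambda>x. f x * ee (- (x \<bullet> w)))" "integrable lborel (\<lambda>x. f x * ee (x \<bullet> w))"
    by (rule Bochner_Integration.integrable_bound[OF assms]; auto simp: norm_mult)+
qed

lemma norm_fourier_le: "norm (fourier f w) \<le> (LINT x|lborel. norm (f x))"
  unfolding fourier_eq by (rule order_trans[OF integral_norm_bound]) (simp add: norm_mult)

text \<open>Difference quotients have integral zero by translation invariance. The mean value
  inequality dominates them by a multiple of \<open>wgt\<close>, so the limit can be taken under the
  integral.\<close>

lemma integral_pd_eq_0:
  fixes f :: "'a::euclidean_space \<Rightarrow> complex"
  assumes f: "schwartz f" and b: "b \<in> Basis"
  shows "(LINT x|lborel. pd b f x) = 0"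
proof -
  obtain C where C: "0 < C" "\<And>x. norm (pd b f x) \<le> C * wgt x ^ 1"
    using rapid_wgt[OF schwartz_rapid[OF schwartz_pd[OF f b]]] by metis
  \<comment> \<open>A shift by at most one basis vector costs \<open>2 ^ d\<close> through
    \<open>wgt_mult_le\<close> and another \<open>2 ^ d\<close> because \<open>wgt\<close> is at
    least \<open>(1/2) ^ d\<close> at such a shift.\<close>
  let ?D = "4 ^ DIM('a)"
  have w: "wgt (x + r *\<^sub>R b) \<le> ?D * wgt x" if "0 \<le> r" "r \<le> 1" for x r
  proof -
    have "(1 + (((-r) *\<^sub>R b) \<bullet> b')\<^sup>2) \<le> 2" if "b' \<in> Basis" for b'
      using that b \<open>0 \<le> r\<close> \<open>r \<le> 1\<close> by (auto simp: inner_Basis abs_square_le_1)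
    then have "(\<Prod>b'\<in>(Basis::'a set). 1 / 2) \<le> wgt ((-r) *\<^sub>R b)"
      unfolding wgt_def by (intro prod_mono) (auto intro!: divide_left_mono)
    then have "(1/2) ^ DIM('a) * wgt (x + r *\<^sub>R b) \<le> wgt ((-r) *\<^sub>R b) * wgt (x + r *\<^sub>R b)"
      by (intro mult_right_mono) auto
    also have "\<dots> \<le> 2 ^ DIM('a) * wgt x"
      using wgt_mult_le[of "(-r) *\<^sub>R b" x] by simp
    finally have "2 ^ DIM('a) * ((1/2) ^ DIM('a) * wgt (x + r *\<^sub>R b)) \<le> 2 ^ DIM('a) * (2 ^ DIM('a) * wgt x)"
      by (intro mult_left_mono) auto
    then show ?thesis by (simp add: mult.assoc[symmetric] power_mult_distrib[symmetric])
  qed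
  define s :: "nat \<Rightarrow> real" where "s n = 1 / Suc n" for n
  have s: "0 < s n" "s n \<le> 1" for n by (auto simp: s_def)
  define q where "q n x = (f (x + s n *\<^sub>R b) - f x) / of_real (s n)" for n x
  have dr: "((\<lambda>r. f (x + r *\<^sub>R b)) has_derivative (\<lambda>h. of_real h * pd b f (x + r *\<^sub>R b))) (at r within S)" for x r S
  proof -
    have "((\<lambda>r. f (x + r *\<^sub>R b)) has_derivative (\<lambda>h. frechet_derivative f (at (x + r *\<^sub>R b)) (h *\<^sub>R b))) (at r within S)"
      by (rule has_derivative_compose[where g = f])
         (auto intro!: derivative_eq_intros schwartz_has_derivative f)
    moreover have "frechet_derivative f (at (x + r *\<^sub>R b)) (h *\<^sub>R b) = of_real h * pd b f (x + r *\<^sub>R b)" for h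
      using linear_scale[OF linear_frechet_derivative[OF schwartz_differentiable[OF f]]]
      by (simp add: pd_def scaleR_conv_of_real)
    ultimately show ?thesis by simp
  qed
  have bound: "norm (q n x) \<le> C * ?D * wgt x" for n x
  proof -
    have "norm (f (x + s n *\<^sub>R b) - f (x + 0 *\<^sub>R b)) \<le> (C * ?D * wgt x) * norm (s n - 0)"
    proof (rule differentiable_bound[of "{0..s n}" "\<lambda>r. f (x + r *\<^sub>R b)" "\<lambda>r h. of_real h * pd b f (x + r *\<^sub>R b)"])
      fix r assume r: "r \<in> {0..s n}"
      have "norm (pd b f (x + r *\<^sub>R b)) \<le> C * (?D * wgt x)"
      proof (rule order_trans)
        show "norm (pd b f (x + r *\<^sub>R b)) \<le> C * wgt (x + r *\<^sub>R b)" using C(2)[of "x + r *\<^sub>R b"] by simp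
        show "C * wgt (x + r *\<^sub>R b) \<le> C * (?D * wgt x)"
          using C(1) r s(2)[of n] by (intro mult_left_mono w) auto
      qed
      then show "onorm (\<lambda>h. of_real h * pd b f (x + r *\<^sub>R b)) \<le> C * ?D * wgt x"
      proof (intro onorm_le)
        fix h :: real
        assume le: "norm (pd b f (x + r *\<^sub>R b)) \<le> C * (?D * wgt x)"
        show "norm (of_real h * pd b f (x + r *\<^sub>R b)) \<le> C * ?D * wgt x * norm h"
          using mult_left_mono[OF le, of "\<bar>h\<bar>"] by (simp add: norm_mult mult_ac)
      qed
    qed (use s[of n] dr in auto)
    then show ?thesis using s[of n] by (simp add: q_def norm_divide field_simps)
  qed
  have lim: "(\<lambda>n. q n x) \<longlonglongrightarrow> pd b f x" for x
  proof -
    have "s \<longlonglongrightarrow> 0"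
      using LIMSEQ_inverse_real_of_nat unfolding s_def[abs_def] by (simp only: inverse_eq_divide)
    moreover have "s n \<noteq> 0" for n using s(1)[of n] by simp
    ultimately have "filterlim s (at 0) sequentially" by (simp add: filterlim_at)
    moreover have "((\<lambda>r. norm ((f (x + r *\<^sub>R b) - f (x + 0 *\<^sub>R b)) - of_real (r - 0) * pd b f (x + 0 *\<^sub>R b)) / norm (r - 0)) \<longlongrightarrow> 0) (at 0)"
      using dr[of x 0 UNIV] unfolding has_derivative_iff_norm by simp
    ultimately have "(\<lambda>n. norm ((f (x + s n *\<^sub>R b) - f (x + 0 *\<^sub>R b)) - of_real (s n - 0) * pd b f (x + 0 *\<^sub>R b)) / norm (s n - 0)) \<longlonglongrightarrow> 0"
      by (rule filterlim_compose[rotated])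
    moreover have "norm ((f (x + s n *\<^sub>R b) - f (x + 0 *\<^sub>R b)) - of_real (s n - 0) * pd b f (x + 0 *\<^sub>R b)) / norm (s n - 0)
        = norm (q n x - pd b f x)" for n
    proof -
      have "q n x - pd b f x = ((f (x + s n *\<^sub>R b) - f x) - of_real (s n) * pd b f x) / of_real (s n)"
        using s(1)[of n] by (simp add: q_def field_simps)
      then show ?thesis by (simp add: norm_divide)
    qed
    ultimately have "(\<lambda>n. norm (q n x - pd b f x)) \<longlonglongrightarrow> 0" by simp
    then show ?thesis by (rule LIM_zero_cancel[OF tendsto_norm_zero_cancel])
  qed
  have [measurable]: "f \<in> borel_measurable borel" "pd b f \<in> borel_measurable borel"
    using f b by (auto intro: schwartz_measurable schwartz_pd)
  have "(\<lambda>n. LINT x|lborel. q n x) \<longlonglongrightarrow> (LINT x|lborel. pd b f x)"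
  proof (rule integral_dominated_convergence[where w = "\<lambda>x. C * ?D * wgt x"])
    show "integrable lborel (\<lambda>x. C * ?D * wgt (x::'a))" using integrable_wgt by auto
    show "q n \<in> borel_measurable lborel" for n unfolding q_def[abs_def] by measurable
  qed (use lim bound in auto)
  moreover have "(LINT x|lborel. q n x) = 0" for n
  proof -
    have "integrable lborel (\<lambda>x. f (x + s n *\<^sub>R b))"
      using schwartz_integrable[OF schwartz_shift[OF f, of "- s n *\<^sub>R b"]] by simp
    then show ?thesis
      unfolding q_def using schwartz_integrable[OF f] integral_lborel_shift[of f] by simp
  qed
  ultimately have "(\<lambda>n. 0) \<longlonglongrightarrow> (LINT x|lborel. pd b f x)" by simp
  then show ?thesis by (metis LIMSEQ_const_iff)
qed

text \<open>Integration by parts: the derivative of \<open>f\<close> times the exponential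
  integrates to zero, and the product rule splits it into the two sides.\<close>

lemma fourier_pd:
  assumes f: "schwartz f" and b: "b \<in> Basis"
  shows "fourier (pd b f) w = (2 * pi * \<i> * of_real (w \<bullet> b)) * fourier f w"
proof -
  let ?e = "\<lambda>x. ee (- (x \<bullet> w))"
  let ?c = "2 * of_real pi * \<i> * of_real (w \<bullet> b)"
  have fe: "schwartz (\<lambda>x. f x * ?e x)"
    using schwartz_ee[OF f, of "- w"] by (simp add: mult.commute)
  have "((\<lambda>x. f x * ?e x) has_derivative (\<lambda>v. f x * ((2 * of_real pi * \<i> * of_real (- (v \<bullet> w))) * ?e x) + pd v f x * ?e x)) (at x)" for x
    unfolding frechet_eq_pd[symmetric]
    by (intro has_derivative_mult has_derivative_ee schwartz_has_derivative f has_derivative_minus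
        has_derivative_inner_left has_derivative_ident)
  from pd_eqI[OF this, of b]
  have "pd b (\<lambda>x. f x * ?e x) = (\<lambda>x. pd b f x * ?e x - ?c * (f x * ?e x))"
    by (simp add: algebra_simps inner_commute)
  then have "0 = (LINT x|lborel. pd b f x * ?e x - ?c * (f x * ?e x))"
    using integral_pd_eq_0[OF fe b] by simp
  also have "\<dots> = fourier (pd b f) w - ?c * fourier f w"
    unfolding fourier_eq
    using integrable_mult_ee(1)[OF schwartz_integrable[OF schwartz_pd[OF f b]], of w]
      integrable_mult_ee(1)[OF schwartz_integrable[OF f], of w]
    by simp
  finally show ?thesis by simp
qed

lemma ee_taylor: "norm (ee a - 1 - 2 * of_real pi * \<i> * of_real a) \<le> 2 * pi\<^sup>2 * a\<^sup>2"
  using iexp_approx1[of "2 * pi * a" 1]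
  by (simp add: ee_def cis_conv_exp power2_eq_square algebra_simps)

text \<open>Differentiation under the integral, with an explicit error: the second-order remainder
  of the exponential gives an error of size \<open>norm (y - w)\<close> squared times the second
  absolute moment of \<open>f\<close>.\<close>

lemma fourier_has_derivative:
  assumes f: "schwartz f"
  shows "(fourier f has_derivative (\<lambda>v. fourier (\<lambda>x. (- 2 * of_real pi * \<i>) * (of_real (x \<bullet> v) * f x)) w)) (at w)"
proof -
  let ?F = "\<lambda>v. fourier (\<lambda>x. (- 2 * of_real pi * \<i>) * (of_real (x \<bullet> v) * f x)) w"
  have S: "schwartz (\<lambda>x. (- 2 * of_real pi * \<i>) * (of_real (x \<bullet> v) * f x))" for v
    by (intro schwartz_cmult schwartz_coord f)
  have int: "integrable lborel (\<lambda>x. (- 2 * of_real pi * \<i>) * (of_real (x \<bullet> v) * f x) * ee (- (x \<bullet> w)))" for v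
    by (intro integrable_mult_ee schwartz_integrable S)
  have lin: "linear ?F"
  proof (rule linearI)
    show "?F (v + v') = ?F v + ?F v'" for v v'
      unfolding fourier_eq by (subst Bochner_Integration.integral_add[symmetric, OF int int])
        (auto intro!: Bochner_Integration.integral_cong simp: inner_add_right algebra_simps)
    show "?F (r *\<^sub>R v) = r *\<^sub>R ?F v" for r v
      unfolding fourier_eq by (subst Bochner_Integration.integral_scaleR_right[symmetric])
        (auto intro!: Bochner_Integration.integral_cong simp: scaleR_conv_of_real algebra_simps)
  qed
  obtain C where C: "0 < C" "\<And>x. norm x ^ 0 * norm (f x) \<le> C" using rapidD[OF schwartz_rapid[OF f]] by metis
  let ?g = "\<lambda>x. norm (of_real ((norm x)\<^sup>2) * f x)"
  \<comment> \<open>Writes the second moment integrand as a sum of functions already known to be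
    Schwartz, hence integrable.\<close>
  have sq: "of_real ((norm x)\<^sup>2) * f x = (\<Sum>b\<in>Basis. of_real (x \<bullet> b) * (of_real (x \<bullet> b) * f x))" for x
    unfolding power2_norm_eq_inner by (subst euclidean_inner) (simp add: sum_distrib_right mult.assoc)
  have ig: "integrable lborel ?g"
    unfolding sq by (intro integrable_norm Bochner_Integration.integrable_sum schwartz_integrable schwartz_coord f)
  define K where "K = (LINT x|lborel. 2 * pi\<^sup>2 * ?g x)"
  have K0: "0 \<le> K" unfolding K_def by (intro Bochner_Integration.integral_nonneg) auto
  have est: "norm (fourier f y - fourier f w - ?F (y - w)) \<le> K * (norm (y - w))\<^sup>2" for y
  proof -
    let ?h = "\<lambda>x. f x * ee (- (x \<bullet> y)) - f x * ee (- (x \<bullet> w)) - (- 2 * of_real pi * \<i>) * (of_real (x \<bullet> (y - w)) * f x) * ee (- (x \<bullet> w))"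
    have ih: "integrable lborel ?h"
      by (intro Bochner_Integration.integrable_diff integrable_mult_ee schwartz_integrable f int)
    have "fourier f y - fourier f w - ?F (y - w) = (LINT x|lborel. ?h x)"
      unfolding fourier_eq
      by (subst Bochner_Integration.integral_diff | intro Bochner_Integration.integrable_diff integrable_mult_ee schwartz_integrable f int refl)+
    also have "norm \<dots> \<le> (LINT x|lborel. (2 * pi\<^sup>2 * ?g x) * (norm (y - w))\<^sup>2)"
    proof (rule order_trans[OF integral_norm_bound Bochner_Integration.integral_mono])
      show "integrable lborel (\<lambda>x. norm (?h x))" using ih by (rule integrable_norm)
      show "integrable lborel (\<lambda>x. (2 * pi\<^sup>2 * ?g x) * (norm (y - w))\<^sup>2)" using ig by auto
      fix x
      let ?a = "- (x \<bullet> (y - w))"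
      have "ee (- (x \<bullet> y)) = ee ?a * ee (- (x \<bullet> w))"
        by (simp add: ee_add[symmetric] inner_diff_right)
      then have "?h x = f x * ee (- (x \<bullet> w)) * (ee ?a - 1 - 2 * of_real pi * \<i> * of_real ?a)"
        by (simp add: algebra_simps)
      then have "norm (?h x) \<le> norm (f x) * (2 * pi\<^sup>2 * ?a\<^sup>2)"
        using mult_left_mono[OF ee_taylor[of ?a], of "norm (f x)"] by (simp add: norm_mult)
      also have "\<dots> \<le> norm (f x) * (2 * pi\<^sup>2 * ((norm x)\<^sup>2 * (norm (y - w))\<^sup>2))"
        using Cauchy_Schwarz_ineq[of x "y - w"] by (intro mult_left_mono) (auto simp: power2_norm_eq_inner)
      also have "\<dots> = (2 * pi\<^sup>2 * ?g x) * (norm (y - w))\<^sup>2"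
        by (simp add: norm_mult norm_power)
      finally show "norm (?h x) \<le> (2 * pi\<^sup>2 * ?g x) * (norm (y - w))\<^sup>2" .
    qed
    also have "\<dots> = K * (norm (y - w))\<^sup>2" unfolding K_def by simp
    finally show ?thesis .
  qed
  show ?thesis
  proof (rule has_derivativeI_sandwich[where e = 1 and H = "\<lambda>y. K * norm (y - w)"])
    show "bounded_linear ?F" using lin by (simp add: linear_conv_bounded_linear)
    show "((\<lambda>y. K * norm (y - w)) \<longlongrightarrow> 0) (at w)"
      by (rule tendsto_eq_intros refl tendsto_norm_zero LIM_zero)+ simp
    show "norm (fourier f y - fourier f w - ?F (y - w)) / norm (y - w) \<le> K * norm (y - w)" if "y \<noteq> w" for y
      using est[of y] that by (simp add: divide_simps power2_eq_square mult.assoc)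
  qed simp
qed

text \<open>Each power of the norm is spread over the coordinates and converted into a derivative of
  \<open>f\<close> by \<open>fourier_pd\<close>. Keeping the seminorm of \<open>f\<close> on the
  right makes the bound usable for continuity of distributions.\<close>

lemma fourier_decay:
  "\<exists>K N. 0 \<le> K \<and> (\<forall>(f::'a::euclidean_space \<Rightarrow> complex) w. schwartz f \<longrightarrow> norm w ^ k * norm (fourier f w) \<le> K * schwartz_norm N f)"
proof (induction k)
    case 0
    obtain K N where "0 \<le> K" "\<And>f::'a \<Rightarrow> complex. schwartz f \<Longrightarrow> (LINT x|lborel. norm (f x)) \<le> K * schwartz_norm N f"
      using integral_norm_schwartz_le by blast
    then show ?case
      by (intro exI[of _ K] exI[of _ N]) (auto intro: order_trans[OF norm_fourier_le])
  next
    case (Suc k)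
    then obtain K N where K: "0 \<le> K" "\<And>(f::'a \<Rightarrow> complex) w. schwartz f \<Longrightarrow> norm w ^ k * norm (fourier f w) \<le> K * schwartz_norm N f"
      by blast
    obtain L where L: "0 \<le> L" "\<And>f b. schwartz f \<Longrightarrow> b \<in> (Basis::'a set) \<Longrightarrow> schwartz_norm N (pd b f) \<le> L * schwartz_norm (Suc N) f"
      using schwartz_norm_pd[of N] by metis
    have "norm w ^ Suc k * norm (fourier f w) \<le> (DIM('a) * (K * L)) * schwartz_norm (Suc N) f"
      if f: "schwartz f" for f :: "'a \<Rightarrow> complex" and w
    proof -
      have *: "norm w ^ k * (\<bar>w \<bullet> b\<bar> * norm (fourier f w)) \<le> K * (L * schwartz_norm (Suc N) f)" if b: "b \<in> Basis" for b
      proof -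
        have "\<bar>w \<bullet> b\<bar> * norm (fourier f w) \<le> 2 * pi * (\<bar>w \<bullet> b\<bar> * norm (fourier f w))"
          using mult_right_mono[of 1 "2 * pi" "\<bar>w \<bullet> b\<bar> * norm (fourier f w)"] pi_ge_two by simp
        also have "\<dots> = norm (fourier (pd b f) w)"
          by (simp add: fourier_pd[OF f b] norm_mult mult.assoc)
        finally have "norm w ^ k * (\<bar>w \<bullet> b\<bar> * norm (fourier f w)) \<le> norm w ^ k * norm (fourier (pd b f) w)"
          by (intro mult_left_mono) auto
        also have "\<dots> \<le> K * schwartz_norm N (pd b f)" by (intro K schwartz_pd f b)
        also have "\<dots> \<le> K * (L * schwartz_norm (Suc N) f)" by (intro mult_left_mono L f b K)
        finally show ?thesis .
      qed
      have "norm w ^ Suc k * norm (fourier f w) = norm w ^ k * (norm w * norm (fourier f w))" by simp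
      also have "\<dots> \<le> norm w ^ k * ((\<Sum>b\<in>Basis. \<bar>w \<bullet> b\<bar>) * norm (fourier f w))"
        by (intro mult_left_mono mult_right_mono norm_le_l1) auto
      also have "\<dots> = (\<Sum>b\<in>Basis. norm w ^ k * (\<bar>w \<bullet> b\<bar> * norm (fourier f w)))"
        by (simp add: sum_distrib_left sum_distrib_right)
      also have "\<dots> \<le> (\<Sum>b\<in>(Basis::'a set). K * (L * schwartz_norm (Suc N) f))" by (intro sum_mono *)
      finally show ?thesis by (simp add: mult_ac)
    qed
    then show ?case using K L by (intro exI[of _ "DIM('a) * (K * L)"] exI[of _ "Suc N"]) auto
qed

lemma schwartz_fourier: "schwartz f \<Longrightarrow> schwartz (fourier f)"
proof (rule schwartz_mapI[where T = fourier and S = "\<lambda>v f x. (- 2 * of_real pi * \<i>) * (of_real (x \<bullet> v) * f x)"])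
  show "rapid (fourier f)" if "schwartz f" for f :: "'a \<Rightarrow> complex"
    unfolding rapid_def using fourier_decay that by metis
qed (intro fourier_has_derivative schwartz_cmult schwartz_coord | assumption)+

lemma schwartz_inv_fourier: "schwartz f \<Longrightarrow> schwartz (inv_fourier f)"
  using schwartz_reflect[OF schwartz_fourier, of f 0] by (simp add: inv_fourier_eq_fourier[abs_def])

text \<open>Continuity of the inverse transform from Schwartz space to L^1; it is what makes the
  evolved distribution tempered.\<close>

lemma integral_norm_inv_fourier_le:
  "\<exists>K N. 0 \<le> K \<and> (\<forall>f::'a::euclidean_space \<Rightarrow> complex. schwartz f \<longrightarrow> (LINT x|lborel. norm (inv_fourier f x)) \<le> K * schwartz_norm N f)"
proof -
  let ?n = "DIM('a)" and ?W = "LINT x|lborel. wgt (x::'a)"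
  have W: "0 \<le> ?W" by (intro Bochner_Integration.integral_nonneg) auto
  obtain K N where K: "0 \<le> K" "\<And>(f::'a \<Rightarrow> complex) w. schwartz f \<Longrightarrow> norm w ^ 0 * norm (fourier f w) \<le> K * schwartz_norm N f"
    using fourier_decay by blast
  obtain L M where L: "0 \<le> L" "\<And>(f::'a \<Rightarrow> complex) w. schwartz f \<Longrightarrow> norm w ^ (2 * (1 * ?n)) * norm (fourier f w) \<le> L * schwartz_norm M f"
    using fourier_decay by blast
  obtain K1 where K1: "0 \<le> K1" "\<And>f::'a \<Rightarrow> complex. schwartz f \<Longrightarrow> schwartz_norm N f \<le> K1 * schwartz_norm (max M N) f"
    using schwartz_norm_mono[of N "max M N"] by auto
  obtain L1 where L1: "0 \<le> L1" "\<And>f::'a \<Rightarrow> complex. schwartz f \<Longrightarrow> schwartz_norm M f \<le> L1 * schwartz_norm (max M N) f"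
    using schwartz_norm_mono[of M "max M N"] by auto
  let ?C = "2 ^ ?n * (K * K1 + L * L1)"
  show ?thesis
  proof (rule exI[of _ "?C * ?W"], rule exI[of _ "max M N"], intro conjI allI impI)
    fix f :: "'a \<Rightarrow> complex" assume f: "schwartz f"
    let ?S = "schwartz_norm (max M N) f"
    have "norm (inv_fourier f x) \<le> 2 ^ (1 * ?n) * (K * (K1 * ?S) + L * (L1 * ?S)) * wgt x ^ 1" for x
      unfolding inv_fourier_eq_fourier
      using K(2)[OF f, of "- x"] L(2)[OF f, of "- x"] mult_left_mono[OF K1(2)[OF f] K(1)] mult_left_mono[OF L1(2)[OF f] L(1)]
      by (intro decay_wgt) auto
    then have "(LINT x|lborel. norm (inv_fourier f x)) \<le> (LINT x|lborel. 2 ^ ?n * (K * (K1 * ?S) + L * (L1 * ?S)) * wgt (x::'a))"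
      using schwartz_integrable[OF schwartz_inv_fourier[OF f]] integrable_wgt by (intro integral_mono_AE) auto
    also have "\<dots> = 2 ^ ?n * (K * (K1 * ?S) + L * (L1 * ?S)) * ?W" by simp
    finally show "(LINT x|lborel. norm (inv_fourier f x)) \<le> (?C * ?W) * ?S" by (simp add: algebra_simps)
  qed (use W K L K1 L1 in auto)
qed

section \<open>Fourier inversion and Plancherel\<close>

text \<open>The Fubini hypothesis in the frequent case of a majorant that is a product of two
  integrable functions.\<close>

lemma integrable_pair_dominated:
  fixes F :: "'a \<Rightarrow> 'b \<Rightarrow> 'c::{banach, second_countable_topology}"
  assumes "sigma_finite_measure N"
    and [measurable]: "case_prod F \<in> borel_measurable (M \<Otimes>\<^sub>M N)"
    and a: "integrable M a" and b: "integrable N b"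
    and le: "\<And>x y. norm (F x y) \<le> a x * b y"
  shows "integrable (M \<Otimes>\<^sub>M N) (case_prod F)"
proof (rule integrableI_bounded)
  interpret N: sigma_finite_measure N by fact
  have [measurable]: "a \<in> borel_measurable M" "b \<in> borel_measurable N" using a b by auto
  have "(\<integral>\<^sup>+p. ennreal (norm (case_prod F p)) \<partial>(M \<Otimes>\<^sub>M N)) = (\<integral>\<^sup>+x. \<integral>\<^sup>+y. ennreal (norm (F x y)) \<partial>N \<partial>M)"
    by (subst N.nn_integral_fst[symmetric]) auto
  also have "\<dots> \<le> (\<integral>\<^sup>+x. \<integral>\<^sup>+y. ennreal (norm (a x)) * ennreal (norm (b y)) \<partial>N \<partial>M)"
  proof (intro nn_integral_mono)
    fix x y
    have "norm (F x y) \<le> norm (a x) * norm (b y)"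
      using le[of x y] abs_ge_self[of "a x * b y"] by (simp add: abs_mult)
    then show "ennreal (norm (F x y)) \<le> ennreal (norm (a x)) * ennreal (norm (b y))"
      by (simp add: ennreal_mult[symmetric] ennreal_leI)
  qed
  also have "\<dots> = (\<integral>\<^sup>+x. ennreal (norm (a x)) \<partial>M) * (\<integral>\<^sup>+y. ennreal (norm (b y)) \<partial>N)"
    by (simp add: nn_integral_cmult nn_integral_multc)
  also have "\<dots> < \<infinity>"
    using a b by (auto simp: integrable_iff_bounded ennreal_mult_less_top)
  finally show "(\<integral>\<^sup>+p. ennreal (norm (case_prod F p)) \<partial>(M \<Otimes>\<^sub>M N)) < \<infinity>" .
qed measurable

abbreviation lborel2 :: "('a::euclidean_space \<times> 'a) measure" where
  "lborel2 \<equiv> lborel \<Otimes>\<^sub>M lborel"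

interpretation lborel2: sigma_finite_measure "lborel2 :: ('a::euclidean_space \<times> 'a) measure"
  by (rule sigma_finite_pair_measure[OF sigma_finite_lborel sigma_finite_lborel])

interpretation lborel2_pair: pair_sigma_finite "lborel2 :: ('a::euclidean_space \<times> 'a) measure" "lborel :: 'a measure" ..

section \<open>The Gaussian and its Fourier transform\<close>

lemma lborel_prod_integral:
  fixes f :: "'a::euclidean_space \<Rightarrow> real \<Rightarrow> complex"
  assumes int: "\<And>b. b \<in> Basis \<Longrightarrow> integrable lborel (f b)"
  shows "integrable lborel (\<lambda>x. \<Prod>b\<in>Basis. f b (x \<bullet> b))"
    and "(LINT x|lborel. (\<Prod>b\<in>Basis. f b (x \<bullet> b))) = (\<Prod>b\<in>Basis. LINT x|lborel. f b x)"
proof -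
  interpret P: product_sigma_finite "\<lambda>_::'a. lborel :: real measure" ..
  have [measurable]: "f b \<in> borel_measurable borel" if "b \<in> Basis" for b
    using int[OF that] by auto
  have co: "(\<Prod>b\<in>Basis. f b ((\<Sum>c\<in>Basis. x c *\<^sub>R c) \<bullet> b)) = (\<Prod>b\<in>Basis. f b (x b))" for x
    by (intro prod.cong refl) simp
  have m: "(\<lambda>x. \<Prod>b\<in>Basis. f b (x \<bullet> b)) \<in> borel_measurable borel" by measurable
  show "integrable lborel (\<lambda>x. \<Prod>b\<in>Basis. f b (x \<bullet> b))"
    by (subst lborel_eq, subst integrable_distr_eq)
       (use m int in \<open>auto simp: co intro!: P.product_integrable_prod\<close>)
  show "(LINT x|lborel. (\<Prod>b\<in>Basis. f b (x \<bullet> b))) = (\<Prod>b\<in>Basis. LINT x|lborel. f b x)"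
    by (subst lborel_eq, subst integral_distr)
       (use m int in \<open>auto simp: co intro!: P.product_integral_prod\<close>)
qed

text \<open>With the factor \<open>pi\<close> in the exponent the Gaussian has integral one and is
  its own Fourier transform in the present normalisation.\<close>

definition gauss :: "'a::euclidean_space \<Rightarrow> real" where
  "gauss x = exp (- pi * (norm x)\<^sup>2)"

lemma gauss_real_fourier:
  fixes z :: real
  shows "integrable lborel (\<lambda>x. of_real (exp (- pi * x\<^sup>2)) * ee (- (x * z)))"
    and "(LINT x|lborel. of_real (exp (- pi * x\<^sup>2)) * ee (- (x * z))) = of_real (exp (- pi * z\<^sup>2))"
proof -
  \<comment> \<open>The dilation by \<open>sqrt (2 * pi)\<close> carries the standard normal density
    to the Gaussian, so its characteristic function yields the transform.\<close>
  define c where "c = sqrt (2 * pi)"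
  define t where "t = - c * z"
  have c: "0 < c" "c * c = 2 * pi" by (auto simp: c_def)
  let ?f = "\<lambda>x. std_normal_density x *\<^sub>R iexp (t * x)"
  have "integrable lborel (\<lambda>x. std_normal_density x *\<^sub>R iexp (t * x))"
    by (rule Bochner_Integration.integrable_bound[OF integrable_normal_density[of 1 0]]) simp_all
  then have i: "integrable lborel (\<lambda>x. ?f (0 + c * x))"
    using c by (intro lborel_integrable_real_affine) auto
  have "(LINT x|lborel. ?f x) = char std_normal_distribution t"
    unfolding char_def by (subst integral_density) auto
  also have "\<dots> = of_real (exp (- (t\<^sup>2) / 2))" by (simp add: char_std_normal_distribution)
  also have "- (t\<^sup>2) / 2 = - pi * z\<^sup>2" using c by (simp add: t_def power2_eq_square algebra_simps)
  finally have v: "\<bar>c\<bar> *\<^sub>R (LINT x|lborel. ?f (0 + c * x)) = of_real (exp (- pi * z\<^sup>2))"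
    using lborel_integral_real_affine[of c ?f 0] c by simp
  have e: "?f (0 + c * x) = (of_real (exp (- pi * x\<^sup>2)) * ee (- (x * z))) /\<^sub>R c" for x
  proof -
    have "(c * x)\<^sup>2 = 2 * pi * x\<^sup>2" using c by (simp add: power_mult_distrib power2_eq_square)
    then have "std_normal_density (c * x) = exp (- pi * x\<^sup>2) / c"
      by (simp add: std_normal_density_def c_def)
    moreover have "iexp (t * (c * x)) = ee (- (x * z))"
    proof -
      have "t * (c * x) = 2 * pi * (- (x * z))" using c by (simp add: t_def algebra_simps)
      then show ?thesis by (simp add: ee_def cis_conv_exp)
    qed
    ultimately show ?thesis by (simp add: scaleR_conv_of_real field_simps)
  qed
  show "integrable lborel (\<lambda>x. of_real (exp (- pi * x\<^sup>2)) * ee (- (x * z)))"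
    using integrable_scaleR_right[of c, OF i[unfolded e]] c by simp
  show "(LINT x|lborel. of_real (exp (- pi * x\<^sup>2)) * ee (- (x * z))) = of_real (exp (- pi * z\<^sup>2))"
    using v c unfolding e by simp
qed

lemma ee_sum: "ee (\<Sum>i\<in>I. f i) = (\<Prod>i\<in>I. ee (f i))"
  by (induction I rule: infinite_finite_induct) (auto simp: ee_add)

lemma gauss_prod: "of_real (gauss x) * ee (- (x \<bullet> w)) = (\<Prod>b\<in>Basis. of_real (exp (- pi * (x \<bullet> b)\<^sup>2)) * ee (- ((x \<bullet> b) * (w \<bullet> b))))"
proof -
  have "gauss x = (\<Prod>b\<in>Basis. exp (- pi * (x \<bullet> b)\<^sup>2))"
    unfolding gauss_def power2_norm_eq_inner
    by (subst euclidean_inner) (simp add: exp_sum[symmetric] sum_negf sum_distrib_left power2_eq_square)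
  moreover have "ee (- (x \<bullet> w)) = (\<Prod>b\<in>Basis. ee (- ((x \<bullet> b) * (w \<bullet> b))))"
    by (subst euclidean_inner) (simp only: ee_sum[symmetric] sum_negf)
  ultimately show ?thesis by (simp add: prod.distrib)
qed

lemma gauss_fourier:
  "integrable lborel (\<lambda>x. of_real (gauss x) * ee (- (x \<bullet> w)))"
  "fourier (\<lambda>x. of_real (gauss x)) w = of_real (gauss w)"
proof -
  show "integrable lborel (\<lambda>x. of_real (gauss x) * ee (- (x \<bullet> w)))"
    unfolding gauss_prod by (intro lborel_prod_integral gauss_real_fourier)
  have "fourier (\<lambda>x. of_real (gauss x)) w = (\<Prod>b\<in>Basis. of_real (exp (- pi * (w \<bullet> b)\<^sup>2)))"
    unfolding fourier_eq gauss_prod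
    by (subst lborel_prod_integral[OF gauss_real_fourier(1)]) (simp only: gauss_real_fourier(2))
  also have "\<dots> = of_real (gauss w)"
    using gauss_prod[of w 0] by simp
  finally show "fourier (\<lambda>x. of_real (gauss x)) w = of_real (gauss w)" .
qed

lemma gauss_measurable [measurable]: "gauss \<in> borel_measurable borel"
  unfolding gauss_def[abs_def] by measurable

lemma integrable_gauss: "integrable lborel gauss"
  using gauss_fourier(1)[of 0] by (simp add: complex_of_real_integrable_eq)

lemma integral_gauss: "(LINT x|lborel. gauss x) = 1"
  using gauss_fourier(2)[of "0::'a"] by (simp add: fourier_eq gauss_def)

lemma gauss_nonneg [simp]: "0 \<le> gauss x" and gauss_le_1: "gauss x \<le> 1"
  by (auto simp: gauss_def)

lemma fourier_scaled_gauss: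
  fixes z :: "'a::euclidean_space"
  assumes s: "0 < s"
  shows "(LINT x|lborel. of_real (gauss (s *\<^sub>R x)) * ee (- (x \<bullet> z))) = of_real (gauss (z /\<^sub>R s)) / of_real s ^ DIM('a)"
proof -
  have "fourier (\<lambda>x. of_real (gauss x)) (z /\<^sub>R s) = s ^ DIM('a) *\<^sub>R (LINT x|lborel. of_real (gauss (s *\<^sub>R x)) * ee (- (s *\<^sub>R x \<bullet> z /\<^sub>R s)))"
    unfolding fourier_eq
    by (subst integral_lborel_affine[where c = s and t = 0]) (use s in auto)
  also have "(\<lambda>x. s *\<^sub>R x \<bullet> z /\<^sub>R s) = (\<lambda>x. x \<bullet> z)" using s by (simp add: field_simps)
  finally show ?thesis using s unfolding gauss_fourier(2) by (simp add: scaleR_conv_of_real field_simps)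
qed

lemma seq_to_0: "(\<lambda>n. 1 / real (Suc n)) \<longlonglongrightarrow> 0"
  using LIMSEQ_inverse_real_of_nat by (simp add: inverse_eq_divide)

text \<open>A Gaussian convergence factor makes the double integral absolutely convergent. After
  Fubini the integral over \<open>w\<close> is a narrow Gaussian centred at \<open>x\<close>, an
  approximate identity; both forms of \<open>A\<close> are passed to the limit by dominated
  convergence.\<close>

theorem inv_fourier_fourier:
  fixes f :: "'a::euclidean_space \<Rightarrow> complex"
  assumes f: "schwartz f"
  shows "inv_fourier (fourier f) = f"
proof
  fix x
  define s :: "nat \<Rightarrow> real" where "s n = 1 / Suc n" for n
  have s: "0 < s n" for n by (simp add: s_def)
  have s0: "s \<longlonglongrightarrow> 0" using seq_to_0 by (simp add: s_def[abs_def])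
  have [measurable]: "f \<in> borel_measurable borel" "fourier f \<in> borel_measurable borel"
    using f by (auto intro: schwartz_measurable schwartz_fourier)
  have cg: "continuous_on UNIV (gauss :: 'a \<Rightarrow> real)" unfolding gauss_def by (intro continuous_intros)
  define A where "A n = (LINT w|lborel. fourier f w * ee (x \<bullet> w) * of_real (gauss (s n *\<^sub>R w)))" for n
  have "A \<longlonglongrightarrow> (LINT w|lborel. fourier f w * ee (x \<bullet> w))"
    unfolding A_def[abs_def]
  proof (rule integral_dominated_convergence[where w = "\<lambda>w. norm (fourier f w)"])
    show "integrable lborel (\<lambda>w. norm (fourier f w))"
      by (intro integrable_norm schwartz_integrable schwartz_fourier f)
    show "AE w in lborel. (\<lambda>n. fourier f w * ee (x \<bullet> w) * of_real (gauss (s n *\<^sub>R w))) \<longlonglongrightarrow> fourier f w * ee (x \<bullet> w)"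
    proof (rule AE_I2)
      fix w :: 'a
      have "(\<lambda>n. s n *\<^sub>R w) \<longlonglongrightarrow> 0 *\<^sub>R w" by (intro tendsto_intros s0)
      then have "(\<lambda>n. gauss (s n *\<^sub>R w)) \<longlonglongrightarrow> gauss (0 *\<^sub>R w)"
        by (rule continuous_on_tendsto_compose[OF cg]) auto
      then have "(\<lambda>n. fourier f w * ee (x \<bullet> w) * of_real (gauss (s n *\<^sub>R w))) \<longlonglongrightarrow> fourier f w * ee (x \<bullet> w) * of_real (gauss (0 *\<^sub>R w))"
        by (intro tendsto_intros)
      then show "(\<lambda>n. fourier f w * ee (x \<bullet> w) * of_real (gauss (s n *\<^sub>R w))) \<longlonglongrightarrow> fourier f w * ee (x \<bullet> w)"
        by (simp add: gauss_def)
    qed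
    show "AE w in lborel. norm (fourier f w * ee (x \<bullet> w) * of_real (gauss (s n *\<^sub>R w))) \<le> norm (fourier f w)" for n
      by (intro AE_I2) (simp add: norm_mult mult_left_le gauss_le_1)
  qed (auto simp: inner_commute[of x])
  moreover have "A = (\<lambda>n. LINT z|lborel. f (x + s n *\<^sub>R z) * of_real (gauss z))"
  proof
    fix n
    let ?F = "\<lambda>w y. f y * ee (- (y \<bullet> w)) * ee (x \<bullet> w) * of_real (gauss (s n *\<^sub>R w))"
    have "integrable lborel (\<lambda>w::'a. gauss (s n *\<^sub>R w))"
    proof -
      have "integrable lborel (\<lambda>w::'a. s n ^ DIM('a) *\<^sub>R gauss (0 + s n *\<^sub>R w))"
        using integrable_gauss[where 'a='a] s[of n]
        by (subst (asm) lborel_affine[of "s n" 0]) (simp_all add: integrable_density integrable_distr_eq)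
      then show ?thesis using s[of n] by simp
    qed
    then have ig: "integrable lborel (\<lambda>w::'a. gauss (s n *\<^sub>R w))" .
    have int: "integrable lborel2 (case_prod ?F)"
    proof (rule integrable_pair_dominated[OF sigma_finite_lborel _ ig])
      show "integrable lborel (\<lambda>y. norm (f y))" using schwartz_integrable[OF f] by simp
      show "case_prod ?F \<in> borel_measurable lborel2" by measurable
    qed (simp add: norm_mult mult.commute)
    have "A n = (LINT w|lborel. LINT y|lborel. ?F w y)"
      unfolding A_def fourier_eq by simp
    also have "\<dots> = (LINT y|lborel. LINT w|lborel. ?F w y)"
      by (rule lborel_pair.Fubini_integral[OF int, symmetric])
    also have "\<dots> = (LINT y|lborel. f y * (of_real (gauss ((y - x) /\<^sub>R s n)) / of_real (s n) ^ DIM('a)))"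
    proof (rule Bochner_Integration.integral_cong[OF refl])
      fix y
      have F: "?F w y = f y * (of_real (gauss (s n *\<^sub>R w)) * ee (- (w \<bullet> (y - x))))" for w
        using ee_add[of "- (y \<bullet> w)" "x \<bullet> w"] by (simp add: inner_diff_right inner_commute mult_ac)
      show "(LINT w|lborel. ?F w y) = f y * (of_real (gauss ((y - x) /\<^sub>R s n)) / of_real (s n) ^ DIM('a))"
        unfolding F integral_mult_right_zero by (simp only: fourier_scaled_gauss[OF s])
    qed
    also have "\<dots> = (LINT z|lborel. f (x + s n *\<^sub>R z) * of_real (gauss z))"
      by (subst integral_lborel_affine[where c = "s n" and t = x])
         (use s[of n] in \<open>auto simp: scaleR_conv_of_real\<close>)
    finally show "A n = (LINT z|lborel. f (x + s n *\<^sub>R z) * of_real (gauss z))" .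
  qed
  moreover have "(\<lambda>n. LINT z|lborel. f (x + s n *\<^sub>R z) * of_real (gauss z)) \<longlonglongrightarrow> (LINT z|lborel. f x * of_real (gauss (z::'a)))"
  proof -
    obtain C where C: "0 < C" "\<And>x. norm (f x) \<le> C" using schwartz_bounded[OF f] by blast
    show ?thesis
    proof (rule integral_dominated_convergence[where w = "\<lambda>z. C * gauss z"])
      show "integrable lborel (\<lambda>z::'a. C * gauss z)" using integrable_gauss by auto
      show "AE z in lborel. (\<lambda>n. f (x + s n *\<^sub>R z) * of_real (gauss z)) \<longlonglongrightarrow> f x * of_real (gauss z)"
      proof (rule AE_I2)
        fix z :: 'a
        have "(\<lambda>n. x + s n *\<^sub>R z) \<longlonglongrightarrow> x + 0 *\<^sub>R z" by (intro tendsto_intros s0)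
        then have "(\<lambda>n. f (x + s n *\<^sub>R z)) \<longlonglongrightarrow> f (x + 0 *\<^sub>R z)"
          by (rule continuous_on_tendsto_compose[OF schwartz_continuous[OF f, of UNIV]]) auto
        then show "(\<lambda>n. f (x + s n *\<^sub>R z) * of_real (gauss z)) \<longlonglongrightarrow> f x * of_real (gauss z)"
          by (intro tendsto_mult_right) simp
      qed
      show "AE z in lborel. norm (f (x + s n *\<^sub>R z) * of_real (gauss z)) \<le> C * gauss z" for n
        using C by (intro AE_I2) (simp add: norm_mult mult_right_mono)
    qed auto
  qed
  ultimately have "A \<longlonglongrightarrow> (LINT w|lborel. fourier f w * ee (x \<bullet> w))" "A \<longlonglongrightarrow> (LINT z|lborel. f x * of_real (gauss (z::'a)))"
    by simp_all
  then have "(LINT w|lborel. fourier f w * ee (x \<bullet> w)) = (LINT z|lborel. f x * of_real (gauss (z::'a)))"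
    by (rule LIMSEQ_unique)
  also have "\<dots> = f x" using integral_gauss[where 'a='a] by simp
  finally show "inv_fourier (fourier f) x = f x"
    by (simp add: inv_fourier_eq_fourier fourier_eq inner_commute)
qed

text \<open>The inverse transform is the forward one composed with a reflection, so the other order
  of inversion follows by reflecting the integration variable.\<close>

lemma fourier_inv_fourier:
  assumes f: "schwartz f"
  shows "fourier (inv_fourier f) = f"
proof
  fix x
  have [measurable]: "fourier f \<in> borel_measurable borel"
    using f by (auto intro: schwartz_measurable schwartz_fourier)
  have "fourier (inv_fourier f) x = (LINT w|lborel. fourier f (- w) * ee (- (w \<bullet> x)))"
    by (simp add: fourier_eq inv_fourier_eq_fourier)
  also have "\<dots> = (LINT w|lborel. fourier f w * ee (w \<bullet> x))"
    using integral_lborel_reflect[of "\<lambda>w. fourier f w * ee (w \<bullet> x)" 0] by simp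
  also have "\<dots> = inv_fourier (fourier f) x"
    by (simp add: inv_fourier_eq_fourier fourier_eq)
  finally show "fourier (inv_fourier f) x = f x" by (simp add: inv_fourier_fourier[OF f])
qed

lemma fourier_mult_exchange:
  assumes f: "integrable lborel f" and g: "integrable lborel g"
  shows "(LINT w|lborel. fourier f w * g w) = (LINT x|lborel. f x * fourier g x)"
proof -
  have [measurable]: "f \<in> borel_measurable borel" "g \<in> borel_measurable borel" using f g by auto
  let ?F = "\<lambda>w x. f x * ee (- (x \<bullet> w)) * g w"
  have int: "integrable lborel2 (case_prod ?F)"
  proof (rule integrable_pair_dominated[OF sigma_finite_lborel])
    show "integrable lborel (\<lambda>x. norm (g x))" "integrable lborel (\<lambda>x. norm (f x))" using f g by auto
    show "case_prod ?F \<in> borel_measurable lborel2" by measurable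
  qed (simp add: norm_mult)
  have "(LINT w|lborel. fourier f w * g w) = (LINT w|lborel. LINT x|lborel. ?F w x)"
    unfolding fourier_eq by simp
  also have "\<dots> = (LINT x|lborel. LINT w|lborel. ?F w x)"
    by (rule lborel_pair.Fubini_integral[OF int, symmetric])
  also have "\<dots> = (LINT x|lborel. f x * fourier g x)"
    unfolding fourier_eq
    by (simp add: mult.assoc inner_commute mult.commute[of "ee _"])
  finally show ?thesis .
qed

text \<open>The multiplication formula is applied to \<open>f\<close> and the conjugate of its
  transform, whose own transform is the conjugate of \<open>f\<close> by inversion.\<close>

lemma plancherel:
  assumes f: "schwartz f"
  shows "(\<integral>\<^sup>+w. ennreal ((norm (fourier f w))\<^sup>2) \<partial>lborel) = (\<integral>\<^sup>+x. ennreal ((norm (f x))\<^sup>2) \<partial>lborel)"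
proof -
  have *: "integrable lborel (\<lambda>x. (norm (h x))\<^sup>2)" "(LINT x|lborel. h x * cnj (h x)) = of_real (LINT x|lborel. (norm (h x))\<^sup>2)"
    if "schwartz h" for h :: "'a \<Rightarrow> complex"
  proof -
    have "schwartz (\<lambda>x. h x * cnj (h x))" using that by (intro schwartz_mult schwartz_cnj)
    then have "integrable lborel (\<lambda>x. Re (h x * cnj (h x)))" using schwartz_integrable by (intro integrable_Re) blast
    moreover have "Re (h x * cnj (h x)) = (norm (h x))\<^sup>2" for x
      unfolding cmod_power2 by (simp add: power2_eq_square)
    ultimately show "integrable lborel (\<lambda>x. (norm (h x))\<^sup>2)" by simp
    show "(LINT x|lborel. h x * cnj (h x)) = of_real (LINT x|lborel. (norm (h x))\<^sup>2)"
      by (simp add: complex_norm_square[symmetric] flip: integral_complex_of_real)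
  qed
  have sf: "schwartz (fourier f)" using f by (rule schwartz_fourier)
  have "fourier (\<lambda>w. cnj (fourier f w)) x = cnj (inv_fourier (fourier f) x)" for x
  proof -
    have "fourier (\<lambda>w. cnj (fourier f w)) x = (LINT w|lborel. cnj (fourier f w * ee (w \<bullet> x)))"
      by (simp add: fourier_eq[of "\<lambda>w. cnj (fourier f w)"] ee_minus)
    also have "\<dots> = cnj (LINT w|lborel. fourier f w * ee (w \<bullet> x))" by (rule Bochner_Integration.integral_cnj)
    also have "\<dots> = cnj (inv_fourier (fourier f) x)"
      by (simp add: inv_fourier_eq_fourier fourier_eq[of "fourier f"])
    finally show ?thesis .
  qed
  then have "fourier (\<lambda>w. cnj (fourier f w)) = (\<lambda>x. cnj (f x))"
    by (simp add: inv_fourier_fourier[OF f] fun_eq_iff)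
  then have "(LINT w|lborel. fourier f w * cnj (fourier f w)) = (LINT x|lborel. f x * cnj (f x))"
    using fourier_mult_exchange[OF schwartz_integrable[OF f] schwartz_integrable[OF schwartz_cnj[OF sf]]] by simp
  then have "(LINT w|lborel. (norm (fourier f w))\<^sup>2) = (LINT x|lborel. (norm (f x))\<^sup>2)"
    unfolding *(2)[OF f] *(2)[OF sf] of_real_eq_iff .
  then show ?thesis
    by (simp add: nn_integral_eq_integral *(1)[OF f] *(1)[OF sf])
qed

section \<open>The short-time Fourier transform of a chirped Schwartz function\<close>

text \<open>The multiplier of the propagator, \<open>exp (- 4 pi^2 i t \<bar>x\<bar>^2)\<close>,
  expressed with \<open>ee\<close>; its variable is a frequency.\<close>

definition chirp :: "real \<Rightarrow> 'a::euclidean_space \<Rightarrow> complex" where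
  "chirp t x = ee (- 2 * pi * t * (norm x)\<^sup>2)"

lemma norm_chirp [simp]: "norm (chirp t x) = 1"
  by (simp add: chirp_def)

lemma chirp_measurable [measurable]: "chirp t \<in> borel_measurable borel"
  unfolding chirp_def[abs_def] by measurable

lemma schwartz_chirp_mult: "schwartz f \<Longrightarrow> schwartz (\<lambda>x. chirp t x * f x)"
  unfolding chirp_def by (rule schwartz_chirp)

text \<open>The usual short-time Fourier transform whose window is the reflected conjugate of
  \<open>h\<close>. For \<open>h = inv_fourier (\<lambda>x. cnj (g x))\<close> that window is
  \<open>inv_fourier g\<close>.\<close>

definition stft :: "('a::euclidean_space \<Rightarrow> complex) \<Rightarrow> ('a \<Rightarrow> complex) \<Rightarrow> 'a \<Rightarrow> 'a \<Rightarrow> complex" where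
  "stft f h z = fourier (\<lambda>x. f x * h (z - x))"

lemma schwartz_window: "schwartz f \<Longrightarrow> schwartz h \<Longrightarrow> schwartz (\<lambda>x. f x * h (z - x))"
  by (intro schwartz_mult schwartz_reflect)

lemma schwartz_stft: "schwartz f \<Longrightarrow> schwartz h \<Longrightarrow> schwartz (stft f h z)"
  unfolding stft_def by (intro schwartz_fourier schwartz_window)

text \<open>Integration by parts, with the three terms of the product rule: the derivative falls on
  \<open>f\<close>, on the chirp, or on the reflected window, whence the minus sign. Each term is
  again of the same kind with other Schwartz data, so the identity can be iterated.\<close>

lemma stft_chirp_coord:
  fixes f h :: "'a::euclidean_space \<Rightarrow> complex"
  assumes f: "schwartz f" and h: "schwartz h" and b: "b \<in> Basis"
  shows "(2 * pi * \<i> * of_real (w \<bullet> b)) * stft (\<lambda>x. chirp t x * f x) h z w =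
    stft (\<lambda>x. chirp t x * pd b f x) h z w
    + (- 8 * pi\<^sup>2 * \<i> * t) * stft (\<lambda>x. chirp t x * (of_real (x \<bullet> b) * f x)) h z w
    - stft (\<lambda>x. chirp t x * f x) (pd b h) z w"
proof -
  let ?a = "- 2 * pi * t"
  let ?e = "\<lambda>x::'a. chirp t x"
  have dh: "((\<lambda>x. h (z - x)) has_derivative (\<lambda>v. - pd v h (z - x))) (at x)" for x
    using has_derivative_affine[OF schwartz_smooth[OF h], of "-1" z x] by simp
  have de: "((\<lambda>x. ?e x) has_derivative (\<lambda>v. (2 * of_real pi * \<i> * of_real (?a * (2 * (x \<bullet> v)))) * ?e x)) (at x)" for x
    unfolding chirp_def power2_norm_eq_inner
    by (rule has_derivative_eq_rhs[OF has_derivative_ee])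
       (auto intro!: derivative_eq_intros simp: inner_commute)
  have "((\<lambda>x. ?e x * f x * h (z - x)) has_derivative
     (\<lambda>v. ?e x * f x * (- pd v h (z - x)) + (?e x * pd v f x + ((2 * of_real pi * \<i> * of_real (?a * (2 * (x \<bullet> v)))) * ?e x) * f x) * h (z - x))) (at x)" for x
    unfolding frechet_eq_pd[symmetric, where f = f]
    by (intro has_derivative_mult de dh schwartz_has_derivative f)
  from pd_eqI[OF this, of b]
  have pd: "pd b (\<lambda>x. ?e x * f x * h (z - x)) = (\<lambda>x. (?e x * pd b f x) * h (z - x)
      + (- 8 * pi\<^sup>2 * \<i> * t) * ((?e x * (of_real (x \<bullet> b) * f x)) * h (z - x)) - (?e x * f x) * pd b h (z - x))"
    by (simp add: algebra_simps power2_eq_square)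
  have i1: "integrable lborel (\<lambda>x. (?e x * pd b f x) * h (z - x) * ee (- (x \<bullet> w)))"
    and i2: "integrable lborel (\<lambda>x. (?e x * (of_real (x \<bullet> b) * f x)) * h (z - x) * ee (- (x \<bullet> w)))"
    and i3: "integrable lborel (\<lambda>x. (?e x * f x) * pd b h (z - x) * ee (- (x \<bullet> w)))"
    by (intro integrable_mult_ee schwartz_integrable schwartz_window schwartz_chirp_mult schwartz_coord schwartz_pd f h b)+
  have "(2 * pi * \<i> * of_real (w \<bullet> b)) * stft (\<lambda>x. ?e x * f x) h z w
      = fourier (pd b (\<lambda>x. ?e x * f x * h (z - x))) w"
    unfolding stft_def
    by (rule fourier_pd[symmetric]) (intro schwartz_window schwartz_chirp_mult f h b)+
  also have "\<dots> = (LINT x|lborel. (?e x * pd b f x) * h (z - x) * ee (- (x \<bullet> w))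
      + (- 8 * pi\<^sup>2 * \<i> * t) * ((?e x * (of_real (x \<bullet> b) * f x)) * h (z - x) * ee (- (x \<bullet> w)))
      - (?e x * f x) * pd b h (z - x) * ee (- (x \<bullet> w)))"
    unfolding pd fourier_eq by (simp only: distrib_right left_diff_distrib mult.assoc)
  also have "\<dots> = stft (\<lambda>x. ?e x * pd b f x) h z w
    + (- 8 * pi\<^sup>2 * \<i> * t) * stft (\<lambda>x. ?e x * (of_real (x \<bullet> b) * f x)) h z w
    - stft (\<lambda>x. ?e x * f x) (pd b h) z w"
    unfolding stft_def fourier_eq
    by (subst Bochner_Integration.integral_diff Bochner_Integration.integral_add
         | intro Bochner_Integration.integrable_add integrable_mult_right i1 i2 i3)+ simp
  finally show ?thesis .
qed

text \<open>
  One factor \<open>1 + (2 \<pi> w\<^sub>b / L)\<^sup>2\<close> with \<open>L = 1 + \<bar>t\<bar>\<close> costs one derivative in direction \<open>b\<close>, and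
  differentiating the chirp gives a factor of size \<open>\<bar>t\<bar> \<le> L\<close>; this makes the bound uniform in \<open>t\<close>.
\<close>

lemma stft_chirp_weighted_L2:
  fixes f h :: "'a::euclidean_space \<Rightarrow> complex"
  assumes "finite B" "B \<subseteq> Basis" "schwartz f" "schwartz h"
  shows "\<exists>C\<ge>0. \<forall>t z. (\<integral>\<^sup>+w. ennreal ((\<Prod>b\<in>B. 1 + (2 * pi / (1 + \<bar>t\<bar>) * (w \<bullet> b))\<^sup>2)
           * (norm (stft (\<lambda>x. chirp t x * f x) h z w))\<^sup>2) \<partial>lborel) \<le> ennreal (C * (wgt z)\<^sup>2)"
  using assms
\<comment> \<open>The data are generalised because the step applies the hypothesis to derivatives of
  \<open>f\<close> and \<open>h\<close> and to a coordinate multiple of \<open>f\<close>.\<close>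
proof (induction B arbitrary: f h rule: finite_induct)
  case empty
  note f = \<open>schwartz f\<close> and h = \<open>schwartz h\<close>
  \<comment> \<open>Second-order decay: one factor \<open>wgt x\<close> joins
    \<open>wgt (z - x)\<close> to give \<open>wgt z\<close>, the other keeps the integral over
    \<open>x\<close> finite.\<close>
  obtain C where C: "0 < C" "\<And>x. norm (f x) \<le> C * wgt x ^ 2" using rapid_wgt[OF schwartz_rapid[OF f]] by blast
  obtain D where D: "0 < D" "\<And>x. norm (h x) \<le> D * wgt x ^ 1" using rapid_wgt[OF schwartz_rapid[OF h]] by blast
  let ?W = "LINT x|lborel. wgt (x::'a)"
  have W: "0 \<le> ?W" by (intro Bochner_Integration.integral_nonneg) auto
  let ?C = "(C * D * 2 ^ DIM('a))\<^sup>2"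
  have "(\<integral>\<^sup>+w. ennreal ((norm (stft (\<lambda>x. chirp t x * f x) h z w))\<^sup>2) \<partial>lborel) \<le> ennreal (?C * ?W * (wgt z)\<^sup>2)" for t z
  proof -
    have "(\<integral>\<^sup>+w. ennreal ((norm (stft (\<lambda>x. chirp t x * f x) h z w))\<^sup>2) \<partial>lborel)
      = (\<integral>\<^sup>+x. ennreal ((norm (chirp t x * f x * h (z - x)))\<^sup>2) \<partial>lborel)"
      unfolding stft_def by (intro plancherel schwartz_window schwartz_chirp_mult f h)
    also have "\<dots> \<le> (\<integral>\<^sup>+x. ennreal (?C * (wgt z)\<^sup>2) * ennreal (wgt (x::'a)) \<partial>lborel)"
    proof (intro nn_integral_mono)
      fix x
      have "norm (chirp t x * f x * h (z - x)) \<le> (C * wgt x ^ 2) * (D * wgt (z - x))"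
        using C(2)[of x] D(2)[of "z - x"] C(1) by (auto simp: norm_mult intro!: mult_mono)
      also have "\<dots> = (C * D * wgt x) * (wgt x * wgt (z - x))" by (simp add: power2_eq_square)
      also have "\<dots> \<le> (C * D * wgt x) * (2 ^ DIM('a) * wgt z)"
        using C D by (intro mult_left_mono wgt_mult_le) auto
      finally have "(norm (chirp t x * f x * h (z - x)))\<^sup>2 \<le> ((C * D * wgt x) * (2 ^ DIM('a) * wgt z))\<^sup>2"
        by (intro power_mono) auto
      also have "\<dots> = ?C * (wgt z)\<^sup>2 * (wgt x)\<^sup>2" by (simp add: power_mult_distrib)
      also have "\<dots> \<le> ?C * (wgt z)\<^sup>2 * wgt x"
        by (intro mult_left_mono) (auto simp: power2_eq_square mult_left_le)
      finally show "ennreal ((norm (chirp t x * f x * h (z - x)))\<^sup>2) \<le> ennreal (?C * (wgt z)\<^sup>2) * ennreal (wgt x)"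
        by (simp add: ennreal_mult[symmetric] ennreal_leI)
    qed
    also have "\<dots> = ennreal (?C * (wgt z)\<^sup>2) * ennreal ?W"
      by (simp add: nn_integral_cmult nn_integral_eq_integral integrable_wgt)
    also have "\<dots> = ennreal (?C * ?W * (wgt z)\<^sup>2)"
      using W by (simp add: ennreal_mult[symmetric] mult_ac)
    finally show ?thesis .
  qed
  then show ?case using W by (intro exI[of _ "?C * ?W"]) auto
next
  case (insert b B)
  note f = \<open>schwartz f\<close> and h = \<open>schwartz h\<close>
  have b: "b \<in> Basis" "B \<subseteq> Basis" using insert.prems by auto
  define S0 where "S0 t = stft (\<lambda>x. chirp t x * f x) h" for t
  define S1 where "S1 t = stft (\<lambda>x. chirp t x * pd b f x) h" for t
  define S2 where "S2 t = stft (\<lambda>x. chirp t x * (of_real (x \<bullet> b) * f x)) h" for t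
  define S3 where "S3 t = stft (\<lambda>x. chirp t x * f x) (pd b h)" for t
  have m: "S0 t z \<in> borel_measurable borel" "S1 t z \<in> borel_measurable borel" "S2 t z \<in> borel_measurable borel" "S3 t z \<in> borel_measurable borel" for t z
    unfolding S0_def S1_def S2_def S3_def
    by (intro schwartz_measurable schwartz_stft schwartz_chirp_mult schwartz_coord schwartz_pd f h b(1))+
  note [measurable] = m
  let ?p = "\<lambda>t w. \<Prod>b\<in>B. 1 + (2 * pi / (1 + \<bar>t\<bar>) * (w \<bullet> b))\<^sup>2"
  let ?I = "\<lambda>S t z. \<integral>\<^sup>+w. ennreal (?p t w * (norm (S t z w))\<^sup>2) \<partial>lborel"
  have p0: "0 \<le> ?p t w" for t w by (intro prod_nonneg) auto
  obtain C0 where C0: "0 \<le> C0" "\<And>t z. ?I S0 t z \<le> ennreal (C0 * (wgt z)\<^sup>2)"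
    using insert.IH[OF b(2) f h] unfolding S0_def by blast
  obtain C1 where C1: "0 \<le> C1" "\<And>t z. ?I S1 t z \<le> ennreal (C1 * (wgt z)\<^sup>2)"
    using insert.IH[OF b(2) schwartz_pd[OF f b(1)] h] unfolding S1_def by blast
  obtain C2 where C2: "0 \<le> C2" "\<And>t z. ?I S2 t z \<le> ennreal (C2 * (wgt z)\<^sup>2)"
    using insert.IH[OF b(2) schwartz_coord[OF f, of b] h] unfolding S2_def by blast
  obtain C3 where C3: "0 \<le> C3" "\<And>t z. ?I S3 t z \<le> ennreal (C3 * (wgt z)\<^sup>2)"
    using insert.IH[OF b(2) f schwartz_pd[OF h b(1)]] unfolding S3_def by blast
  \<comment> \<open>This is \<open>3 * (8 * pi^2)^2\<close>: the square of the chirp coefficient,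
    times the 3 from squaring a sum of three terms.\<close>
  let ?k = "192 * pi ^ 4"
  have lin: "ennreal x + ennreal 3 * ennreal y + ennreal ?k * ennreal u + ennreal 3 * ennreal v = ennreal (x + 3 * y + ?k * u + 3 * v)"
    if "0 \<le> x" "0 \<le> y" "0 \<le> u" "0 \<le> v" for x y u v
    using that by (simp add: ennreal_mult)
  let ?C = "C0 + 3 * C1 + ?k * C2 + 3 * C3"
  have pt: "(1 + (2 * pi / (1 + \<bar>t\<bar>) * (w \<bullet> b))\<^sup>2) * (norm (S0 t z w))\<^sup>2
     \<le> (norm (S0 t z w))\<^sup>2 + 3 * (norm (S1 t z w))\<^sup>2 + ?k * (norm (S2 t z w))\<^sup>2 + 3 * (norm (S3 t z w))\<^sup>2" for t z w
  proof -
    let ?L = "1 + \<bar>t\<bar>"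
    have L: "1 \<le> ?L" by simp
    let ?u = "norm (S1 t z w)" and ?v = "8 * pi\<^sup>2 * \<bar>t\<bar> * norm (S2 t z w)" and ?q = "norm (S3 t z w)"
    have "2 * pi * \<bar>w \<bullet> b\<bar> * norm (S0 t z w) = norm ((2 * pi * \<i> * of_real (w \<bullet> b)) * S0 t z w)"
      by (simp add: norm_mult)
    also have "\<dots> = norm (S1 t z w + (- 8 * pi\<^sup>2 * \<i> * t) * S2 t z w - S3 t z w)"
      unfolding S0_def S1_def S2_def S3_def by (simp only: stft_chirp_coord[OF f h b(1)])
    also have "\<dots> \<le> ?u + ?v + ?q"
      using norm_triangle_ineq4[of "S1 t z w + (- 8 * pi\<^sup>2 * \<i> * t) * S2 t z w" "S3 t z w"]
        norm_triangle_ineq[of "S1 t z w" "(- 8 * pi\<^sup>2 * \<i> * t) * S2 t z w"]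
      by (simp add: norm_mult norm_power)
    finally have "(2 * pi * \<bar>w \<bullet> b\<bar> * norm (S0 t z w))\<^sup>2 \<le> (?u + ?v + ?q)\<^sup>2" by (intro power_mono) auto
    also have "\<dots> \<le> 3 * (?u\<^sup>2 + ?v\<^sup>2 + ?q\<^sup>2)"
    proof -
      have "0 \<le> (?u - ?v)\<^sup>2 + (?v - ?q)\<^sup>2 + (?u - ?q)\<^sup>2" by simp
      then show ?thesis by (simp add: power2_eq_square algebra_simps)
    qed
    \<comment> \<open>The terms free of \<open>t\<close> are enlarged by \<open>?L\<close> squared,
      which is at least 1, so that all three share the factor to be divided out.\<close>
    also have "\<dots> \<le> 3 * (?u\<^sup>2 * ?L\<^sup>2 + (64 * pi ^ 4 * (norm (S2 t z w))\<^sup>2) * ?L\<^sup>2 + ?q\<^sup>2 * ?L\<^sup>2)"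
    proof (intro mult_left_mono add_mono)
      show "?u\<^sup>2 \<le> ?u\<^sup>2 * ?L\<^sup>2" "?q\<^sup>2 \<le> ?q\<^sup>2 * ?L\<^sup>2"
        using L by (auto simp: one_le_power mult_le_cancel_left1)
      have "?v\<^sup>2 = (64 * pi ^ 4 * (norm (S2 t z w))\<^sup>2) * \<bar>t\<bar>\<^sup>2"
        by (simp add: power_mult_distrib power_mult[symmetric])
      also have "\<dots> \<le> (64 * pi ^ 4 * (norm (S2 t z w))\<^sup>2) * ?L\<^sup>2"
        by (intro mult_left_mono power_mono) auto
      finally show "?v\<^sup>2 \<le> (64 * pi ^ 4 * (norm (S2 t z w))\<^sup>2) * ?L\<^sup>2" .
    qed simp
    finally have "(2 * pi * \<bar>w \<bullet> b\<bar> * norm (S0 t z w))\<^sup>2 / ?L\<^sup>2 \<le> 3 * ?u\<^sup>2 + ?k * (norm (S2 t z w))\<^sup>2 + 3 * ?q\<^sup>2"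
      using L by (subst divide_le_eq) (auto simp: algebra_simps)
    moreover have "(2 * pi / ?L * (w \<bullet> b))\<^sup>2 * (norm (S0 t z w))\<^sup>2 = (2 * pi * \<bar>w \<bullet> b\<bar> * norm (S0 t z w))\<^sup>2 / ?L\<^sup>2"
      by (simp add: power_mult_distrib power_divide)
    ultimately show ?thesis by (simp add: distrib_right)
  qed
  have "(\<integral>\<^sup>+w. ennreal ((\<Prod>b\<in>insert b B. 1 + (2 * pi / (1 + \<bar>t\<bar>) * (w \<bullet> b))\<^sup>2) * (norm (S0 t z w))\<^sup>2) \<partial>lborel)
      \<le> ennreal (?C * (wgt z)\<^sup>2)" (is "?lhs \<le> _") for t z
  proof -
    have "?lhs \<le> (\<integral>\<^sup>+w. ennreal (?p t w * (norm (S0 t z w))\<^sup>2) + ennreal 3 * ennreal (?p t w * (norm (S1 t z w))\<^sup>2)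
        + ennreal ?k * ennreal (?p t w * (norm (S2 t z w))\<^sup>2) + ennreal 3 * ennreal (?p t w * (norm (S3 t z w))\<^sup>2) \<partial>lborel)"
    proof (intro nn_integral_mono)
      fix w
      have "(\<Prod>b\<in>insert b B. 1 + (2 * pi / (1 + \<bar>t\<bar>) * (w \<bullet> b))\<^sup>2) * (norm (S0 t z w))\<^sup>2
        = ?p t w * ((1 + (2 * pi / (1 + \<bar>t\<bar>) * (w \<bullet> b))\<^sup>2) * (norm (S0 t z w))\<^sup>2)"
        using insert.hyps by simp
      also have "\<dots> \<le> ?p t w * ((norm (S0 t z w))\<^sup>2 + 3 * (norm (S1 t z w))\<^sup>2 + ?k * (norm (S2 t z w))\<^sup>2 + 3 * (norm (S3 t z w))\<^sup>2)"
        by (intro mult_left_mono pt p0)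
      also have "\<dots> = ?p t w * (norm (S0 t z w))\<^sup>2 + 3 * (?p t w * (norm (S1 t z w))\<^sup>2)
        + ?k * (?p t w * (norm (S2 t z w))\<^sup>2) + 3 * (?p t w * (norm (S3 t z w))\<^sup>2)"
        by (simp only: algebra_simps)
      finally have fin: "(\<Prod>b\<in>insert b B. 1 + (2 * pi / (1 + \<bar>t\<bar>) * (w \<bullet> b))\<^sup>2) * (norm (S0 t z w))\<^sup>2 \<le> \<dots>" .
      have nn: "0 \<le> ?p t w * r\<^sup>2" for r by (intro mult_nonneg_nonneg p0) simp
      show "ennreal ((\<Prod>b\<in>insert b B. 1 + (2 * pi / (1 + \<bar>t\<bar>) * (w \<bullet> b))\<^sup>2) * (norm (S0 t z w))\<^sup>2)
        \<le> ennreal (?p t w * (norm (S0 t z w))\<^sup>2) + ennreal 3 * ennreal (?p t w * (norm (S1 t z w))\<^sup>2)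
        + ennreal ?k * ennreal (?p t w * (norm (S2 t z w))\<^sup>2) + ennreal 3 * ennreal (?p t w * (norm (S3 t z w))\<^sup>2)"
        by (subst lin[OF nn nn nn nn]) (rule ennreal_leI[OF fin])
    qed
    also have "\<dots> = ?I S0 t z + ennreal 3 * ?I S1 t z + ennreal ?k * ?I S2 t z + ennreal 3 * ?I S3 t z"
      by (simp add: nn_integral_add nn_integral_cmult)
    also have "\<dots> \<le> ennreal (C0 * (wgt z)\<^sup>2) + ennreal 3 * ennreal (C1 * (wgt z)\<^sup>2) + ennreal ?k * ennreal (C2 * (wgt z)\<^sup>2) + ennreal 3 * ennreal (C3 * (wgt z)\<^sup>2)"
      by (intro add_mono mult_left_mono C0 C1 C2 C3) auto
    also have "\<dots> = ennreal (?C * (wgt z)\<^sup>2)"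
      using C0 C1 C2 C3 by (subst lin) (auto simp: algebra_simps)
    finally show ?thesis .
  qed
  then show ?case using C0 C1 C2 C3 unfolding S0_def by (intro exI[of _ ?C]) auto
qed


text \<open>
  Weighted AM-GM: \<open>r \<le> (A / p + p r\<^sup>2 / A) / 2\<close> turns the weighted \<open>L\<^sup>2\<close> bound into an \<open>L\<^sup>1\<close> bound.
\<close>

proposition stft_chirp_L1:
  fixes f h :: "'a::euclidean_space \<Rightarrow> complex"
  assumes f: "schwartz f" and h: "schwartz h"
  shows "\<exists>C\<ge>0. \<forall>t. (\<integral>\<^sup>+z. \<integral>\<^sup>+w. ennreal (norm (stft (\<lambda>x. chirp t x * f x) h z w)) \<partial>lborel \<partial>lborel)
           \<le> ennreal (C * (1 + \<bar>t\<bar>) powr (DIM('a) / 2))"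
proof -
  obtain C where C: "0 \<le> C" "\<And>t z. (\<integral>\<^sup>+w. ennreal ((\<Prod>b\<in>Basis. 1 + (2 * pi / (1 + \<bar>t\<bar>) * (w \<bullet> b))\<^sup>2)
           * (norm (stft (\<lambda>x. chirp t x * f x) h z w))\<^sup>2) \<partial>lborel) \<le> ennreal (C * (wgt z)\<^sup>2)"
    using stft_chirp_weighted_L2[OF finite_Basis order_refl f h] by blast
  obtain K where K: "0 < K"
    "\<And>c. 0 < c \<Longrightarrow> (\<integral>\<^sup>+x. ennreal (\<Prod>b\<in>Basis. 1 / (1 + (c * ((x::'a) \<bullet> b))\<^sup>2)) \<partial>lborel) = ennreal ((K / c) ^ DIM('a))"
    using nn_integral_wgt_scaled[where 'a='a] by metis
  \<comment> \<open>The integral of \<open>1 / p\<close> for the scale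
    \<open>2 * pi / (1 + \<bar>t\<bar>)\<close>, with its power of \<open>1 + \<bar>t\<bar>\<close>
    removed.\<close>
  let ?k = "(K / (2 * pi)) ^ DIM('a)"
  have k0: "0 \<le> ?k" using K by simp
  let ?W = "LINT x|lborel. wgt (x::'a)"
  have W: "0 \<le> ?W" by (intro Bochner_Integration.integral_nonneg) auto
  let ?C = "(?k + C) / 2"
  have "(\<integral>\<^sup>+z. \<integral>\<^sup>+w. ennreal (norm (stft (\<lambda>x. chirp t x * f x) h z w)) \<partial>lborel \<partial>lborel)
           \<le> ennreal (?C * ?W * (1 + \<bar>t\<bar>) powr (DIM('a) / 2))" for t
  proof -
    define r where "r = (1 + \<bar>t\<bar>) powr (DIM('a) / 2)"
    have r: "0 < r" "r * r = (1 + \<bar>t\<bar>) ^ DIM('a)"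
      by (simp_all add: r_def powr_add[symmetric] powr_realpow)
    have "(\<integral>\<^sup>+w. ennreal (norm (stft (\<lambda>x. chirp t x * f x) h z w)) \<partial>lborel) \<le> ennreal (?C * r * wgt z)" for z
    proof -
      define p where "p w = (\<Prod>b\<in>Basis. 1 + (2 * pi / (1 + \<bar>t\<bar>) * ((w::'a) \<bullet> b))\<^sup>2)" for w
      have p: "0 < p w" for w unfolding p_def by (intro prod_pos) simp
      define S where "S = stft (\<lambda>x. chirp t x * f x) h z"
      have [measurable]: "S \<in> borel_measurable borel" "p \<in> borel_measurable borel"
        unfolding S_def p_def[abs_def] by (intro schwartz_measurable schwartz_stft schwartz_chirp_mult f h) measurable
      \<comment> \<open>The balancing choice: the integral of \<open>1 / p\<close> is a multiple of
        \<open>r * r\<close> and the weighted L^2 integral a multiple of \<open>wgt z\<close>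
        squared, so both halves become multiples of \<open>r * wgt z\<close>.\<close>
      define A where "A = wgt z / r"
      have A: "0 < A" using r by (simp add: A_def)
      have "norm (S w) \<le> A / 2 * (1 / p w) + 1 / (2 * A) * (p w * (norm (S w))\<^sup>2)" for w
      proof -
        have "0 \<le> (p w * norm (S w) - A)\<^sup>2" by simp
        then show ?thesis using p[of w] A by (simp add: field_simps power2_eq_square)
      qed
      then have "ennreal (norm (S w)) \<le> ennreal (A / 2) * ennreal (1 / p w) + ennreal (1 / (2 * A)) * ennreal (p w * (norm (S w))\<^sup>2)" for w
        using p[of w] A by (simp add: ennreal_mult'[symmetric] ennreal_plus[symmetric] ennreal_leI less_imp_le del: ennreal_plus)
      then have "(\<integral>\<^sup>+w. ennreal (norm (S w)) \<partial>lborel)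
          \<le> (\<integral>\<^sup>+w. ennreal (A / 2) * ennreal (1 / p w) + ennreal (1 / (2 * A)) * ennreal (p w * (norm (S w))\<^sup>2) \<partial>lborel)"
        by (intro nn_integral_mono)
      also have "\<dots> = ennreal (A / 2) * (\<integral>\<^sup>+w. ennreal (1 / p w) \<partial>lborel) + ennreal (1 / (2 * A)) * (\<integral>\<^sup>+w. ennreal (p w * (norm (S w))\<^sup>2) \<partial>lborel)"
        by (simp add: nn_integral_add nn_integral_cmult)
      also have "\<dots> \<le> ennreal (A / 2) * ennreal (?k * (r * r)) + ennreal (1 / (2 * A)) * ennreal (C * (wgt z)\<^sup>2)"
      proof (intro add_mono mult_left_mono)
        have "1 / p w = (\<Prod>b\<in>Basis. 1 / (1 + (2 * pi / (1 + \<bar>t\<bar>) * (w \<bullet> b))\<^sup>2))" for w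
          unfolding p_def by (simp add: prod_dividef)
        then have "(\<integral>\<^sup>+w. ennreal (1 / p w) \<partial>lborel) = ennreal ((K / (2 * pi / (1 + \<bar>t\<bar>))) ^ DIM('a))"
          using K(2)[of "2 * pi / (1 + \<bar>t\<bar>)"] by simp
        also have "(K / (2 * pi / (1 + \<bar>t\<bar>))) ^ DIM('a) = ?k * (r * r)"
          unfolding r(2) power_mult_distrib[symmetric] by simp
        finally show "(\<integral>\<^sup>+w. ennreal (1 / p w) \<partial>lborel) \<le> ennreal (?k * (r * r))" by simp
      qed (use C(2)[of t z] in \<open>simp_all add: p_def S_def\<close>)
      also have "\<dots> = ennreal (A / 2 * (?k * (r * r)) + 1 / (2 * A) * (C * (wgt z)\<^sup>2))"
      proof -
        have "ennreal (A / 2) * ennreal (?k * (r * r)) = ennreal (A / 2 * (?k * (r * r)))"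
          using A k0 r by (intro ennreal_mult[symmetric]) auto
        moreover have "ennreal (1 / (2 * A)) * ennreal (C * (wgt z)\<^sup>2) = ennreal (1 / (2 * A) * (C * (wgt z)\<^sup>2))"
          using A C by (intro ennreal_mult[symmetric]) auto
        ultimately show ?thesis using A k0 r C by (simp only:) (intro ennreal_plus[symmetric]; simp)
      qed
      also have "A / 2 * (?k * (r * r)) + 1 / (2 * A) * (C * (wgt z)\<^sup>2) = ?C * r * wgt z"
      proof -
        have "A * r = wgt z" using r by (simp add: A_def)
        then have "A / 2 * (?k * (r * r)) = ?k / 2 * (r * wgt z)" by (simp add: algebra_simps)
        moreover have "1 / (2 * A) * (C * (wgt z)\<^sup>2) = C / 2 * (r * wgt z)"
          using r by (simp add: A_def power2_eq_square)
        ultimately have "A / 2 * (?k * (r * r)) + 1 / (2 * A) * (C * (wgt z)\<^sup>2) = ?k / 2 * (r * wgt z) + C / 2 * (r * wgt z)"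
          by (simp only:)
        then show ?thesis by (simp only: add_divide_distrib distrib_right mult.assoc)
      qed
      finally show ?thesis by (simp add: S_def)
    qed
    then have "(\<integral>\<^sup>+z. \<integral>\<^sup>+w. ennreal (norm (stft (\<lambda>x. chirp t x * f x) h z w)) \<partial>lborel \<partial>lborel)
       \<le> (\<integral>\<^sup>+z. ennreal (?C * r * wgt (z::'a)) \<partial>lborel)"
      by (intro nn_integral_mono)
    also have "\<dots> = ennreal (?C * r * ?W)"
      using k0 C r by (subst nn_integral_eq_integral[OF integrable_mult_right[OF integrable_wgt]]) auto
    finally show ?thesis by (simp add: r_def mult_ac)
  qed
  then show ?thesis using k0 C W by (intro exI[of _ "?C * ?W"]) auto
qed

section \<open>Cutting off a tempered distribution\<close>

lemma iter_partial_add: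
  assumes "smooth f" "smooth g" "set bs \<subseteq> Basis"
  shows "iter_partial bs (\<lambda>x. f x + g x) = (\<lambda>x. iter_partial bs f x + iter_partial bs g x)"
  using assms(3)
proof (induction bs)
  case (Cons b bs)
  have "((\<lambda>x. iter_partial bs f x + iter_partial bs g x) has_derivative
      (\<lambda>v. pd v (iter_partial bs f) x + pd v (iter_partial bs g) x)) (at x)" for x
    using assms Cons.prems unfolding smooth_def frechet_eq_pd[symmetric]
    by (intro has_derivative_add) (auto simp: frechet_derivative_works[symmetric])
  from pd_eqI[OF this, of b] show ?case
    using Cons by (simp add: pd_def)
qed simp

lemma iter_partial_cmult:
  assumes "smooth f" "set bs \<subseteq> Basis"
  shows "iter_partial bs (\<lambda>x. c * f x) = (\<lambda>x. c * iter_partial bs f x)"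
  using assms(2)
proof (induction bs)
  case (Cons b bs)
  have "((\<lambda>x. c * iter_partial bs f x) has_derivative (\<lambda>v. c * pd v (iter_partial bs f) x)) (at x)" for x
    using assms Cons.prems unfolding smooth_def frechet_eq_pd[symmetric]
    by (intro has_derivative_mult_right) (auto simp: frechet_derivative_works[symmetric])
  from pd_eqI[OF this, of b] show ?case
    using Cons by (simp add: pd_def)
qed simp

lemma pd_dilate_mult:
  assumes h: "schwartz h" and f: "schwartz f"
  shows "pd b (\<lambda>x. (h (s *\<^sub>R x) - c) * f x) = (\<lambda>x. of_real s * (pd b h (s *\<^sub>R x) * f x) + (h (s *\<^sub>R x) - c) * pd b f x)"
proof -
  have "((\<lambda>x. h (s *\<^sub>R x) - c) has_derivative (\<lambda>v. of_real s * pd v h (s *\<^sub>R x) - 0)) (at x)" for x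
    using has_derivative_affine[OF schwartz_smooth[OF h], of s 0] by (intro has_derivative_diff) auto
  then have "((\<lambda>x. (h (s *\<^sub>R x) - c) * f x) has_derivative
     (\<lambda>v. (h (s *\<^sub>R x) - c) * pd v f x + (of_real s * pd v h (s *\<^sub>R x) - 0) * f x)) (at x)" for x
    unfolding frechet_eq_pd[symmetric, where f = f]
    by (intro has_derivative_mult schwartz_has_derivative f)
  from pd_eqI[OF this, of b] show ?thesis by (simp add: algebra_simps)
qed

text \<open>Applied at \<open>s x\<close>, it makes \<open>h (s x) - h 0\<close> small like
  \<open>s * norm x\<close>; the extra power of the norm is absorbed by the decay of
  \<open>f\<close>.\<close>

lemma schwartz_lipschitz_0:
  fixes h :: "'a::euclidean_space \<Rightarrow> complex"
  assumes h: "schwartz h"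
  shows "\<exists>L\<ge>0. \<forall>x. norm (h x - h 0) \<le> L * norm x"
proof -
  have "\<forall>b\<in>Basis. \<exists>C>0. \<forall>x. norm (pd b h x) \<le> C"
    using schwartz_bounded[OF schwartz_pd[OF h]] by metis
  then obtain C where C: "\<And>b. b \<in> Basis \<Longrightarrow> 0 < C b" "\<And>b x. b \<in> Basis \<Longrightarrow> norm (pd b h x) \<le> C b"
    by metis
  let ?L = "\<Sum>b\<in>Basis. C b"
  have "norm (h x - h 0) \<le> ?L * norm x" for x
  proof -
    have "norm (h x - h 0) \<le> ?L * norm (x - 0)"
    proof (rule differentiable_bound[of UNIV h "\<lambda>x. frechet_derivative h (at x)"])
      fix y :: 'a
      show "(h has_derivative frechet_derivative h (at y)) (at y within UNIV)"
        using schwartz_has_derivative[OF h] by simp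
      show "onorm (frechet_derivative h (at y)) \<le> ?L"
      proof (rule onorm_le)
        fix v
        have lin: "linear (frechet_derivative h (at y))"
          by (rule linear_frechet_derivative[OF schwartz_differentiable[OF h]])
        have "frechet_derivative h (at y) v = (\<Sum>b\<in>Basis. (v \<bullet> b) *\<^sub>R pd b h y)"
          by (subst euclidean_representation[of v, symmetric])
             (simp add: linear_sum[OF lin] linear_scale[OF lin] pd_def)
        also have "norm \<dots> \<le> (\<Sum>b\<in>Basis. norm v * C b)"
          by (intro order_trans[OF norm_sum] sum_mono)
             (auto intro!: mult_mono Basis_le_norm C)
        finally show "norm (frechet_derivative h (at y) v) \<le> ?L * norm v"
          by (simp add: sum_distrib_left mult.commute)
      qed
    qed auto
    then show ?thesis by simp
  qed
  moreover have "0 \<le> ?L" using C(1) by (intro sum_nonneg) (auto intro: less_imp_le)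
  ultimately show ?thesis by blast
qed

text \<open>A derivative falling on the dilated factor brings out \<open>s\<close>; one falling on
  \<open>f\<close> leaves the expression in the same form. The induction peels off the innermost
  derivative, so the hypothesis applies to \<open>pd b h\<close> or to
  \<open>pd b f\<close>.\<close>

lemma dilate_mult_diff:
  assumes "set bs \<subseteq> Basis" "schwartz h" "schwartz f"
  shows "\<exists>C. \<forall>s x. 0 < s \<and> s \<le> 1 \<longrightarrow> norm x ^ k * norm (iter_partial bs (\<lambda>x. (h (s *\<^sub>R x) - h 0) * f x) x) \<le> s * C"
  using assms
proof (induction bs arbitrary: h f rule: rev_induct)
  case Nil
  obtain L where L: "0 \<le> L" "\<And>x. norm (h x - h 0) \<le> L * norm x"
    using schwartz_lipschitz_0[OF \<open>schwartz h\<close>] by blast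
  obtain B where B: "0 < B" "\<And>x. norm x ^ Suc k * norm (f x) \<le> B" using rapidD[OF schwartz_rapid[OF Nil(3)]] by blast
  have "norm x ^ k * norm ((h (s *\<^sub>R x) - h 0) * f x) \<le> s * (L * B)" if s: "0 < s" for s x
  proof -
    have "norm x ^ k * norm ((h (s *\<^sub>R x) - h 0) * f x) = norm (h (s *\<^sub>R x) - h 0) * (norm x ^ k * norm (f x))"
      by (simp add: norm_mult mult_ac)
    also have "\<dots> \<le> (L * norm (s *\<^sub>R x)) * (norm x ^ k * norm (f x))" by (intro mult_right_mono L) auto
    also have "\<dots> = s * (L * (norm x ^ Suc k * norm (f x)))" using s by (simp add: mult_ac)
    also have "\<dots> \<le> s * (L * B)" using s L(1) B(2)[of x] by (intro mult_left_mono) auto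
    finally show ?thesis .
  qed
  then show ?case by auto
next
  case (snoc b bs)
  have b: "b \<in> Basis" "set bs \<subseteq> Basis" using snoc.prems by auto
  note h = \<open>schwartz h\<close> and f = \<open>schwartz f\<close>
  let ?d = "pd b h 0"
  obtain A where A: "\<And>s x. 0 < s \<Longrightarrow> s \<le> 1 \<Longrightarrow> norm x ^ k * norm (iter_partial bs (\<lambda>x. (pd b h (s *\<^sub>R x) - ?d) * f x) x) \<le> s * A"
    using snoc.IH[OF b(2) schwartz_pd[OF h b(1)] f] by blast
  \<comment> \<open>Subtracting the value of \<open>pd b h\<close> at 0 restores the form required
    by the hypothesis. The constant put back leaves this term, which is bounded and already carries
    the factor \<open>s\<close>.\<close>
  have "rapid (iter_partial bs (\<lambda>x. ?d * f x))"
    using schwartz_cmult[OF f, of ?d] b(2) by (simp add: schwartz_alt)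
  then obtain D where D: "\<And>x. norm x ^ k * norm (iter_partial bs (\<lambda>x. ?d * f x) x) \<le> D"
    unfolding rapid_def by blast
  obtain B where B: "\<And>s x. 0 < s \<Longrightarrow> s \<le> 1 \<Longrightarrow> norm x ^ k * norm (iter_partial bs (\<lambda>x. (h (s *\<^sub>R x) - h 0) * pd b f x) x) \<le> s * B"
    using snoc.IH[OF b(2) h schwartz_pd[OF f b(1)]] by blast
  have "norm x ^ k * norm (iter_partial (bs @ [b]) (\<lambda>x. (h (s *\<^sub>R x) - h 0) * f x) x) \<le> s * (\<bar>A\<bar> + D + B)" if s: "0 < s" "s \<le> 1" for s x
  proof -
    let ?F = "iter_partial bs (\<lambda>x. (pd b h (s *\<^sub>R x) - ?d) * f x) x" and ?E = "iter_partial bs (\<lambda>x. ?d * f x) x"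
    let ?G = "iter_partial bs (\<lambda>x. (h (s *\<^sub>R x) - h 0) * pd b f x) x"
    have sch: "schwartz (\<lambda>x. (q (s *\<^sub>R x) - c) * p x)" if "schwartz q" "schwartz p" for q p :: "'a \<Rightarrow> complex" and c
    proof -
      have "schwartz (\<lambda>x. q (s *\<^sub>R x) * p x - c * p x)"
        using s that by (intro schwartz_diff schwartz_cmult schwartz_mult schwartz_scale) auto
      then show ?thesis by (simp add: left_diff_distrib)
    qed
    note sF = sch[OF schwartz_pd[OF h b(1)] f, of ?d] and sE = schwartz_cmult[OF f, of ?d] and sG = sch[OF h schwartz_pd[OF f b(1)], of "h 0"]
    have "pd b (\<lambda>x. (h (s *\<^sub>R x) - h 0) * f x)
      = (\<lambda>x. of_real s * ((pd b h (s *\<^sub>R x) - ?d) * f x + ?d * f x) + (h (s *\<^sub>R x) - h 0) * pd b f x)"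
      unfolding pd_dilate_mult[OF h f] by (simp add: algebra_simps)
    then have eq: "iter_partial (bs @ [b]) (\<lambda>x. (h (s *\<^sub>R x) - h 0) * f x) x = of_real s * (?F + ?E) + ?G"
      using sF sE sG b(2)
      by (simp add: iter_partial_snoc iter_partial_add iter_partial_cmult schwartz_smooth schwartz_cmult schwartz_add)
    have "norm (iter_partial (bs @ [b]) (\<lambda>x. (h (s *\<^sub>R x) - h 0) * f x) x) \<le> s * (norm ?F + norm ?E) + norm ?G"
    proof -
      have "norm (of_real s * (?F + ?E)) = s * norm (?F + ?E)" using s by (simp add: norm_mult)
      moreover have "s * norm (?F + ?E) \<le> s * (norm ?F + norm ?E)"
        using s by (intro mult_left_mono norm_triangle_ineq) auto
      ultimately show ?thesis
        unfolding eq using norm_triangle_ineq[of "of_real s * (?F + ?E)" ?G] by linarith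
    qed
    then have "norm x ^ k * norm (iter_partial (bs @ [b]) (\<lambda>x. (h (s *\<^sub>R x) - h 0) * f x) x) \<le> norm x ^ k * (s * (norm ?F + norm ?E) + norm ?G)"
      by (intro mult_left_mono) auto
    also have "\<dots> = s * (norm x ^ k * norm ?F + norm x ^ k * norm ?E) + norm x ^ k * norm ?G" by (simp add: algebra_simps)
    also have "\<dots> \<le> s * (\<bar>A\<bar> + D) + s * B"
    proof (intro add_mono mult_left_mono)
      \<comment> \<open>This term is of second order in \<open>s\<close>; one factor is discarded,
        and the absolute value is taken since the sign of \<open>A\<close> is unknown.\<close>
      have "s * A \<le> s * \<bar>A\<bar>" using s by (intro mult_left_mono) auto
      also have "\<dots> \<le> \<bar>A\<bar>" using s by (intro mult_left_le_one_le) auto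
      finally have "s * A \<le> \<bar>A\<bar>" .
      then show "norm x ^ k * norm ?F \<le> \<bar>A\<bar>" using A[OF s, of x] by simp
    qed (use D B[OF s] s in auto)
    finally show ?thesis by (simp add: distrib_left)
  qed
  then show ?case by blast
qed

lemma tempered_diff:
  assumes "tempered u" "schwartz f" "schwartz g"
  shows "u (\<lambda>x. f x - g x) = u f - u g"
proof -
  have "u (\<lambda>x. f x + (-1) * g x) = u f + u (\<lambda>x. (-1) * g x)"
    using assms schwartz_cmult[of g "-1"] unfolding tempered_def by blast
  also have "u (\<lambda>x. (-1) * g x) = (-1) * u g"
    using assms unfolding tempered_def by blast
  finally show ?thesis by simp
qed

definition eps :: "nat \<Rightarrow> real" where
  "eps n = 1 / real (Suc n)"

lemma eps_pos [simp]: "0 < eps n" and eps_le_1 [simp]: "eps n \<le> 1" and eps_neq_0 [simp]: "eps n \<noteq> 0"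
  by (auto simp: eps_def)

lemma eps_tendsto: "eps \<longlonglongrightarrow> 0"
  unfolding eps_def by (rule seq_to_0)

text \<open>Continuity of \<open>u\<close> involves finitely many seminorms, and each of them is of
  order \<open>eps n\<close> on the difference. For compactly supported \<open>h\<close> this
  recovers \<open>u\<close> from its cut-offs.\<close>

lemma tempered_dilate_tendsto:
  fixes u :: "'a::euclidean_space distr"
  assumes u: "tempered u" and h: "schwartz h" "h 0 = 1" and f: "schwartz f"
  shows "(\<lambda>n. u (\<lambda>x. h (eps n *\<^sub>R x) * f x)) \<longlonglongrightarrow> u f"
proof -
  obtain K N where K: "\<And>\<phi>. schwartz \<phi> \<Longrightarrow> cmod (u \<phi>) \<le> K * schwartz_norm N \<phi>"
    using u unfolding tempered_def by blast
  let ?d = "\<lambda>s x. (h (s *\<^sub>R x) - h 0) * f x"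
  have "\<forall>k bs. set bs \<subseteq> Basis \<longrightarrow> (\<exists>C. \<forall>s x. 0 < s \<and> s \<le> 1 \<longrightarrow> norm x ^ k * norm (iter_partial bs (?d s) x) \<le> s * C)"
    using dilate_mult_diff[OF _ h(1) f] by blast
  then obtain C where C: "\<And>k bs s x. set bs \<subseteq> Basis \<Longrightarrow> 0 < s \<Longrightarrow> s \<le> 1 \<Longrightarrow> norm x ^ k * norm (iter_partial bs (?d s) x) \<le> s * C k bs"
    by metis
  have d: "schwartz (?d s)" if "0 < s" for s
  proof -
    have "schwartz (\<lambda>x. h (s *\<^sub>R x) * f x - h 0 * f x)"
      using that by (intro schwartz_diff schwartz_cmult schwartz_mult schwartz_scale h f) auto
    then show ?thesis by (simp add: left_diff_distrib)
  qed
  let ?M = "\<Sum>k\<le>N. \<Sum>bs | set bs \<subseteq> (Basis::'a set) \<and> length bs \<le> N. C k bs"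
  have le: "norm (u (\<lambda>x. h (eps n *\<^sub>R x) * f x) - u f) \<le> \<bar>K\<bar> * ?M * eps n" for n
  proof -
    have "schwartz_norm N (?d (eps n)) \<le> (\<Sum>k\<le>N. \<Sum>bs | set bs \<subseteq> (Basis::'a set) \<and> length bs \<le> N. eps n * C k bs)"
      unfolding schwartz_norm_def by (intro sum_mono cSUP_least C) auto
    also have "\<dots> = ?M * eps n" by (simp add: sum_distrib_left sum_distrib_right mult.commute)
    finally have le: "schwartz_norm N (?d (eps n)) \<le> ?M * eps n" .
    have "u (\<lambda>x. h (eps n *\<^sub>R x) * f x) - u f = u (\<lambda>x. h (eps n *\<^sub>R x) * f x - f x)"
      by (intro tempered_diff[symmetric] u schwartz_mult schwartz_scale h f) simp
    also have "(\<lambda>x. h (eps n *\<^sub>R x) * f x - f x) = ?d (eps n)"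
      using h(2) by (simp add: left_diff_distrib)
    also have "norm (u (?d (eps n))) \<le> K * schwartz_norm N (?d (eps n))" by (intro K d) simp
    also have "\<dots> \<le> \<bar>K\<bar> * schwartz_norm N (?d (eps n))"
      by (intro mult_right_mono schwartz_norm_nonneg d) auto
    also have "\<dots> \<le> \<bar>K\<bar> * (?M * eps n)" by (intro mult_left_mono le) simp
    finally show ?thesis by (simp add: mult.assoc)
  qed
  have "(\<lambda>n. \<bar>K\<bar> * ?M * eps n) \<longlonglongrightarrow> \<bar>K\<bar> * ?M * 0" by (intro tendsto_intros eps_tendsto)
  then have "(\<lambda>n. u (\<lambda>x. h (eps n *\<^sub>R x) * f x) - u f) \<longlonglongrightarrow> 0"
    by (intro Lim_null_comparison[OF always_eventually[OF allI[OF le]]]) simp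
  then show ?thesis by (rule LIM_zero_cancel)
qed

section \<open>Norms\<close>

lemma ennreal_powr_1 [simp]: "ennreal_powr x 1 = x"
  by (cases x) (auto simp: ennreal_powr_def)

lemma Lp_norm_1: "Lp_norm 1 F = (\<integral>\<^sup>+x. F x \<partial>lborel)"
  by (simp add: Lp_norm_def)

lemma Lp_norm_infinity: "Lp_norm \<infinity> F = esssup lborel F"
  by (simp add: Lp_norm_def)

lemma window_L2:
  assumes "window g"
  shows "(\<integral>\<^sup>+x. ennreal ((norm (g x))\<^sup>2) \<partial>lborel) = 1"
proof -
  have e2: "enn2real 2 = 2" by (metis enn2real_ennreal ennreal_numeral zero_le_numeral)
  have "ennreal_powr (ennreal (norm (g x))) 2 = ennreal ((norm (g x))\<^sup>2)" for x
    by (simp add: ennreal_powr_def)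
  then have "ennreal_powr (\<integral>\<^sup>+x. ennreal ((norm (g x))\<^sup>2) \<partial>lborel) (1 / 2) = 1"
    using assms by (simp add: window_def Lp_norm_def e2)
  then obtain r where r: "0 \<le> r" "(\<integral>\<^sup>+x. ennreal ((norm (g x))\<^sup>2) \<partial>lborel) = ennreal r" "ennreal (r powr (1 / 2)) = 1"
    by (cases "\<integral>\<^sup>+x. ennreal ((norm (g x))\<^sup>2) \<partial>lborel") (auto simp: ennreal_powr_def)
  then have "sqrt r = 1" by (simp add: powr_half_sqrt ennreal_eq_1)
  then show ?thesis using r by simp
qed

text \<open>The density is set to zero where it exceeds its essential supremum. A bound valid
  everywhere is then available without changing any integral.\<close>

lemma FL_infinity_density:
  assumes "v \<in> FL \<infinity>"
  obtains H r where "H \<in> borel_measurable borel" "0 \<le> r" "\<And>w. norm (H w) \<le> r"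
    "\<And>f. schwartz f \<Longrightarrow> v (fourier f) = (LINT w|lborel. H w * f w)"
proof -
  obtain D where D: "D \<in> borel_measurable borel" "Lp_norm \<infinity> (\<lambda>w. ennreal (norm (D w))) < \<infinity>"
    "\<And>f. schwartz f \<Longrightarrow> v (fourier f) = (LINT w|lborel. D w * f w)"
    using assms by (auto simp: FL_def fourier_densities_def Lp_space_def fourier_distr_def)
  note [measurable] = D(1)
  obtain r where r: "0 \<le> r" "esssup lborel (\<lambda>w. ennreal (norm (D w))) = ennreal r"
    using D(2)[unfolded Lp_norm_infinity] by (cases "esssup lborel (\<lambda>w. ennreal (norm (D w)))") auto
  have ae: "AE w in lborel. norm (D w) \<le> r"
    using esssup_AE[of "\<lambda>w. ennreal (norm (D w))" lborel] r by simp
  define H where "H w = (if norm (D w) \<le> r then D w else 0)" for w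
  show thesis
  proof (rule that)
    show m: "H \<in> borel_measurable borel" unfolding H_def[abs_def] by measurable
    show "0 \<le> r" "norm (H w) \<le> r" for w using r by (auto simp: H_def)
    show "v (fourier f) = (LINT w|lborel. H w * f w)" if f: "schwartz f" for f
    proof -
      have [measurable]: "f \<in> borel_measurable borel" using f by (rule schwartz_measurable)
      show ?thesis unfolding D(3)[OF f]
        by (rule integral_cong_AE) (use m ae in \<open>auto simp: H_def\<close>)
    qed
  qed
qed

text \<open>Every density gives the estimate with its own essential supremum; division by the L^1
  norm of \<open>f\<close> makes the left side a common lower bound, which passes to the infimum
  defining \<open>FL_norm\<close>.\<close>

lemma FL_infinity_norm_bound:
  assumes "v \<in> FL \<infinity>" and f: "schwartz f"
  shows "norm (v (fourier f)) \<le> enn2real (FL_norm \<infinity> v) * (LINT w|lborel. norm (f w))"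
    and "FL_norm \<infinity> v < \<infinity>"
proof -
  have [measurable]: "f \<in> borel_measurable borel" using f by (rule schwartz_measurable)
  have fi: "integrable lborel (\<lambda>w. norm (f w))" using schwartz_integrable[OF f] by simp
  let ?c = "LINT w|lborel. norm (f w)"
  have c0: "0 \<le> ?c" by (intro Bochner_Integration.integral_nonneg) auto
  have *: "\<exists>r\<ge>0. Lp_norm \<infinity> (\<lambda>w. ennreal (norm (D w))) = ennreal r \<and> norm (v (fourier f)) \<le> r * ?c"
    if "D \<in> fourier_densities \<infinity> v" for D
  proof -
    have D: "D \<in> borel_measurable borel" "Lp_norm \<infinity> (\<lambda>w. ennreal (norm (D w))) < \<infinity>"
      "v (fourier f) = (LINT w|lborel. D w * f w)"
      using that f by (auto simp: fourier_densities_def Lp_space_def fourier_distr_def)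
    note [measurable] = D(1)
    obtain r where r: "0 \<le> r" "esssup lborel (\<lambda>w. ennreal (norm (D w))) = ennreal r"
      using D(2)[unfolded Lp_norm_infinity] by (cases "esssup lborel (\<lambda>w. ennreal (norm (D w)))") auto
    have ae: "AE w in lborel. norm (D w) \<le> r"
      using esssup_AE[of "\<lambda>w. ennreal (norm (D w))" lborel] r by simp
    have ae': "AE w in lborel. norm (D w * f w) \<le> r * norm (f w)"
      using ae by eventually_elim (simp add: norm_mult mult_right_mono)
    have "integrable lborel (\<lambda>w. D w * f w)"
    proof (rule Bochner_Integration.integrable_bound)
      show "integrable lborel (\<lambda>w. r * norm (f w))" using fi by simp
      show "AE w in lborel. norm (D w * f w) \<le> norm (r * norm (f w))" using ae' r by simp
    qed measurable
    then have "norm (v (fourier f)) \<le> (LINT w|lborel. r * norm (f w))"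
      unfolding D(3) using fi ae' by (intro order_trans[OF integral_norm_bound integral_mono_AE]) auto
    then show ?thesis using r unfolding Lp_norm_infinity by auto
  qed
  have ne: "fourier_densities \<infinity> v \<noteq> {}" using assms(1) by (simp add: FL_def)
  then obtain D where "D \<in> fourier_densities \<infinity> v" by blast
  then have "FL_norm \<infinity> v \<le> Lp_norm \<infinity> (\<lambda>w. ennreal (norm (D w)))"
    unfolding FL_norm_def by (intro INF_lower)
  then show fin: "FL_norm \<infinity> v < \<infinity>" using *[OF \<open>D \<in> _\<close>] by (auto simp: less_top[symmetric] top_unique)
  show "norm (v (fourier f)) \<le> enn2real (FL_norm \<infinity> v) * ?c"
  \<comment> \<open>The division is impossible for a vanishing L^1 norm; there any single density
    already forces the pairing to be zero.\<close>
  proof (cases "?c = 0")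
    case True
    then show ?thesis using *[OF \<open>D \<in> _\<close>] by auto
  next
    case False
    have c: "0 < ?c" by (rule le_neq_trans[OF c0 False[symmetric]])
    have "ennreal (norm (v (fourier f)) / ?c) \<le> FL_norm \<infinity> v"
      unfolding FL_norm_def
    proof (rule INF_greatest)
      fix D assume "D \<in> fourier_densities \<infinity> v"
      then obtain r where "0 \<le> r" "Lp_norm \<infinity> (\<lambda>w. ennreal (norm (D w))) = ennreal r" "norm (v (fourier f)) \<le> r * ?c"
        using * by blast
      then show "ennreal (norm (v (fourier f)) / ?c) \<le> Lp_norm \<infinity> (\<lambda>w. ennreal (norm (D w)))"
        using c by (simp add: ennreal_leI divide_le_eq)
    qed
    then have "norm (v (fourier f)) / ?c \<le> enn2real (FL_norm \<infinity> v)"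
      using fin c by (cases "FL_norm \<infinity> v") auto
    then show ?thesis using c by (simp add: divide_le_eq)
  qed
qed

section \<open>Representation of amalgam distributions by their short-time Fourier transform\<close>

lemma fourier_shift:
  assumes [measurable]: "f \<in> borel_measurable borel"
  shows "fourier (\<lambda>w. f (w - v)) x = ee (- (v \<bullet> x)) * fourier f x"
proof -
  have "fourier (\<lambda>w. f (w - v)) x = (LINT w|lborel. (\<lambda>z. f z * ee (- ((z + v) \<bullet> x))) (w - v))"
    by (simp add: fourier_eq)
  also have "\<dots> = (LINT z|lborel. f z * ee (- ((z + v) \<bullet> x)))"
    by (rule integral_lborel_shift) measurable
  also have "\<dots> = (LINT z|lborel. ee (- (v \<bullet> x)) * (f z * ee (- (z \<bullet> x))))"
    using ee_add[of "- (_ \<bullet> x)" "- (v \<bullet> x)"] by (simp add: inner_add_left mult_ac)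
  finally show ?thesis by (simp add: fourier_eq)
qed

lemma fourier_modulate: "fourier (\<lambda>w. ee (y \<bullet> w) * f w) x = fourier f (x - y)"
proof -
  have *: "ee (y \<bullet> w) * f w * ee (- (w \<bullet> x)) = f w * ee (- (w \<bullet> (x - y)))" for w
    using ee_add[of "y \<bullet> w" "- (w \<bullet> x)"] by (simp add: inner_diff_right inner_commute mult_ac)
  show ?thesis by (simp only: fourier_eq *)
qed

text \<open>The dilation normalised in L^1. Its transform is a dilated cut-off, so cutting off at
  any scale costs the same constant.\<close>

lemma fourier_dilate:
  fixes f :: "'a::euclidean_space \<Rightarrow> complex"
  assumes [measurable]: "f \<in> borel_measurable borel" and s: "0 < s"
  shows "fourier (\<lambda>w. f (w /\<^sub>R s) / of_real s ^ DIM('a)) x = fourier f (s *\<^sub>R x)"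
    and "(LINT w|lborel. norm (f (w /\<^sub>R s) / of_real s ^ DIM('a))) = (LINT w|lborel. norm (f w))"
proof -
  show "fourier (\<lambda>w. f (w /\<^sub>R s) / of_real s ^ DIM('a)) x = fourier f (s *\<^sub>R x)"
    unfolding fourier_eq
    by (subst integral_lborel_affine[where c = s and t = 0])
       (use s in \<open>auto simp: scaleR_conv_of_real inner_commute\<close>)
  show "(LINT w|lborel. norm (f (w /\<^sub>R s) / of_real s ^ DIM('a))) = (LINT w|lborel. norm (f w))"
    by (subst integral_lborel_affine[where c = s and t = 0])
       (use s in \<open>auto simp: norm_divide norm_power\<close>)
qed

lemma stft_eq: "stft f h z w = (LINT x|lborel. f x * h (z - x) * ee (- (x \<bullet> w)))"
  by (simp add: stft_def fourier_eq)

lemma stft_measurable: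
  assumes [measurable]: "f \<in> borel_measurable borel" "h \<in> borel_measurable borel"
  shows "(\<lambda>(w, z). stft f h z w) \<in> borel_measurable lborel2"
  unfolding stft_eq by measurable

text \<open>The case \<open>t = 0\<close> of \<open>stft_chirp_L1\<close>, where the chirp is
  identically one.\<close>

lemma stft_integrable:
  fixes f h :: "'a::euclidean_space \<Rightarrow> complex"
  assumes f: "schwartz f" and h: "schwartz h"
  shows "integrable lborel2 (\<lambda>(w, z). stft f h z w)"
proof (rule integrableI_bounded)
  show m: "(\<lambda>(w, z). stft f h z w) \<in> borel_measurable lborel2"
    by (intro stft_measurable schwartz_measurable f h)
  obtain C where C: "(\<integral>\<^sup>+z. \<integral>\<^sup>+w. ennreal (norm (stft (\<lambda>x. chirp 0 x * f x) h z w)) \<partial>lborel \<partial>lborel)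
           \<le> ennreal (C * (1 + \<bar>0\<bar>) powr (DIM('a) / 2))"
    using stft_chirp_L1[OF f h] by blast
  have "(\<lambda>p. ennreal (norm (case p of (w, z) \<Rightarrow> stft f h z w))) \<in> borel_measurable lborel2"
    using m by measurable
  from lborel_pair.nn_integral_snd[OF this]
  have "(\<integral>\<^sup>+p. ennreal (norm (case p of (w, z) \<Rightarrow> stft f h z w)) \<partial>lborel2)
     = (\<integral>\<^sup>+z. \<integral>\<^sup>+w. ennreal (norm (stft f h z w)) \<partial>lborel \<partial>lborel)" by simp
  also have "\<dots> < \<infinity>" using C by (auto simp: chirp_def intro: le_less_trans)
  finally show "(\<integral>\<^sup>+p. ennreal (norm (case p of (w, z) \<Rightarrow> stft f h z w)) \<partial>lborel2) < \<infinity>" .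
qed

text \<open>The bound is uniform in \<open>w\<close>. In the pairing with \<open>W\<close> this slot
  is occupied by \<open>y\<close>, in which the local norm supplies the integrability.\<close>

lemma stft_norm_integral_le:
  assumes f: "schwartz f" and h: "schwartz h"
  shows "(\<integral>\<^sup>+z. ennreal (norm (stft f h z w)) \<partial>lborel) \<le> ennreal ((LINT x|lborel. norm (f x)) * (LINT x|lborel. norm (h x)))"
proof -
  have m [measurable]: "f \<in> borel_measurable borel" "h \<in> borel_measurable borel"
    using f h by (auto intro: schwartz_measurable)
  have eq: "(\<integral>\<^sup>+x. ennreal (norm (k x)) \<partial>lborel) = ennreal (LINT x|lborel. norm (k x))" if "schwartz k" for k :: "'a \<Rightarrow> complex"
    using schwartz_integrable[OF that] by (intro nn_integral_eq_integral) auto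
  have "(\<integral>\<^sup>+z. ennreal (norm (stft f h z w)) \<partial>lborel) \<le> (\<integral>\<^sup>+z. \<integral>\<^sup>+x. ennreal (norm (f x)) * ennreal (norm (h (z - x))) \<partial>lborel \<partial>lborel)"
  proof (intro nn_integral_mono)
    fix z
    have "ennreal (norm (stft f h z w)) \<le> (\<integral>\<^sup>+x. ennreal (norm (f x * h (z - x) * ee (- (x \<bullet> w)))) \<partial>lborel)"
      unfolding stft_eq
      by (intro integral_norm_bound_ennreal integrable_mult_ee schwartz_integrable schwartz_window f h)
    then show "ennreal (norm (stft f h z w)) \<le> (\<integral>\<^sup>+x. ennreal (norm (f x)) * ennreal (norm (h (z - x))) \<partial>lborel)"
      by (simp add: norm_mult ennreal_mult)
  qed
  also have "\<dots> = (\<integral>\<^sup>+x. \<integral>\<^sup>+z. ennreal (norm (f x)) * ennreal (norm (h (z - x))) \<partial>lborel \<partial>lborel)"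
    by (rule lborel_pair.Fubini') measurable
  also have "\<dots> = (\<integral>\<^sup>+x. ennreal (norm (f x)) * (\<integral>\<^sup>+z. ennreal (norm (h z)) \<partial>lborel) \<partial>lborel)"
    by (simp add: nn_integral_cmult nn_integral_lborel_shift[of "\<lambda>z. ennreal (norm (h z))"])
  also have "\<dots> = ennreal ((LINT x|lborel. norm (f x)) * (LINT x|lborel. norm (h x)))"
    by (simp add: nn_integral_multc eq f h ennreal_mult Bochner_Integration.integral_nonneg)
  finally show ?thesis .
qed

lemma translate_test_function: "test_function g \<Longrightarrow> test_function (translate y g)"
  using test_function_affine[of g 1 1 "- y"] by (simp add: translate_def)

text \<open>Integrating over \<open>y\<close> first is Fourier inversion of the windowed function at
  \<open>x\<close>. What is left is the square integral of the transform of \<open>g\<close> over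
  \<open>z\<close>, equal to 1 by Plancherel and the normalisation of the window.\<close>

lemma stft_inversion:
  fixes f g :: "'a::euclidean_space \<Rightarrow> complex"
  assumes g: "schwartz g" and g1: "(\<integral>\<^sup>+x. ennreal ((norm (g x))\<^sup>2) \<partial>lborel) = 1" and f: "schwartz f"
  shows "f x = (LINT (y, z)|lborel2. ee (y \<bullet> x) * inv_fourier g (x - z) * stft f (inv_fourier (\<lambda>x. cnj (g x))) z y)"
proof -
  let ?g' = "inv_fourier g" and ?h = "inv_fourier (\<lambda>x. cnj (g x))"
  have sg': "schwartz ?g'" and sh: "schwartz ?h"
    by (intro schwartz_inv_fourier schwartz_cnj g)+
  have [measurable]: "?g' \<in> borel_measurable borel" "?h \<in> borel_measurable borel" "f \<in> borel_measurable borel"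
    using sg' sh f by (auto intro: schwartz_measurable)
  obtain B where B: "0 < B" "\<And>x. norm (?g' x) \<le> B" using schwartz_bounded[OF sg'] by blast
  let ?F = "\<lambda>y z. ee (y \<bullet> x) * ?g' (x - z) * stft f ?h z y"
  have int: "integrable lborel2 (case_prod ?F)"
  proof (rule Bochner_Integration.integrable_bound)
    show "integrable lborel2 (\<lambda>p. B * norm (case p of (w, z) \<Rightarrow> stft f ?h z w))"
      by (intro integrable_mult_right integrable_norm stft_integrable f sh)
    show "case_prod ?F \<in> borel_measurable lborel2"
      using stft_measurable[of f ?h] by measurable
    show "AE p in lborel2. norm (case_prod ?F p) \<le> norm (B * norm (case p of (w, z) \<Rightarrow> stft f ?h z w))"
      using B by (intro AE_I2) (auto simp: norm_mult split: prod.split intro!: mult_right_mono)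
  qed
  have "(LINT (y, z)|lborel2. ?F y z) = (LINT z|lborel. LINT y|lborel. ?F y z)"
    by (rule lborel_pair.integral_snd[OF int, symmetric])
  also have "\<dots> = (LINT z|lborel. f x * (?g' (x - z) * ?h (z - x)))"
  proof (rule Bochner_Integration.integral_cong[OF refl])
    fix z
    let ?w = "\<lambda>v. f v * ?h (z - v)"
    have "(LINT y|lborel. ?F y z) = (LINT y|lborel. ?g' (x - z) * (fourier ?w y * ee (y \<bullet> x)))"
      by (simp add: stft_def mult_ac)
    also have "\<dots> = ?g' (x - z) * inv_fourier (fourier ?w) x"
      by (simp add: inv_fourier_eq_fourier fourier_eq[of "fourier _"])
    also have "inv_fourier (fourier ?w) x = ?w x"
      by (simp add: inv_fourier_fourier schwartz_window f sh)
    finally show "(LINT y|lborel. ?F y z) = f x * (?g' (x - z) * ?h (z - x))" by simp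
  qed
  also have "\<dots> = f x * (LINT z|lborel. (\<lambda>v. complex_of_real ((norm (fourier g v))\<^sup>2)) (z - x))"
  proof -
    have "?h v = cnj (fourier g v)" for v
    proof -
      have "?h v = (LINT y|lborel. cnj (g y * ee (- (y \<bullet> v))))"
        by (simp add: inv_fourier_eq_fourier fourier_eq[of "\<lambda>x. cnj (g x)"] ee_minus)
      also have "\<dots> = cnj (fourier g v)"
        by (simp only: fourier_eq Bochner_Integration.integral_cnj)
      finally show ?thesis .
    qed
    moreover have "?g' (x - z) = fourier g (z - x)" for z by (simp add: inv_fourier_eq_fourier)
    ultimately show ?thesis by (simp only: complex_norm_square integral_mult_right_zero)
  qed
  also have "(LINT z|lborel. (\<lambda>v. complex_of_real ((norm (fourier g v))\<^sup>2)) (z - x)) = (LINT v|lborel. of_real ((norm (fourier g v))\<^sup>2))"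
    using schwartz_measurable[OF schwartz_fourier[OF g]]
    by (intro integral_lborel_shift) measurable
  also have "\<dots> = 1"
  proof -
    have "(LINT v|lborel. (norm (fourier g v))\<^sup>2) = enn2real (\<integral>\<^sup>+v. ennreal ((norm (fourier g v))\<^sup>2) \<partial>lborel)"
      using schwartz_measurable[OF schwartz_fourier[OF g]] by (intro integral_eq_nn_integral) auto
    then show ?thesis by (simp add: plancherel[OF g] g1 del: of_real_power)
  qed
  finally show ?thesis by simp
qed

text \<open>Everything the evolution estimate needs to know about \<open>u\<close>: a joint symbol
  in position \<open>y\<close> and frequency \<open>z\<close>, dominated in \<open>y\<close> alone
  by an integrable local norm \<open>N\<close>.\<close>

locale dominated_symbol =
  fixes W :: "'a::euclidean_space \<Rightarrow> 'a \<Rightarrow> complex" and N :: "'a \<Rightarrow> real" and c :: real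
  assumes W_measurable [measurable]: "(\<lambda>p. W (fst p) (snd p)) \<in> borel_measurable lborel2"
    and N_measurable [measurable]: "N \<in> borel_measurable borel"
    and W_le: "norm (W y z) \<le> c * N y"
    and c_nonneg: "0 \<le> c" and N_nonneg: "0 \<le> N y"
    and N_finite: "(\<integral>\<^sup>+y. ennreal (N y) \<partial>lborel) < \<infinity>"

text \<open>Pairing \<open>stft_inversion\<close> with a density of the cut-off distribution gives
  the formula for each cut-off; the symbols are dominated uniformly in the cut-off, so the formula
  passes to \<open>u\<close>. The constant precedes \<open>u\<close> in the quantifiers, as a
  uniform estimate demands.\<close>

proposition amalgam_representation:
  fixes g :: "'a::euclidean_space \<Rightarrow> complex"
  assumes g: "window g"
  shows "\<exists>c. \<forall>u\<in>amalgam g \<infinity> 1. \<exists>W N. dominated_symbol W N c \<and>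
    local_FL_norm g \<infinity> u = (\<lambda>y. ennreal (N y)) \<and>
    (\<forall>f. schwartz f \<longrightarrow> u (fourier f) =
       (LINT p|lborel2. W (fst p) (snd p) * stft f (inv_fourier (\<lambda>x. cnj (g x))) (snd p) (fst p)))"
proof -
  have tg: "test_function g" using g by (simp add: window_def)
  have sg: "schwartz g" by (rule test_function_schwartz[OF tg])
  note g1 = window_L2[OF g]
  have "\<exists>x0. g x0 \<noteq> 0"
  proof (rule ccontr)
    assume "\<not> (\<exists>x0. g x0 \<noteq> 0)"
    then have "g = (\<lambda>_. 0)" by auto
    then show False using g1 by simp
  qed
  then obtain x0 where x0: "g x0 \<noteq> 0" by blast
  \<comment> \<open>A bump equal to 1 at the origin, made from \<open>g\<close> by moving a point
    where it does not vanish to 0 and rescaling.\<close>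
  define h where "h x = (1 / g x0) * g (1 *\<^sub>R x + x0)" for x
  have th: "test_function h" unfolding h_def[abs_def] by (rule test_function_affine[OF tg]) simp
  have h0: "h 0 = 1" using x0 by (simp add: h_def)
  have sh: "schwartz h" by (rule test_function_schwartz[OF th])
  define k where "k = inv_fourier h"
  have sk: "schwartz k" unfolding k_def by (rule schwartz_inv_fourier[OF sh])
  define g' where "g' = inv_fourier g"
  have sg': "schwartz g'" unfolding g'_def by (rule schwartz_inv_fourier[OF sg])
  define \<gamma> where "\<gamma> = inv_fourier (\<lambda>x. cnj (g x))"
  have s\<gamma>: "schwartz \<gamma>" unfolding \<gamma>_def by (intro schwartz_inv_fourier schwartz_cnj sg)
  have [measurable]: "g \<in> borel_measurable borel" "g' \<in> borel_measurable borel" "k \<in> borel_measurable borel" "\<gamma> \<in> borel_measurable borel"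
    by (intro schwartz_measurable sg sg' sk s\<gamma>)+
  have fg': "fourier g' = g" unfolding g'_def by (rule fourier_inv_fourier[OF sg])
  have fk: "fourier k = h" unfolding k_def by (rule fourier_inv_fourier[OF sh])
  \<comment> \<open>The price of multiplying by any dilate of \<open>h\<close> on the Fourier side;
    it depends on \<open>g\<close> and the choice of \<open>x0\<close>, not on
    \<open>u\<close>.\<close>
  define c where "c = (LINT x|lborel. norm (k x))"
  have c: "0 \<le> c" unfolding c_def by (intro Bochner_Integration.integral_nonneg) auto
  have "\<exists>W N. dominated_symbol W N c \<and> local_FL_norm g \<infinity> u = (\<lambda>y. ennreal (N y)) \<and>
    (\<forall>f. schwartz f \<longrightarrow> u (fourier f) = (LINT p|lborel2. W (fst p) (snd p) * stft f \<gamma> (snd p) (fst p)))"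
    if u: "u \<in> amalgam g \<infinity> 1" for u
  proof -
    have tu: "tempered u" and FLu: "\<And>h. test_function h \<Longrightarrow> mult_distr h u \<in> FL \<infinity>"
      and Nm: "local_FL_norm g \<infinity> u \<in> borel_measurable lborel"
      and Ni: "(\<integral>\<^sup>+x. local_FL_norm g \<infinity> u x \<partial>lborel) < \<infinity>"
      using u by (auto simp: amalgam_def amalgam_norm_def Lp_norm_1)
    define N where "N y = enn2real (local_FL_norm g \<infinity> u y)" for y
    have N0: "0 \<le> N y" for y by (simp add: N_def)
    have [measurable]: "N \<in> borel_measurable borel" unfolding N_def[abs_def] using Nm by measurable
    have Neq: "local_FL_norm g \<infinity> u y = ennreal (N y)" for y
      using FL_infinity_norm_bound(2)[OF FLu[OF translate_test_function[OF tg]] sg, of y]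
      by (simp add: N_def local_FL_norm_def)
    have Ni': "(\<integral>\<^sup>+y. ennreal (N y) \<partial>lborel) < \<infinity>" using Ni unfolding Neq .
    have thn: "test_function (\<lambda>x. h (eps n *\<^sub>R x))" for n
      using test_function_affine[OF th, of "eps n" 1 0] by simp
    have "\<exists>H r. H \<in> borel_measurable borel \<and> 0 \<le> r \<and> (\<forall>w. norm (H w) \<le> r) \<and>
       (\<forall>f. schwartz f \<longrightarrow> u (\<lambda>x. h (eps n *\<^sub>R x) * fourier f x) = (LINT w|lborel. H w * f w))" for n
    proof -
      obtain H r where "H \<in> borel_measurable borel" "0 \<le> r" "\<And>w. norm (H w) \<le> r"
        "\<And>f. schwartz f \<Longrightarrow> mult_distr (\<lambda>x. h (eps n *\<^sub>R x)) u (fourier f) = (LINT w|lborel. H w * f w)"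
        using FL_infinity_density[OF FLu[OF thn[of n]]] by blast
      then show ?thesis unfolding mult_distr_def by blast
    qed
    then obtain H r where Hm [measurable]: "\<And>n. H n \<in> borel_measurable borel" and r: "\<And>n::nat. 0 \<le> r n" "\<And>n w. norm (H n w) \<le> r n"
      and Hu: "\<And>n f. schwartz f \<Longrightarrow> u (\<lambda>x. h (eps n *\<^sub>R x) * fourier f x) = (LINT w|lborel. H n w * f w)"
      by metis
    \<comment> \<open>The window modulated and moved to \<open>y\<close>. Being the Fourier
      transform of a modulated translate of \<open>g'\<close>, it can be paired with
      \<open>u\<close> through densities.\<close>
    define E where "E y z x = ee (- (z \<bullet> (x - y))) * g (x - y)" for y z x
    have mod: "schwartz (\<lambda>w. ee (y \<bullet> w) * g' (w - z))" for y z
      using schwartz_ee[OF schwartz_shift[OF sg', of z], of y] by (simp add: inner_commute)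
    have E_eq: "fourier (\<lambda>w. ee (y \<bullet> w) * g' (w - z)) = E y z" for y z
      by (simp add: fun_eq_iff fourier_modulate fourier_shift fg' E_def)
    have sE: "schwartz (E y z)" for y z
      unfolding E_eq[symmetric] by (intro schwartz_fourier mod)
    \<comment> \<open>The integral form gives joint measurability in \<open>y\<close> and
      \<open>z\<close>; the equal expression \<open>Wn_u\<close> gives the limit in
      \<open>n\<close>.\<close>
    define Wn where "Wn n y z = (LINT w|lborel. H n w * (ee (y \<bullet> w) * g' (w - z)))" for n y z
    have Wn_u: "Wn n y z = u (\<lambda>x. h (eps n *\<^sub>R x) * E y z x)" for n y z
      unfolding Wn_def E_eq[symmetric] by (rule Hu[OF mod, symmetric])
    have Wn_m [measurable]: "(\<lambda>(y, z). Wn n y z) \<in> borel_measurable lborel2" for n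
      unfolding Wn_def by measurable
    have Wn_b: "norm (Wn n y z) \<le> c * N y" for n y z
    proof -
      \<comment> \<open>The bump and the modulation are moved away from the window: their product is
        the transform of \<open>?f\<close>, which leaves the pairing of \<open>?f\<close> with the
        distribution localised at \<open>y\<close>. The L^1 norm of \<open>?f\<close> is
        \<open>c\<close> for every \<open>n\<close> and \<open>z\<close>.\<close>
      let ?k = "\<lambda>w. k (w /\<^sub>R eps n) / of_real (eps n) ^ DIM('a)"
      let ?f = "\<lambda>w. ee (z \<bullet> y) * ?k (w - z)"
      have [measurable]: "?k \<in> borel_measurable borel" by measurable
      have "schwartz (\<lambda>w. (1 / of_real (eps n) ^ DIM('a)) * k (inverse (eps n) *\<^sub>R w))"
        by (intro schwartz_cmult schwartz_scale sk) simp
      then have sk': "schwartz ?k" by simp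
      have sf: "schwartz ?f" by (intro schwartz_cmult schwartz_shift[OF sk'])
      have "fourier ?f x = ee (z \<bullet> y) * (ee (- (z \<bullet> x)) * h (eps n *\<^sub>R x))" for x
      proof -
        have "fourier ?f x = ee (z \<bullet> y) * fourier (\<lambda>w. ?k (w - z)) x"
          by (simp only: fourier_eq mult.assoc integral_mult_right_zero)
        also have "fourier (\<lambda>w. ?k (w - z)) x = ee (- (z \<bullet> x)) * fourier ?k x"
          by (rule fourier_shift) measurable
        also have "fourier ?k x = h (eps n *\<^sub>R x)"
          by (subst fourier_dilate) (simp_all add: fk)
        finally show ?thesis .
      qed
      then have "translate y g x * fourier ?f x = h (eps n *\<^sub>R x) * E y z x" for x
        using ee_add[of "z \<bullet> y" "- (z \<bullet> x)"]
        by (simp add: E_def translate_def inner_diff_right mult_ac)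
      then have "Wn n y z = mult_distr (translate y g) u (fourier ?f)"
        unfolding Wn_u mult_distr_def by simp
      also have "norm \<dots> \<le> N y * (LINT w|lborel. norm (?f w))"
        unfolding N_def local_FL_norm_def
        by (rule FL_infinity_norm_bound(1)[OF FLu[OF translate_test_function[OF tg]] sf])
      also have "(LINT w|lborel. norm (?f w)) = (LINT w|lborel. (\<lambda>w. norm (?k w)) (w - z))"
        by (simp only: norm_mult norm_ee mult_1_left)
      also have "\<dots> = (LINT w|lborel. norm (?k w))"
        by (rule integral_lborel_shift) measurable
      also have "\<dots> = c"
        unfolding c_def by (rule fourier_dilate) simp_all
      finally show ?thesis by (simp add: mult.commute)
    qed
    define W where "W y z = u (E y z)" for y z
    have W_lim: "(\<lambda>n. Wn n y z) \<longlonglongrightarrow> W y z" for y z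
      unfolding Wn_u W_def by (rule tempered_dilate_tendsto[OF tu sh h0 sE])
    have W_m [measurable]: "(\<lambda>(y, z). W y z) \<in> borel_measurable lborel2"
    proof (rule borel_measurable_LIMSEQ_metric)
      show "(\<lambda>n. case p of (y, z) \<Rightarrow> Wn n y z) \<longlonglongrightarrow> (case p of (y, z) \<Rightarrow> W y z)" for p
        by (cases p) (simp add: W_lim)
    qed (rule Wn_m)
    have W_b: "norm (W y z) \<le> c * N y" for y z
      by (rule LIMSEQ_le_const2[OF tendsto_norm[OF W_lim]]) (use Wn_b in blast)
    have rep: "u (fourier f) = (LINT p|lborel2. W (fst p) (snd p) * stft f \<gamma> (snd p) (fst p))" if f: "schwartz f" for f
    proof -
      have [measurable]: "f \<in> borel_measurable borel" by (rule schwartz_measurable[OF f])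
      note st_m [measurable] = stft_measurable[OF \<open>f \<in> _\<close> \<open>\<gamma> \<in> _\<close>]
      have st_m' [measurable]: "(\<lambda>p. stft f \<gamma> (snd p) (fst p)) \<in> borel_measurable lborel2"
        using st_m by (simp add: case_prod_beta')
      have Wn_m' [measurable]: "(\<lambda>p. Wn n (fst p) (snd p)) \<in> borel_measurable lborel2" for n
        using Wn_m by (simp add: case_prod_beta')
      have fin: "u (\<lambda>x. h (eps n *\<^sub>R x) * fourier f x) = (LINT p|lborel2. Wn n (fst p) (snd p) * stft f \<gamma> (snd p) (fst p))" for n
      proof -
        \<comment> \<open>For Fubini at a fixed \<open>n\<close> the crude bound \<open>r n\<close>
          is enough, even if it grows with \<open>n\<close>; the uniform bound \<open>Wn_b\<close>
          is kept for the limit.\<close>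
        let ?F = "\<lambda>p w. H n w * (ee (fst p \<bullet> w) * g' (w - snd p)) * stft f \<gamma> (snd p) (fst p)"
        have mF: "case_prod ?F \<in> borel_measurable (lborel2 \<Otimes>\<^sub>M lborel)" by measurable
        have gi: "integrable lborel (\<lambda>w. norm (g' w))" using schwartz_integrable[OF sg'] by simp
        have int: "integrable (lborel2 \<Otimes>\<^sub>M lborel) (case_prod ?F)"
        proof (rule integrableI_bounded[OF mF])
          have "(\<integral>\<^sup>+q. ennreal (norm (case_prod ?F q)) \<partial>(lborel2 \<Otimes>\<^sub>M lborel)) = (\<integral>\<^sup>+p. \<integral>\<^sup>+w. ennreal (norm (?F p w)) \<partial>lborel \<partial>lborel2)"
            using mF by (subst lborel.nn_integral_fst[symmetric]) auto
          also have "\<dots> \<le> (\<integral>\<^sup>+p. \<integral>\<^sup>+w. ennreal (norm (stft f \<gamma> (snd p) (fst p))) * (ennreal (r n) * ennreal (norm (g' (w - snd p)))) \<partial>lborel \<partial>lborel2)"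
          proof (intro nn_integral_mono)
            fix p w
            have "norm (?F p w) \<le> norm (stft f \<gamma> (snd p) (fst p)) * (r n * norm (g' (w - snd p)))"
              using mult_right_mono[OF r(2)[of n w], of "norm (g' (w - snd p)) * norm (stft f \<gamma> (snd p) (fst p))"]
              by (simp add: norm_mult mult_ac)
            then show "ennreal (norm (?F p w)) \<le> ennreal (norm (stft f \<gamma> (snd p) (fst p))) * (ennreal (r n) * ennreal (norm (g' (w - snd p))))"
              using r(1)[of n] by (simp add: ennreal_mult[symmetric] ennreal_leI)
          qed
          also have "\<dots> = (\<integral>\<^sup>+p. ennreal (norm (stft f \<gamma> (snd p) (fst p))) * (ennreal (r n) * (\<integral>\<^sup>+w. ennreal (norm (g' w)) \<partial>lborel)) \<partial>lborel2)"
            by (simp add: nn_integral_cmult nn_integral_lborel_shift[of "\<lambda>z. ennreal (norm (g' z))"])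
          also have "\<dots> = (\<integral>\<^sup>+p. ennreal (norm (stft f \<gamma> (snd p) (fst p))) \<partial>lborel2) * (ennreal (r n) * (\<integral>\<^sup>+w. ennreal (norm (g' w)) \<partial>lborel))"
            by (simp add: nn_integral_multc)
          also have "\<dots> < \<infinity>"
            using stft_integrable[OF f s\<gamma>] gi by (auto simp: integrable_iff_bounded ennreal_mult_less_top case_prod_beta')
          finally show "(\<integral>\<^sup>+q. ennreal (norm (case_prod ?F q)) \<partial>(lborel2 \<Otimes>\<^sub>M lborel)) < \<infinity>" .
        qed
        have "u (\<lambda>x. h (eps n *\<^sub>R x) * fourier f x) = (LINT w|lborel. H n w * f w)" by (rule Hu[OF f])
        also have "\<dots> = (LINT w|lborel. LINT p|lborel2. ?F p w)"
        proof (rule Bochner_Integration.integral_cong[OF refl])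
          fix w
          have "f w = (LINT p|lborel2. ee (fst p \<bullet> w) * g' (w - snd p) * stft f \<gamma> (snd p) (fst p))"
            using stft_inversion[OF sg g1 f, of w] unfolding g'_def \<gamma>_def by (simp add: case_prod_beta')
          then show "H n w * f w = (LINT p|lborel2. ?F p w)" by (simp add: mult.assoc)
        qed
        also have "\<dots> = (LINT p|lborel2. LINT w|lborel. ?F p w)"
          by (rule lborel2_pair.Fubini_integral[OF int])
        also have "\<dots> = (LINT p|lborel2. Wn n (fst p) (snd p) * stft f \<gamma> (snd p) (fst p))"
          unfolding Wn_def by simp
        finally show ?thesis .
      qed
      have "(\<lambda>n. LINT p|lborel2. Wn n (fst p) (snd p) * stft f \<gamma> (snd p) (fst p))
         \<longlonglongrightarrow> (LINT p|lborel2. W (fst p) (snd p) * stft f \<gamma> (snd p) (fst p))"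
      \<comment> \<open>The majorant is free of \<open>n\<close>. It is integrable because the
        integral over \<open>z\<close> is bounded uniformly in \<open>y\<close> and \<open>N\<close>
        is integrable.\<close>
      proof (rule integral_dominated_convergence[where w = "\<lambda>p. c * N (fst p) * norm (stft f \<gamma> (snd p) (fst p))"])
        show "integrable lborel2 (\<lambda>p. c * N (fst p) * norm (stft f \<gamma> (snd p) (fst p)))"
        proof (rule integrableI_bounded)
          let ?K = "(LINT x|lborel. norm (f x)) * (LINT x|lborel. norm (\<gamma> x))"
          have "(\<integral>\<^sup>+p. ennreal (norm (c * N (fst p) * norm (stft f \<gamma> (snd p) (fst p)))) \<partial>lborel2)
             = (\<integral>\<^sup>+y. \<integral>\<^sup>+z. ennreal (c * N y) * ennreal (norm (stft f \<gamma> z y)) \<partial>lborel \<partial>lborel)"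
            using c N0 by (subst lborel.nn_integral_fst[symmetric]) (auto simp: ennreal_mult abs_mult)
          also have "\<dots> \<le> (\<integral>\<^sup>+y. ennreal (c * N y) * ennreal ?K \<partial>lborel)"
            by (intro nn_integral_mono, subst nn_integral_cmult)
               (auto intro!: mult_left_mono stft_norm_integral_le f s\<gamma> schwartz_measurable schwartz_stft
                  simp: measurable_Pair2'[THEN measurable_compose, OF _ st_m'])
          also have "\<dots> = ennreal c * (\<integral>\<^sup>+y. ennreal (N y) \<partial>lborel) * ennreal ?K"
            using c N0 by (simp add: nn_integral_multc ennreal_mult nn_integral_cmult)
          also have "\<dots> < \<infinity>" using Ni' by (simp add: ennreal_mult_less_top)
          finally show "(\<integral>\<^sup>+p. ennreal (norm (c * N (fst p) * norm (stft f \<gamma> (snd p) (fst p)))) \<partial>lborel2) < \<infinity>" .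
        qed measurable
        show "AE p in lborel2. (\<lambda>n. Wn n (fst p) (snd p) * stft f \<gamma> (snd p) (fst p)) \<longlonglongrightarrow> W (fst p) (snd p) * stft f \<gamma> (snd p) (fst p)"
          by (intro AE_I2 tendsto_mult_right W_lim)
        show "AE p in lborel2. norm (Wn n (fst p) (snd p) * stft f \<gamma> (snd p) (fst p)) \<le> c * N (fst p) * norm (stft f \<gamma> (snd p) (fst p))" for n
          by (intro AE_I2) (simp add: norm_mult mult_right_mono Wn_b)
        show "(\<lambda>p. W (fst p) (snd p) * stft f \<gamma> (snd p) (fst p)) \<in> borel_measurable lborel2"
          using W_m st_m' by (intro borel_measurable_times) (simp_all add: case_prod_beta')
      qed measurable
      moreover have "(\<lambda>n. u (\<lambda>x. h (eps n *\<^sub>R x) * fourier f x)) \<longlonglongrightarrow> u (fourier f)"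
        by (rule tempered_dilate_tendsto[OF tu sh h0 schwartz_fourier[OF f]])
      ultimately show ?thesis unfolding fin by (rule LIMSEQ_unique[rotated])
    qed
    have "dominated_symbol W N c"
      by unfold_locales (use W_m W_b c N0 Ni' in \<open>simp_all add: case_prod_beta'\<close>)
    then show ?thesis using Neq rep by blast
  qed
  then show ?thesis unfolding \<gamma>_def by blast
qed

section \<open>Uniqueness of integrable densities\<close>

text \<open>No integrability is assumed: the Bochner integral of a non-integrable function has the
  default value 0.\<close>

lemma ennreal_norm_integral_le:
  fixes f :: "'a \<Rightarrow> 'b::{banach, second_countable_topology}"
  shows "ennreal (norm (LINT x|M. f x)) \<le> (\<integral>\<^sup>+x. ennreal (norm (f x)) \<partial>M)"
  by (cases "integrable M f") (simp_all add: integral_norm_bound_ennreal not_integrable_integral_eq)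

text \<open>
  Any window furnishes an approximate identity \<open>\<bar>g\<bar>\<^sup>2\<close>, so no further bump function is needed.
\<close>

lemma integral_open_eq_0:
  fixes F g :: "'a::euclidean_space \<Rightarrow> complex"
  assumes g: "schwartz g" and g1: "(\<integral>\<^sup>+x. ennreal ((norm (g x))\<^sup>2) \<partial>lborel) = 1"
    and F: "integrable lborel F" and z: "\<And>f. schwartz f \<Longrightarrow> (LINT x|lborel. F x * f x) = 0"
    and U: "open U" and fr: "AE x in lborel. x \<notin> frontier U"
  shows "(LINT x:U|lborel. F x) = 0"
proof -
  let ?\<psi> = "\<lambda>x. (norm (g x))\<^sup>2"
  have [measurable]: "g \<in> borel_measurable borel" "F \<in> borel_measurable borel" "U \<in> sets borel"
    using schwartz_measurable[OF g] F U by auto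
  have \<psi>i: "integrable lborel ?\<psi>" by (rule integrableI_bounded) (use g1 in auto)
  have \<psi>1: "(LINT x|lborel. ?\<psi> x) = 1"
    by (subst integral_eq_nn_integral) (use g1 in auto)
  \<comment> \<open>The indicator of \<open>U\<close> averaged against
    \<open>\<bar>g\<bar>^2\<close> at scale \<open>eps n\<close>; off the frontier the indicator is
    locally constant, so the averages converge to it.\<close>
  define G where "G n x = (LINT v|lborel. ?\<psi> v * indicator U (x + eps n *\<^sub>R v))" for n and x :: 'a
  have G_m [measurable]: "G n \<in> borel_measurable borel" for n
    unfolding G_def[abs_def] by measurable
  have G_le: "norm (G n x) \<le> 1" for n x
  proof -
    have "norm (G n x) \<le> (LINT v|lborel. ?\<psi> v)"
      unfolding G_def
      by (intro order_trans[OF integral_norm_bound integral_mono_AE])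
         (auto intro!: Bochner_Integration.integrable_bound[OF \<psi>i] simp: \<psi>i indicator_def)
    then show ?thesis by (simp add: \<psi>1)
  qed
  have G_lim: "(\<lambda>n. G n x) \<longlonglongrightarrow> indicator U x" if "x \<notin> frontier U" for x
  proof -
    have cases: "x \<in> U \<or> x \<in> - closure U"
      using that U by (auto simp: frontier_def interior_open)
    have "(\<lambda>n. G n x) \<longlonglongrightarrow> (LINT v|lborel. ?\<psi> v * indicator U x)"
      unfolding G_def
    proof (rule integral_dominated_convergence[where w = ?\<psi>])
      show "AE v in lborel. (\<lambda>n. ?\<psi> v * indicator U (x + eps n *\<^sub>R v)) \<longlonglongrightarrow> ?\<psi> v * indicator U x"
      proof (intro AE_I2 tendsto_mult_left)
        fix v :: 'a
        have "(\<lambda>n. x + eps n *\<^sub>R v) \<longlonglongrightarrow> x + 0 *\<^sub>R v" by (intro tendsto_intros eps_tendsto)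
        then have lim: "(\<lambda>n. x + eps n *\<^sub>R v) \<longlonglongrightarrow> x" by simp
        have "\<forall>\<^sub>F n in sequentially. indicator U (x + eps n *\<^sub>R v) = (indicator U x :: real)"
          using cases
        proof
          assume x: "x \<in> U"
          from topological_tendstoD[OF lim U x] show ?thesis
            by eventually_elim (use x in auto)
        next
          assume x: "x \<in> - closure U"
          have "open (- closure U)" by (simp add: open_Compl)
          from topological_tendstoD[OF lim this x] show ?thesis
            by eventually_elim (use x closure_subset[of U] in \<open>auto simp: indicator_def\<close>)
        qed
        then show "(\<lambda>n. indicator U (x + eps n *\<^sub>R v)) \<longlonglongrightarrow> (indicator U x :: real)"
          by (rule tendsto_eventually)
      qed
    qed (auto simp: \<psi>i indicator_def)
    then show ?thesis by (simp add: \<psi>1)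
  qed
  have "(\<lambda>n. LINT x|lborel. F x * of_real (G n x)) \<longlonglongrightarrow> (LINT x|lborel. F x * of_real (indicator U x))"
  proof (rule integral_dominated_convergence[where w = "\<lambda>x. norm (F x)"])
    show "AE x in lborel. (\<lambda>n. F x * of_real (G n x)) \<longlonglongrightarrow> F x * of_real (indicator U x)"
      using fr by eventually_elim (intro tendsto_intros G_lim)
    show "AE x in lborel. norm (F x * of_real (G n x)) \<le> norm (F x)" for n
      using G_le[of n] by (intro AE_I2) (simp add: norm_mult mult_left_le)
  qed (use F in auto)
  moreover have "(LINT x|lborel. F x * of_real (G n x)) = 0" for n
  proof -
    \<comment> \<open>After the substitution \<open>y = x + eps n *\<^sub>R v\<close> the smoothing
      kernel is, for fixed \<open>y\<close>, a Schwartz function of \<open>x\<close>, and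
      orthogonality applies under the integral over \<open>y\<close>.\<close>
    let ?H = "\<lambda>x y. F x * (of_real (?\<psi> ((y - x) /\<^sub>R eps n) * indicator U y) / of_real (eps n) ^ DIM('a))"
    have sub: "of_real (G n x) = (LINT y|lborel. complex_of_real (?\<psi> ((y - x) /\<^sub>R eps n) * indicator U y) / of_real (eps n) ^ DIM('a))" for x
    proof -
      have "of_real (G n x) = (LINT v|lborel. complex_of_real (?\<psi> v * indicator U (x + eps n *\<^sub>R v)))"
        unfolding G_def by (rule integral_complex_of_real[symmetric])
      also have "\<dots> = (LINT y|lborel. complex_of_real (?\<psi> ((y - x) /\<^sub>R eps n) * indicator U y) / of_real (eps n) ^ DIM('a))"
        by (subst (2) integral_lborel_affine[where c = "eps n" and t = x])
           (auto simp: scaleR_conv_of_real abs_of_pos[OF eps_pos])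
      finally show ?thesis .
    qed
    have sch: "schwartz (\<lambda>x. complex_of_real (?\<psi> ((y - x) /\<^sub>R eps n) * indicator U y) / of_real (eps n) ^ DIM('a))" for y
    proof -
      have "schwartz (\<lambda>x. g ((- inverse (eps n)) *\<^sub>R x + inverse (eps n) *\<^sub>R y))"
        by (intro schwartz_affine g) simp
      then have "schwartz (\<lambda>x. g ((y - x) /\<^sub>R eps n))" by (simp add: scaleR_diff_right)
      then have "schwartz (\<lambda>x. (of_real (indicator U y) / of_real (eps n) ^ DIM('a)) * (g ((y - x) /\<^sub>R eps n) * cnj (g ((y - x) /\<^sub>R eps n))))"
        by (intro schwartz_cmult schwartz_mult schwartz_cnj)
      then show ?thesis by (simp add: complex_norm_square[symmetric] mult.commute[of "complex_of_real (indicat_real U y)"] del: of_real_power)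
    qed
    have int: "integrable lborel2 (case_prod ?H)"
    proof (rule integrableI_bounded)
      show m: "case_prod ?H \<in> borel_measurable lborel2" by measurable
      have "(\<integral>\<^sup>+p. ennreal (norm (case_prod ?H p)) \<partial>lborel2) = (\<integral>\<^sup>+x. \<integral>\<^sup>+y. ennreal (norm (?H x y)) \<partial>lborel \<partial>lborel)"
        using m by (subst lborel.nn_integral_fst[symmetric]) auto
      also have "\<dots> \<le> (\<integral>\<^sup>+x. ennreal (norm (F x)) * (\<integral>\<^sup>+y. ennreal (?\<psi> ((y - x) /\<^sub>R eps n) / eps n ^ DIM('a)) \<partial>lborel) \<partial>lborel)"
      proof (subst nn_integral_cmult[symmetric], simp, intro nn_integral_mono)
        fix x y
        have "norm (?H x y) \<le> norm (F x) * (?\<psi> ((y - x) /\<^sub>R eps n) / eps n ^ DIM('a))"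
          using eps_pos[of n]
          by (auto simp: norm_mult norm_divide norm_power indicator_def less_imp_le simp del: eps_pos intro!: mult_left_mono)
        then show "ennreal (norm (?H x y)) \<le> ennreal (norm (F x)) * ennreal (?\<psi> ((y - x) /\<^sub>R eps n) / eps n ^ DIM('a))"
          using eps_pos[of n] by (subst ennreal_mult[symmetric]) (auto intro!: ennreal_leI simp: less_imp_le simp del: eps_pos)
      qed
      also have "\<dots> = (\<integral>\<^sup>+x. ennreal (norm (F x)) * 1 \<partial>lborel)"
      proof (intro nn_integral_cong arg_cong2[where f = "(*)"] refl)
        fix x :: 'a
        have "(\<integral>\<^sup>+y. ennreal (?\<psi> ((y - x) /\<^sub>R eps n) / eps n ^ DIM('a)) \<partial>lborel)
           = ennreal (\<bar>eps n\<bar> ^ DIM('a)) * (\<integral>\<^sup>+y. ennreal (?\<psi> y / eps n ^ DIM('a)) \<partial>lborel)"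
          by (subst nn_integral_lborel_affine[where c = "eps n" and t = x]) auto
        also have "\<dots> = (\<integral>\<^sup>+y. ennreal (?\<psi> y) \<partial>lborel)"
          using eps_pos[of n]
          by (subst nn_integral_cmult[symmetric]) (auto simp: ennreal_mult[symmetric] less_imp_le simp del: eps_pos)
        finally show "(\<integral>\<^sup>+y. ennreal (?\<psi> ((y - x) /\<^sub>R eps n) / eps n ^ DIM('a)) \<partial>lborel) = 1"
          using g1 by simp
      qed
      also have "\<dots> < \<infinity>" using F by (simp add: integrable_iff_bounded)
      finally show "(\<integral>\<^sup>+p. ennreal (norm (case_prod ?H p)) \<partial>lborel2) < \<infinity>" .
    qed
    have "(LINT x|lborel. F x * of_real (G n x)) = (LINT x|lborel. LINT y|lborel. ?H x y)"
      unfolding sub integral_mult_right_zero by simp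
    also have "\<dots> = (LINT y|lborel. LINT x|lborel. ?H x y)"
      by (rule lborel_pair.Fubini_integral[OF int, symmetric])
    also have "\<dots> = 0" unfolding z[OF sch] by simp
    finally show ?thesis .
  qed
  ultimately have "(\<lambda>n. 0) \<longlonglongrightarrow> (LINT x|lborel. F x * of_real (indicator U x))" by simp
  then have "(LINT x|lborel. F x * of_real (indicator U x)) = 0" by (metis LIMSEQ_const_iff)
  then show ?thesis by (simp add: set_lebesgue_integral_def scaleR_conv_of_real mult.commute)
qed

text \<open>Boxes have null frontiers, so \<open>integral_open_eq_0\<close> handles them. They are
  stable under intersection and generate the Borel sets, so the integral of \<open>F\<close>
  vanishes over every Borel set.\<close>

lemma integrable_orthogonal_schwartz_AE_0:
  fixes F g :: "'a::euclidean_space \<Rightarrow> complex"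
  assumes g: "schwartz g" and g1: "(\<integral>\<^sup>+x. ennreal ((norm (g x))\<^sup>2) \<partial>lborel) = 1"
    and F: "integrable lborel F" and z: "\<And>f. schwartz f \<Longrightarrow> (LINT x|lborel. F x * f x) = 0"
  shows "AE x in lborel. F x = 0"
proof (rule sigma_finite_measure.density_zero[OF sigma_finite_lborel F])
  fix A :: "'a set" assume "A \<in> sets lborel"
  then have A: "A \<in> sigma_sets UNIV (range (\<lambda>(a, b). box a b :: 'a set))"
    by (simp add: borel_eq_box)
  have sets: "B \<in> sets lborel" if "B \<in> sigma_sets UNIV (range (\<lambda>(a, b). box a b :: 'a set))" for B
    using that by (simp add: borel_eq_box)
  have si: "set_integrable lborel B F" if "B \<in> sets lborel" for B
    unfolding set_integrable_def by (intro integrable_mult_indicator that F)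
  show "(LINT x:A|lborel. F x) = 0"
  proof (rule sigma_sets_induct_disjoint[OF _ _ A, where P = "\<lambda>A. (LINT x:A|lborel. F x) = 0"])
    show "Int_stable (range (\<lambda>(a, b). box a b :: 'a set))"
      unfolding Int_stable_def by (auto simp: box_Int_box)
    show "(LINT x:B|lborel. F x) = 0" if B: "B \<in> range (\<lambda>(a, b). box a b)" for B
    proof -
      obtain a b where ab: "B = box a b" using B by auto
      have "negligible (frontier (box a b))"
        by (rule negligible_convex_frontier) simp
      then have "frontier (box a b) \<in> null_sets lborel"
        by (simp add: negligible_iff_null_sets null_sets_completion_iff)
      from AE_not_in[OF this] show ?thesis
        unfolding ab by (intro integral_open_eq_0[OF g g1 F z]) auto
    qed
    have U: "(LINT x:UNIV|lborel. F x) = 0"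
      by (intro integral_open_eq_0[OF g g1 F z]) auto
    show "(LINT x:UNIV - B|lborel. F x) = 0"
      if "B \<in> sigma_sets UNIV (range (\<lambda>(a, b). box a b))" and "(LINT x:B|lborel. F x) = 0" for B
    proof -
      have "(LINT x:UNIV|lborel. F x) = (LINT x:B \<union> (UNIV - B)|lborel. F x)"
        by (simp add: Un_absorb1)
      also have "\<dots> = (LINT x:B|lborel. F x) + (LINT x:UNIV - B|lborel. F x)"
        using sets[OF that(1)] by (intro set_integral_Un si) auto
      finally show ?thesis using U that(2) by simp
    qed
    show "(LINT x:(\<Union>i. B i)|lborel. F x) = 0"
      if d: "disjoint_family B" and B: "range B \<subseteq> sigma_sets UNIV (range (\<lambda>(a, b). box a b))"
        and z: "\<And>i. (LINT x:B i|lborel. F x) = 0" for B :: "nat \<Rightarrow> 'a set"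
    proof -
      have "B i \<in> sets lborel" for i using B sets by blast
      then have "(LINT x:(\<Union>i. B i)|lborel. F x) = (\<Sum>i. LINT x:B i|lborel. F x)"
        using d by (intro lebesgue_integral_countable_add si sets.countable_UN) (auto simp: disjoint_family_on_def)
      then show ?thesis by (simp add: z)
    qed
  qed (auto simp: set_lebesgue_integral_def)
qed

section \<open>The Schroedinger evolution on the phase space side\<close>

text \<open>Expanding the square of \<open>norm (x + w)\<close> leaves a constant phase, the chirp
  itself, and a plane wave of frequency proportional to \<open>t\<close> and
  \<open>w\<close>.\<close>

lemma chirp_add:
  "chirp t (x + w) = ee (- 2 * pi * t * (norm w)\<^sup>2) * ee (- (x \<bullet> (4 * pi * t) *\<^sub>R w)) * chirp t x"
  unfolding chirp_def ee_add[symmetric]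
  by (rule arg_cong[where f = ee]) (simp add: power2_norm_eq_inner inner_add_left inner_add_right inner_commute algebra_simps)

text \<open>Moving the shift from \<open>h\<close> to the chirp and the window: constant phases
  disappear in the norm, and the plane wave of \<open>chirp_add\<close> becomes a translation in
  frequency.\<close>

lemma norm_stft_chirp_shift:
  fixes h k :: "'a::euclidean_space \<Rightarrow> complex"
  assumes [measurable]: "h \<in> borel_measurable borel" "k \<in> borel_measurable borel"
  shows "norm (stft (\<lambda>x. chirp t x * h (x - w)) k z y) = norm (stft (\<lambda>x. chirp t x * h x) k (z - w) (y + (4 * pi * t) *\<^sub>R w))"
proof -
  let ?G = "\<lambda>x. chirp t (x + w) * h x * k (z - w - x) * ee (- ((x + w) \<bullet> y))"
  let ?c = "ee (- 2 * pi * t * (norm w)\<^sup>2) * ee (- (w \<bullet> y))"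
  have "stft (\<lambda>x. chirp t x * h (x - w)) k z y = (LINT x|lborel. ?G (x - w))"
    by (simp add: stft_eq)
  also have "\<dots> = (LINT x|lborel. ?G x)" by (rule integral_lborel_shift) measurable
  also have "\<dots> = (LINT x|lborel. ?c * (chirp t x * h x * k (z - w - x) * ee (- (x \<bullet> (y + (4 * pi * t) *\<^sub>R w)))))"
  proof (rule Bochner_Integration.integral_cong[OF refl])
    fix x
    have "ee (- ((x + w) \<bullet> y)) = ee (- (x \<bullet> y)) * ee (- (w \<bullet> y))"
      by (simp add: ee_add[symmetric] inner_add_left)
    moreover have "ee (- (x \<bullet> (y + (4 * pi * t) *\<^sub>R w))) = ee (- (x \<bullet> y)) * ee (- (x \<bullet> (4 * pi * t) *\<^sub>R w))"
      by (simp add: ee_add[symmetric] inner_add_right)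
    ultimately show "?G x = ?c * (chirp t x * h x * k (z - w - x) * ee (- (x \<bullet> (y + (4 * pi * t) *\<^sub>R w))))"
      unfolding chirp_add by (simp only: mult_ac)
  qed
  also have "\<dots> = ?c * stft (\<lambda>x. chirp t x * h x) k (z - w) (y + (4 * pi * t) *\<^sub>R w)"
    unfolding stft_eq integral_mult_right_zero ..
  finally show ?thesis by (simp add: norm_mult)
qed

definition stft_chirp_norm :: "real \<Rightarrow> ('a::euclidean_space \<Rightarrow> complex) \<Rightarrow> ('a \<Rightarrow> complex) \<Rightarrow> ennreal" where
  "stft_chirp_norm t h k = (\<integral>\<^sup>+z. \<integral>\<^sup>+w. ennreal (norm (stft (\<lambda>x. chirp t x * h x) k z w)) \<partial>lborel \<partial>lborel)"

lemma stft_measurable':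
  assumes "h \<in> borel_measurable borel" "k \<in> borel_measurable borel"
  shows "(\<lambda>p. stft h k (snd p) (fst p)) \<in> borel_measurable (borel \<Otimes>\<^sub>M borel)"
proof -
  have "sets (borel \<Otimes>\<^sub>M borel :: ('a \<times> 'a) measure) = sets lborel2"
    by (intro sets_pair_measure_cong) auto
  then show ?thesis using stft_measurable[OF assms] by (simp add: case_prod_beta' cong: measurable_cong_sets)
qed

text \<open>
  The substitution \<open>x = y + 4 \<pi> t w\<close> is the source of the decay \<open>\<bar>t\<bar>\<^sup>-\<^sup>d\<close>.
\<close>

lemma stft_chirp_shift_integral:
  fixes h k :: "'a::euclidean_space \<Rightarrow> complex"
  assumes m [measurable]: "h \<in> borel_measurable borel" "k \<in> borel_measurable borel" and t: "t \<noteq> 0"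
  shows "(\<integral>\<^sup>+z. \<integral>\<^sup>+w. ennreal (norm (stft (\<lambda>x. chirp t x * h (x - w)) k z y)) \<partial>lborel \<partial>lborel)
      = ennreal (1 / (4 * pi * \<bar>t\<bar>) ^ DIM('a)) * stft_chirp_norm t h k"
proof -
  define S where "S z w = ennreal (norm (stft (\<lambda>x. chirp t x * h x) k z w))" for z w
  have S_m [measurable]: "(\<lambda>p. S (snd p) (fst p)) \<in> borel_measurable (borel \<Otimes>\<^sub>M borel)"
    using stft_measurable'[of "\<lambda>x. chirp t x * h x" k] unfolding S_def by measurable
  have S_m' [measurable (raw)]: "(\<lambda>x. S (a x) (b x)) \<in> borel_measurable M"
    if "a \<in> borel_measurable M" "b \<in> borel_measurable M" for a b and M :: "'c measure"
    using measurable_compose[OF measurable_Pair[OF that(2,1)] S_m] by simp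
  let ?c = "4 * pi * t"
  have c: "?c \<noteq> 0" using t by simp
  have "(\<integral>\<^sup>+z. \<integral>\<^sup>+w. ennreal (norm (stft (\<lambda>x. chirp t x * h (x - w)) k z y)) \<partial>lborel \<partial>lborel)
      = (\<integral>\<^sup>+z. \<integral>\<^sup>+w. S (z - w) (y + ?c *\<^sub>R w) \<partial>lborel \<partial>lborel)"
    unfolding S_def by (simp only: norm_stft_chirp_shift[OF m])
  \<comment> \<open>The displacement of \<open>z\<close> by \<open>w\<close> is removed with
    \<open>w\<close> held fixed, so the order of integration is exchanged for this step and then
    restored for the substitution in \<open>w\<close>.\<close>
  also have "\<dots> = (\<integral>\<^sup>+w. \<integral>\<^sup>+z. S (z - w) (y + ?c *\<^sub>R w) \<partial>lborel \<partial>lborel)"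
    by (rule lborel_pair.Fubini') measurable
  also have "\<dots> = (\<integral>\<^sup>+w. \<integral>\<^sup>+z. S z (y + ?c *\<^sub>R w) \<partial>lborel \<partial>lborel)"
    by (intro nn_integral_cong nn_integral_lborel_shift) measurable
  also have "\<dots> = (\<integral>\<^sup>+z. \<integral>\<^sup>+w. S z (y + ?c *\<^sub>R w) \<partial>lborel \<partial>lborel)"
    by (rule lborel_pair.Fubini') measurable
  also have "\<dots> = (\<integral>\<^sup>+z. ennreal (1 / (4 * pi * \<bar>t\<bar>) ^ DIM('a)) * (\<integral>\<^sup>+w. S z w \<partial>lborel) \<partial>lborel)"
  proof (rule nn_integral_cong)
    fix z
    have "(\<integral>\<^sup>+w. S z w \<partial>lborel) = ennreal (\<bar>?c\<bar> ^ DIM('a)) * (\<integral>\<^sup>+w. S z (y + ?c *\<^sub>R w) \<partial>lborel)"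
      by (rule nn_integral_lborel_affine[OF _ c]) measurable
    then have "ennreal (1 / (4 * pi * \<bar>t\<bar>) ^ DIM('a)) * (\<integral>\<^sup>+w. S z w \<partial>lborel)
       = (ennreal (1 / (4 * pi * \<bar>t\<bar>) ^ DIM('a)) * ennreal (\<bar>?c\<bar> ^ DIM('a))) * (\<integral>\<^sup>+w. S z (y + ?c *\<^sub>R w) \<partial>lborel)"
      by (simp only: mult.assoc)
    also have "ennreal (1 / (4 * pi * \<bar>t\<bar>) ^ DIM('a)) * ennreal (\<bar>?c\<bar> ^ DIM('a)) = 1"
      using t by (subst ennreal_mult[symmetric]) (auto simp: abs_mult)
    finally show "(\<integral>\<^sup>+w. S z (y + ?c *\<^sub>R w) \<partial>lborel) = ennreal (1 / (4 * pi * \<bar>t\<bar>) ^ DIM('a)) * (\<integral>\<^sup>+w. S z w \<partial>lborel)"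
      by simp
  qed
  also have "\<dots> = ennreal (1 / (4 * pi * \<bar>t\<bar>) ^ DIM('a)) * stft_chirp_norm t h k"
    unfolding stft_chirp_norm_def S_def[symmetric] by (rule nn_integral_cmult) measurable
  finally show ?thesis .
qed

text \<open>A modulation merely translates the frequency variable, over which the norm integrates.
  This makes the final estimate uniform in the position of the window.\<close>

lemma stft_chirp_norm_modulate:
  assumes [measurable]: "h \<in> borel_measurable borel" "k \<in> borel_measurable borel"
  shows "stft_chirp_norm t (\<lambda>x. ee (v \<bullet> x) * h x) k = stft_chirp_norm t h k"
proof -
  have "stft (\<lambda>x. chirp t x * (ee (v \<bullet> x) * h x)) k z w = stft (\<lambda>x. chirp t x * h x) k z (w - v)" for z w
    unfolding stft_def fourier_modulate[symmetric] by (simp add: mult_ac)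
  moreover have "(\<integral>\<^sup>+w. ennreal (norm (stft (\<lambda>x. chirp t x * h x) k z (w - v))) \<partial>lborel)
     = (\<integral>\<^sup>+w. ennreal (norm (stft (\<lambda>x. chirp t x * h x) k z w)) \<partial>lborel)" for z
  proof (rule nn_integral_lborel_shift)
    have "(\<lambda>w. stft (\<lambda>x. chirp t x * h x) k z w) \<in> borel_measurable borel"
      unfolding stft_eq by measurable
    then show "(\<lambda>w. ennreal (norm (stft (\<lambda>x. chirp t x * h x) k z w))) \<in> borel_measurable borel" by measurable
  qed
  ultimately show ?thesis by (simp add: stft_chirp_norm_def)
qed

text \<open>The convolution theorem, obtained from the multiplication formula with \<open>h\<close>
  modulated by \<open>v\<close>. It exhibits the result as a superposition of translates of
  \<open>inv_fourier h\<close>.\<close>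

lemma fourier_mult_modulated:
  assumes h: "schwartz h" and f: "schwartz f"
  shows "inv_fourier (\<lambda>x. h x * fourier f x) v = (LINT w|lborel. f w * inv_fourier h (v - w))"
proof -
  have hv: "schwartz (\<lambda>x. h x * ee (x \<bullet> v))" using schwartz_ee[OF h, of v] by (simp add: mult.commute)
  have "inv_fourier (\<lambda>x. h x * fourier f x) v = (LINT x|lborel. fourier f x * (h x * ee (x \<bullet> v)))"
    by (simp add: inv_fourier_eq_fourier fourier_eq[of "\<lambda>x. h x * fourier f x"] mult_ac)
  also have "\<dots> = (LINT w|lborel. f w * fourier (\<lambda>x. h x * ee (x \<bullet> v)) w)"
    by (intro fourier_mult_exchange schwartz_integrable f hv)
  also have "\<dots> = (LINT w|lborel. f w * inv_fourier h (v - w))"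
  proof -
    have "fourier (\<lambda>x. h x * ee (x \<bullet> v)) w = inv_fourier h (v - w)" for w
      using fourier_modulate[of v h w] by (simp add: inv_fourier_eq_fourier mult.commute inner_commute)
    then show ?thesis by simp
  qed
  finally show ?thesis .
qed

text \<open>By duality the propagator acts on the test function, and \<open>u\<close> is left paired
  with a Fourier transform, the form treated by \<open>amalgam_representation\<close>.\<close>

lemma schroedinger_eq:
  "schroedinger t u \<phi> = u (fourier (\<lambda>x. chirp t x * inv_fourier \<phi> x))"
  unfolding schroedinger_def inv_fourier_distr_def mult_distr_def fourier_distr_def chirp_eq chirp_def ..

lemma fourier_add: "schwartz f \<Longrightarrow> schwartz g \<Longrightarrow> fourier (\<lambda>x. f x + g x) = (\<lambda>w. fourier f w + fourier g w)"
  by (simp add: fun_eq_iff fourier_eq distrib_right integrable_mult_ee schwartz_integrable)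

lemma fourier_cmult: "fourier (\<lambda>x. c * f x) = (\<lambda>w. c * fourier f w)"
  by (simp only: fun_eq_iff fourier_eq mult.assoc integral_mult_right_zero) simp

lemma stft_superposition:
  fixes f h k :: "'a::euclidean_space \<Rightarrow> complex"
  assumes f: "schwartz f" and h: "schwartz h" and k: "schwartz k"
  shows "stft (\<lambda>x. chirp t x * (LINT w|lborel. f w * h (x - w))) k z y = (LINT w|lborel. f w * stft (\<lambda>x. chirp t x * h (x - w)) k z y)"
proof -
  have [measurable]: "f \<in> borel_measurable borel" "h \<in> borel_measurable borel" "k \<in> borel_measurable borel"
    by (intro schwartz_measurable f h k)+
  obtain B where B: "0 < B" "\<And>x. norm (h x) \<le> B" using schwartz_bounded[OF h] by blast
  let ?F = "\<lambda>x w. f w * (chirp t x * h (x - w) * k (z - x) * ee (- (x \<bullet> y)))"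
  have int: "integrable lborel2 (case_prod ?F)"
  proof (rule integrable_pair_dominated[OF sigma_finite_lborel])
    show "integrable lborel (\<lambda>x. B * norm (k (z - x)))"
      by (intro integrable_mult_right integrable_norm schwartz_integrable schwartz_reflect k)
    show "integrable lborel (\<lambda>x. norm (f x))" by (intro integrable_norm schwartz_integrable f)
    show "case_prod ?F \<in> borel_measurable lborel2" by measurable
    show "norm (?F x w) \<le> B * norm (k (z - x)) * norm (f w)" for x w
      using mult_right_mono[OF B(2)[of "x - w"], of "norm (k (z - x)) * norm (f w)"] by (simp add: norm_mult mult_ac)
  qed
  have "stft (\<lambda>x. chirp t x * (LINT w|lborel. f w * h (x - w))) k z y = (LINT x|lborel. LINT w|lborel. ?F x w)"
  proof -
    have "chirp t x * (LINT w|lborel. f w * h (x - w)) * k (z - x) * ee (- (x \<bullet> y)) = (LINT w|lborel. ?F x w)" for x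
    proof -
      have "(LINT w|lborel. ?F x w) = (LINT w|lborel. (chirp t x * k (z - x) * ee (- (x \<bullet> y))) * (f w * h (x - w)))"
        by (simp add: mult_ac)
      also have "\<dots> = (chirp t x * k (z - x) * ee (- (x \<bullet> y))) * (LINT w|lborel. f w * h (x - w))"
        by (rule integral_mult_right_zero)
      finally show ?thesis by (simp add: mult_ac)
    qed
    then show ?thesis by (simp add: stft_eq)
  qed
  also have "\<dots> = (LINT w|lborel. LINT x|lborel. ?F x w)"
    by (rule lborel_pair.Fubini_integral[OF int, symmetric])
  also have "\<dots> = (LINT w|lborel. f w * stft (\<lambda>x. chirp t x * h (x - w)) k z y)"
    unfolding stft_eq by (simp only: integral_mult_right_zero)
  finally show ?thesis .
qed

context dominated_symbol
begin

text \<open>With \<open>h\<close> the inverse transform of a localising function, this is the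
  Fourier density of the evolved distribution multiplied by that function.\<close>

definition evolved_density :: "real \<Rightarrow> ('a \<Rightarrow> complex) \<Rightarrow> ('a \<Rightarrow> complex) \<Rightarrow> 'a \<Rightarrow> complex" where
  "evolved_density t k h w =
     (LINT p|lborel2. W (fst p) (snd p) * stft (\<lambda>x. chirp t x * h (x - w)) k (snd p) (fst p))"

text \<open>Once \<open>W\<close> is replaced by \<open>c * N y\<close>, the integral over
  \<open>z\<close> and \<open>w\<close> is the same for every \<open>y\<close> by
  \<open>stft_chirp_shift_integral\<close>; the remaining integral over \<open>y\<close> involves
  only \<open>N\<close>.\<close>

lemma evolved_density_nn_integral_le:
  assumes [measurable]: "h \<in> borel_measurable borel" "k \<in> borel_measurable borel"
    and t: "t \<noteq> 0"
  shows "(\<integral>\<^sup>+p. \<integral>\<^sup>+w. ennreal (norm (W (fst p) (snd p) * stft (\<lambda>x. chirp t x * h (x - w)) k (snd p) (fst p))) \<partial>lborel \<partial>lborel2)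
    \<le> ennreal (c / (4 * pi * \<bar>t\<bar>) ^ DIM('a)) * stft_chirp_norm t h k * (\<integral>\<^sup>+y. ennreal (N y) \<partial>lborel)"
proof -
  define B where "B y z w = ennreal (norm (stft (\<lambda>x. chirp t x * h (x - w)) k z y))" for y z w
  have B_m [measurable]: "(\<lambda>q. B (fst (fst q)) (snd (fst q)) (snd q)) \<in> borel_measurable (lborel2 \<Otimes>\<^sub>M lborel)"
    unfolding B_def stft_eq by measurable
  have B_m2 [measurable]: "(\<lambda>p. \<integral>\<^sup>+w. B (fst p) (snd p) w \<partial>lborel) \<in> borel_measurable lborel2"
    by measurable
  have m1: "(\<lambda>w. B y z w) \<in> borel_measurable lborel" for y z
    unfolding B_def stft_eq by measurable
  have m2: "(\<lambda>z. \<integral>\<^sup>+w. B y z w \<partial>lborel) \<in> borel_measurable lborel" for y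
    unfolding B_def stft_eq by measurable
  have "(\<integral>\<^sup>+p. \<integral>\<^sup>+w. ennreal (norm (W (fst p) (snd p) * stft (\<lambda>x. chirp t x * h (x - w)) k (snd p) (fst p))) \<partial>lborel \<partial>lborel2)
     \<le> (\<integral>\<^sup>+p. ennreal (c * N (fst p)) * (\<integral>\<^sup>+w. B (fst p) (snd p) w \<partial>lborel) \<partial>lborel2)"
  proof (intro nn_integral_mono, subst nn_integral_cmult[OF m1, symmetric], intro nn_integral_mono)
    fix p w
    have "ennreal (norm (W (fst p) (snd p))) \<le> ennreal (c * N (fst p))"
      by (intro ennreal_leI W_le)
    then show "ennreal (norm (W (fst p) (snd p) * stft (\<lambda>x. chirp t x * h (x - w)) k (snd p) (fst p)))
       \<le> ennreal (c * N (fst p)) * B (fst p) (snd p) w"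
      unfolding B_def by (simp add: norm_mult ennreal_mult mult_right_mono)
  qed
  also have "\<dots> = (\<integral>\<^sup>+y. \<integral>\<^sup>+z. ennreal (c * N y) * (\<integral>\<^sup>+w. B y z w \<partial>lborel) \<partial>lborel \<partial>lborel)"
    by (subst lborel.nn_integral_fst[symmetric]) simp_all
  also have "\<dots> = (\<integral>\<^sup>+y. ennreal (c * N y) * (ennreal (1 / (4 * pi * \<bar>t\<bar>) ^ DIM('a)) * stft_chirp_norm t h k) \<partial>lborel)"
  proof (rule nn_integral_cong)
    fix y :: 'a
    show "(\<integral>\<^sup>+z. ennreal (c * N y) * (\<integral>\<^sup>+w. B y z w \<partial>lborel) \<partial>lborel)
      = ennreal (c * N y) * (ennreal (1 / (4 * pi * \<bar>t\<bar>) ^ DIM('a)) * stft_chirp_norm t h k)"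
      unfolding nn_integral_cmult[OF m2] unfolding B_def by (simp add: stft_chirp_shift_integral t)
  qed
  also have "\<dots> = ennreal c * (\<integral>\<^sup>+y. ennreal (N y) \<partial>lborel) * (ennreal (1 / (4 * pi * \<bar>t\<bar>) ^ DIM('a)) * stft_chirp_norm t h k)"
    by (simp add: nn_integral_multc nn_integral_cmult ennreal_mult c_nonneg N_nonneg)
  also have "\<dots> = (ennreal c * ennreal (1 / (4 * pi * \<bar>t\<bar>) ^ DIM('a))) * stft_chirp_norm t h k * (\<integral>\<^sup>+y. ennreal (N y) \<partial>lborel)"
    by (simp only: mult_ac)
  also have "ennreal c * ennreal (1 / (4 * pi * \<bar>t\<bar>) ^ DIM('a)) = ennreal (c / (4 * pi * \<bar>t\<bar>) ^ DIM('a))"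
    using c_nonneg by (subst ennreal_mult[symmetric]) auto
  finally show ?thesis .
qed

lemma evolved_density_norm_le:
  assumes m [measurable]: "h \<in> borel_measurable borel" "k \<in> borel_measurable borel"
    and t: "t \<noteq> 0"
  shows "(\<integral>\<^sup>+w. ennreal (norm (evolved_density t k h w)) \<partial>lborel)
    \<le> ennreal (c / (4 * pi * \<bar>t\<bar>) ^ DIM('a)) * stft_chirp_norm t h k * (\<integral>\<^sup>+y. ennreal (N y) \<partial>lborel)"
proof -
  let ?F = "\<lambda>p w. ennreal (norm (W (fst p) (snd p) * stft (\<lambda>x. chirp t x * h (x - w)) k (snd p) (fst p)))"
  have "(\<integral>\<^sup>+w. ennreal (norm (evolved_density t k h w)) \<partial>lborel) \<le> (\<integral>\<^sup>+w. \<integral>\<^sup>+p. ?F p w \<partial>lborel2 \<partial>lborel)"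
    unfolding evolved_density_def by (intro nn_integral_mono ennreal_norm_integral_le)
  also have "\<dots> = (\<integral>\<^sup>+p. \<integral>\<^sup>+w. ?F p w \<partial>lborel \<partial>lborel2)"
    by (rule lborel2_pair.Fubini') (unfold stft_eq, measurable)
  also have "\<dots> \<le> ennreal (c / (4 * pi * \<bar>t\<bar>) ^ DIM('a)) * stft_chirp_norm t h k * (\<integral>\<^sup>+y. ennreal (N y) \<partial>lborel)"
    by (rule evolved_density_nn_integral_le[OF m t])
  finally show ?thesis .
qed

text \<open>The extra parameter \<open>x\<close> of \<open>h\<close> is for the position of the
  window: it yields measurability of the local norm as a function of that position.\<close>

lemma evolved_density_measurable:
  fixes h :: "'b \<Rightarrow> 'a \<Rightarrow> complex"
  assumes [measurable]: "(\<lambda>(x, v). h x v) \<in> borel_measurable (M \<Otimes>\<^sub>M borel)" "k \<in> borel_measurable borel"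
  shows "(\<lambda>(x, w). evolved_density t k (h x) w) \<in> borel_measurable (M \<Otimes>\<^sub>M lborel)"
proof -
  show ?thesis
    unfolding evolved_density_def stft_eq by measurable
qed

text \<open>Finiteness of \<open>stft_chirp_norm\<close> and boundedness of \<open>f\<close> make
  the integral over \<open>y\<close>, \<open>z\<close> and \<open>w\<close> absolutely convergent,
  so the superposition in \<open>w\<close> can be taken outermost.\<close>

lemma evolved_density_pairing:
  assumes f: "schwartz f" and h: "schwartz h" and k: "schwartz k"
    and t: "t \<noteq> 0"
    and fin: "stft_chirp_norm t h k < \<infinity>"
  shows "(LINT p|lborel2. W (fst p) (snd p) * stft (\<lambda>x. chirp t x * (LINT w|lborel. f w * h (x - w))) k (snd p) (fst p))
    = (LINT w|lborel. evolved_density t k h w * f w)"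
proof -
  have m [measurable]: "h \<in> borel_measurable borel" "k \<in> borel_measurable borel" and fm [measurable]: "f \<in> borel_measurable borel"
    by (intro schwartz_measurable f h k)+
  obtain B where B: "0 < B" "\<And>x. norm (f x) \<le> B" using schwartz_bounded[OF f] by blast
  let ?G = "\<lambda>p w. W (fst p) (snd p) * stft (\<lambda>x. chirp t x * h (x - w)) k (snd p) (fst p)"
  let ?F = "\<lambda>p w. f w * ?G p w"
  have Gm [measurable]: "(\<lambda>q. ?G (fst q) (snd q)) \<in> borel_measurable (lborel2 \<Otimes>\<^sub>M lborel)"
    unfolding stft_eq by measurable
  have Gm1: "(\<lambda>w. ennreal (norm (?G p w))) \<in> borel_measurable lborel" for p
    unfolding stft_eq by measurable
  have Gm2: "(\<lambda>p. \<integral>\<^sup>+w. ennreal (norm (?G p w)) \<partial>lborel) \<in> borel_measurable lborel2"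
    unfolding stft_eq by measurable
  have Fm: "case_prod ?F \<in> borel_measurable (lborel2 \<Otimes>\<^sub>M lborel)"
    using Gm by (simp add: case_prod_beta')
  have int: "integrable (lborel2 \<Otimes>\<^sub>M lborel) (case_prod ?F)"
  proof (rule integrableI_bounded[OF Fm])
    have "(\<integral>\<^sup>+q. ennreal (norm (case_prod ?F q)) \<partial>(lborel2 \<Otimes>\<^sub>M lborel)) = (\<integral>\<^sup>+p. \<integral>\<^sup>+w. ennreal (norm (?F p w)) \<partial>lborel \<partial>lborel2)"
      using Fm by (subst lborel.nn_integral_fst[symmetric]) auto
    also have "\<dots> \<le> (\<integral>\<^sup>+p. \<integral>\<^sup>+w. ennreal B * ennreal (norm (?G p w)) \<partial>lborel \<partial>lborel2)"
    proof (intro nn_integral_mono)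
      fix p w
      have "norm (?F p w) \<le> B * norm (?G p w)"
        unfolding norm_mult[of "f w"] by (intro mult_right_mono B) simp
      then show "ennreal (norm (?F p w)) \<le> ennreal B * ennreal (norm (?G p w))"
        using B(1) by (simp only: ennreal_mult[symmetric] less_imp_le norm_ge_zero ennreal_leI)
    qed
    also have "\<dots> = ennreal B * (\<integral>\<^sup>+p. \<integral>\<^sup>+w. ennreal (norm (?G p w)) \<partial>lborel \<partial>lborel2)"
      unfolding nn_integral_cmult[OF Gm1] nn_integral_cmult[OF Gm2] ..
    also have "\<dots> \<le> ennreal B * (ennreal (c / (4 * pi * \<bar>t\<bar>) ^ DIM('a)) * stft_chirp_norm t h k * (\<integral>\<^sup>+y. ennreal (N y) \<partial>lborel))"
      by (intro mult_left_mono evolved_density_nn_integral_le m t) auto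
    also have "\<dots> < \<infinity>" using N_finite fin by (simp add: ennreal_mult_less_top)
    finally show "(\<integral>\<^sup>+q. ennreal (norm (case_prod ?F q)) \<partial>(lborel2 \<Otimes>\<^sub>M lborel)) < \<infinity>" .
  qed
  have "(LINT p|lborel2. W (fst p) (snd p) * stft (\<lambda>x. chirp t x * (LINT w|lborel. f w * h (x - w))) k (snd p) (fst p))
     = (LINT p|lborel2. LINT w|lborel. ?F p w)"
  proof (rule Bochner_Integration.integral_cong[OF refl])
    fix p
    have "(LINT w|lborel. ?F p w) = (LINT w|lborel. W (fst p) (snd p) * (f w * stft (\<lambda>x. chirp t x * h (x - w)) k (snd p) (fst p)))"
      by (simp add: mult_ac)
    also have "\<dots> = W (fst p) (snd p) * (LINT w|lborel. f w * stft (\<lambda>x. chirp t x * h (x - w)) k (snd p) (fst p))"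
      by (rule integral_mult_right_zero)
    finally show "W (fst p) (snd p) * stft (\<lambda>x. chirp t x * (LINT w|lborel. f w * h (x - w))) k (snd p) (fst p) = (LINT w|lborel. ?F p w)"
      unfolding stft_superposition[OF f h k] by simp
  qed
  also have "\<dots> = (LINT w|lborel. LINT p|lborel2. ?F p w)"
    by (rule lborel2_pair.Fubini_integral[OF int, symmetric])
  also have "\<dots> = (LINT w|lborel. evolved_density t k h w * f w)"
    unfolding evolved_density_def by (simp only: integral_mult_right_zero) (simp only: mult.commute)
  finally show ?thesis .
qed

end

section \<open>The dispersive estimate\<close>

text \<open>Two densities differ by an integrable function orthogonal to all Schwartz functions, so
  all of them have the same L^1 norm. The equality transfers measurability from an explicit density
  to the norm.\<close>

lemma FL_1_norm_eq:
  fixes v :: "'a::euclidean_space distr" and g D :: "'a \<Rightarrow> complex"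
  assumes g: "schwartz g" "(\<integral>\<^sup>+x. ennreal ((norm (g x))\<^sup>2) \<partial>lborel) = 1"
    and D: "D \<in> fourier_densities 1 v"
  shows "FL_norm 1 v = (\<integral>\<^sup>+w. ennreal (norm (D w)) \<partial>lborel)"
proof -
  have "Lp_norm 1 (\<lambda>w. ennreal (norm (D' w))) = (\<integral>\<^sup>+w. ennreal (norm (D w)) \<partial>lborel)"
    if D': "D' \<in> fourier_densities 1 v" for D'
  proof -
    have *: "integrable lborel E" "\<And>f. schwartz f \<Longrightarrow> v (fourier f) = (LINT w|lborel. E w * f w)"
      if "E \<in> fourier_densities 1 v" for E
      using that by (auto simp: fourier_densities_def Lp_space_def Lp_norm_1 fourier_distr_def integrable_iff_bounded)
    have bi: "integrable lborel (\<lambda>w. E w * f w)" if E: "E \<in> fourier_densities 1 v" and f: "schwartz f" for E f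
    proof -
      obtain B where B: "0 < B" "\<And>x. norm (f x) \<le> B" using schwartz_bounded[OF f] by blast
      have [measurable]: "f \<in> borel_measurable borel" "E \<in> borel_measurable borel"
        using schwartz_measurable[OF f] *(1)[OF E] by auto
      show ?thesis
      proof (rule Bochner_Integration.integrable_bound)
        show "integrable lborel (\<lambda>w. B * norm (E w))" using *(1)[OF E] by simp
        show "AE w in lborel. norm (E w * f w) \<le> norm (B * norm (E w))"
        proof (rule AE_I2)
          fix w
          show "norm (E w * f w) \<le> norm (B * norm (E w))"
            using B(1) mult_left_mono[OF B(2)[of w], of "norm (E w)"] by (simp add: norm_mult mult.commute)
        qed
      qed measurable
    qed
    have "AE w in lborel. D' w - D w = 0"
    proof (rule integrable_orthogonal_schwartz_AE_0[OF g])
      show "integrable lborel (\<lambda>w. D' w - D w)" using *(1) D D' by simp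
      show "(LINT w|lborel. (D' w - D w) * f w) = 0" if f: "schwartz f" for f
        using *(2)[OF D f] *(2)[OF D' f] bi[OF D f] bi[OF D' f] by (simp add: left_diff_distrib)
    qed
    then show ?thesis unfolding Lp_norm_1 by (intro nn_integral_cong_AE) auto
  qed
  then have "(\<lambda>h. Lp_norm 1 (\<lambda>w. ennreal (norm (h w)))) ` fourier_densities 1 v = {\<integral>\<^sup>+w. ennreal (norm (D w)) \<partial>lborel}"
    using D by auto
  then show ?thesis unfolding FL_norm_def by simp
qed

theorem proposition3p3:
  fixes g :: "'a::euclidean_space \<Rightarrow> complex"
  assumes "window g"
  shows "\<exists>C::real. 0 < C \<and>
    (\<forall>t::real. t \<noteq> 0 \<longrightarrow>
      (\<forall>u \<in> amalgam g \<infinity> 1.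
         schroedinger t u \<in> amalgam g 1 \<infinity> \<and>
         amalgam_norm g 1 \<infinity> (schroedinger t u)
           \<le> ennreal (C * ((1 + \<bar>t\<bar>) / t\<^sup>2) powr (real DIM('a) / 2)) * amalgam_norm g \<infinity> 1 u))"
proof -
  have tg: "test_function g" using assms by (simp add: window_def)
  have sg: "schwartz g" by (rule test_function_schwartz[OF tg])
  note g1 = window_L2[OF assms]
  define k where "k = inv_fourier (\<lambda>x. cnj (g x))"
  have sk: "schwartz k" unfolding k_def by (intro schwartz_inv_fourier schwartz_cnj sg)
  define g' where "g' = inv_fourier g"
  have sg': "schwartz g'" unfolding g'_def by (rule schwartz_inv_fourier[OF sg])
  have m [measurable]: "k \<in> borel_measurable borel" "g' \<in> borel_measurable borel"
    by (intro schwartz_measurable sk sg')+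
  obtain c where rep: "\<And>u. u \<in> amalgam g \<infinity> 1 \<Longrightarrow> \<exists>W N. dominated_symbol W N c \<and>
    local_FL_norm g \<infinity> u = (\<lambda>y. ennreal (N y)) \<and>
    (\<forall>f. schwartz f \<longrightarrow> u (fourier f) = (LINT p|lborel2. W (fst p) (snd p) * stft f k (snd p) (fst p)))"
    using amalgam_representation[OF assms] unfolding k_def by blast
  obtain K where K: "0 \<le> K" "\<And>t. stft_chirp_norm t g' k \<le> ennreal (K * (1 + \<bar>t\<bar>) powr (DIM('a) / 2))"
    using stft_chirp_L1[OF sg' sk] unfolding stft_chirp_norm_def by blast
  \<comment> \<open>The absolute value is taken because the sign of \<open>c\<close> is known only
    in the presence of some \<open>u\<close>; the added 1 ensures positivity. The factor
    \<open>1 / (4 * pi) ^ d\<close> comes from the Jacobian.\<close>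
  define C where "C = \<bar>c\<bar> * K / (4 * pi) ^ DIM('a) + 1"
  have C: "0 < C" using K by (simp add: C_def add_nonneg_pos)
  have "schroedinger t u \<in> amalgam g 1 \<infinity> \<and>
         amalgam_norm g 1 \<infinity> (schroedinger t u)
           \<le> ennreal (C * ((1 + \<bar>t\<bar>) / t\<^sup>2) powr (real DIM('a) / 2)) * amalgam_norm g \<infinity> 1 u"
    if t: "t \<noteq> 0" and u: "u \<in> amalgam g \<infinity> 1" for t :: real and u
  proof -
    define v where "v = schroedinger t u"
    have tu: "tempered u" using u by (simp add: amalgam_def)
    obtain W N where WN: "dominated_symbol W N c" and Neq: "local_FL_norm g \<infinity> u = (\<lambda>y. ennreal (N y))"
      and u_rep: "\<And>f. schwartz f \<Longrightarrow> u (fourier f) = (LINT p|lborel2. W (fst p) (snd p) * stft f k (snd p) (fst p))"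
      using rep[OF u] by blast
    interpret dominated_symbol W N c by (rule WN)
    note c = c_nonneg and N0 = N_nonneg and Nfin = N_finite
    have u_norm: "amalgam_norm g \<infinity> 1 u = (\<integral>\<^sup>+y. ennreal (N y) \<partial>lborel)"
      by (simp only: amalgam_norm_def Lp_norm_1 Neq)
    have v_eq: "v f = u (fourier (\<lambda>x. chirp t x * inv_fourier f x))" for f
      unfolding v_def by (rule schroedinger_eq)
    have tv: "tempered v"
      unfolding tempered_def
    proof (intro conjI allI impI)
      fix \<phi> \<psi> :: "'a \<Rightarrow> complex" assume s: "schwartz \<phi>" "schwartz \<psi>"
      have "inv_fourier (\<lambda>x. \<phi> x + \<psi> x) = (\<lambda>x. inv_fourier \<phi> x + inv_fourier \<psi> x)"
        by (simp add: inv_fourier_eq_fourier[abs_def] fourier_add[OF s])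
      moreover have "fourier (\<lambda>x. chirp t x * inv_fourier \<phi> x + chirp t x * inv_fourier \<psi> x)
         = (\<lambda>w. fourier (\<lambda>x. chirp t x * inv_fourier \<phi> x) w + fourier (\<lambda>x. chirp t x * inv_fourier \<psi> x) w)"
        by (intro fourier_add schwartz_chirp_mult schwartz_inv_fourier s)
      moreover have "u (\<lambda>w. fourier (\<lambda>x. chirp t x * inv_fourier \<phi> x) w + fourier (\<lambda>x. chirp t x * inv_fourier \<psi> x) w) = v \<phi> + v \<psi>"
        using tu schwartz_fourier[OF schwartz_chirp_mult[OF schwartz_inv_fourier[OF s(1)]]]
          schwartz_fourier[OF schwartz_chirp_mult[OF schwartz_inv_fourier[OF s(2)]]]
        unfolding v_eq tempered_def by blast
      ultimately show "v (\<lambda>x. \<phi> x + \<psi> x) = v \<phi> + v \<psi>" unfolding v_eq by (simp add: distrib_left)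
    next
      fix a :: complex and \<phi> :: "'a \<Rightarrow> complex" assume s: "schwartz \<phi>"
      have "inv_fourier (\<lambda>x. a * \<phi> x) = (\<lambda>x. a * inv_fourier \<phi> x)"
        by (simp add: inv_fourier_eq_fourier[abs_def] fourier_cmult)
      moreover have "fourier (\<lambda>x. a * (chirp t x * inv_fourier \<phi> x)) = (\<lambda>w. a * fourier (\<lambda>x. chirp t x * inv_fourier \<phi> x) w)"
        by (rule fourier_cmult)
      moreover have "u (\<lambda>w. a * fourier (\<lambda>x. chirp t x * inv_fourier \<phi> x) w) = a * v \<phi>"
        using tu schwartz_fourier[OF schwartz_chirp_mult[OF schwartz_inv_fourier[OF s]]]
        unfolding v_eq tempered_def by blast
      ultimately show "v (\<lambda>x. a * \<phi> x) = a * v \<phi>" unfolding v_eq by (simp add: mult.left_commute)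
    next
      \<comment> \<open>Since the chirp has modulus one, the representation bounds
        \<open>v \<phi>\<close> by the integral of \<open>N\<close> times the L^1 norms of
        \<open>k\<close> and \<open>inv_fourier \<phi>\<close>; the last is controlled by a seminorm
        of \<open>\<phi>\<close>.\<close>
      obtain A M where A: "0 \<le> A" "\<And>f::'a \<Rightarrow> complex. schwartz f \<Longrightarrow> (LINT x|lborel. norm (inv_fourier f x)) \<le> A * schwartz_norm M f"
        using integral_norm_inv_fourier_le by blast
      let ?k = "LINT x|lborel. norm (k x)" and ?N = "LINT y|lborel. N y"
      have k0: "0 \<le> ?k" and N0': "0 \<le> ?N" using N0 by (auto intro!: Bochner_Integration.integral_nonneg)
      have Neq': "(\<integral>\<^sup>+y. ennreal (N y) \<partial>lborel) = ennreal ?N"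
        using Nfin N0 by (intro nn_integral_eq_integral integrableI_nonneg) auto
      have "norm (v \<phi>) \<le> (c * ?N * ?k * A) * schwartz_norm M \<phi>" if s: "schwartz \<phi>" for \<phi>
      proof -
        let ?f = "\<lambda>x. chirp t x * inv_fourier \<phi> x"
        have sf: "schwartz ?f" by (intro schwartz_chirp_mult schwartz_inv_fourier s)
        let ?I = "LINT x|lborel. norm (inv_fourier \<phi> x)"
        have I0: "0 \<le> ?I" by (intro Bochner_Integration.integral_nonneg) auto
        have st_m: "(\<lambda>p. stft ?f k (snd p) (fst p)) \<in> borel_measurable lborel2"
          using stft_measurable[OF schwartz_measurable[OF sf] m(1)] by (simp add: case_prod_beta')
        have st_m1: "(\<lambda>z. stft ?f k z y) \<in> borel_measurable lborel" for y
          using schwartz_measurable[OF sf] unfolding stft_eq by measurable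
        have "ennreal (norm (v \<phi>)) \<le> (\<integral>\<^sup>+p. ennreal (norm (W (fst p) (snd p) * stft ?f k (snd p) (fst p))) \<partial>lborel2)"
          unfolding v_eq u_rep[OF sf] by (rule ennreal_norm_integral_le)
        also have "\<dots> \<le> (\<integral>\<^sup>+p. ennreal (c * N (fst p)) * ennreal (norm (stft ?f k (snd p) (fst p))) \<partial>lborel2)"
          using c N0 W_le by (intro nn_integral_mono) (simp add: norm_mult ennreal_mult'[symmetric] ennreal_leI mult_right_mono)
        also have "\<dots> = (\<integral>\<^sup>+y. \<integral>\<^sup>+z. ennreal (c * N y) * ennreal (norm (stft ?f k z y)) \<partial>lborel \<partial>lborel)"
          using st_m by (subst lborel.nn_integral_fst[symmetric]) simp_all
        also have "\<dots> \<le> (\<integral>\<^sup>+y. ennreal (c * N y) * ennreal (?I * ?k) \<partial>lborel)"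
        proof (rule nn_integral_mono)
          fix y :: 'a
          have "(\<integral>\<^sup>+z. ennreal (norm (stft ?f k z y)) \<partial>lborel) \<le> ennreal (?I * ?k)"
            using stft_norm_integral_le[OF sf sk, of y] by (simp add: norm_mult)
          then show "(\<integral>\<^sup>+z. ennreal (c * N y) * ennreal (norm (stft ?f k z y)) \<partial>lborel) \<le> ennreal (c * N y) * ennreal (?I * ?k)"
            using st_m1[of y] by (subst nn_integral_cmult) (auto intro!: mult_left_mono)
        qed
        also have "\<dots> = ennreal (c * ?N * (?I * ?k))"
          using c N0 N0' I0 k0 by (simp add: nn_integral_multc nn_integral_cmult ennreal_mult Neq')
        finally have "norm (v \<phi>) \<le> c * ?N * (?I * ?k)"
          using c N0' I0 k0 by (subst (asm) ennreal_le_iff) auto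
        also have "\<dots> \<le> c * ?N * ((A * schwartz_norm M \<phi>) * ?k)"
          using c N0' k0 by (intro mult_left_mono mult_right_mono A(2)[OF s]) auto
        finally show ?thesis by (simp add: mult_ac)
      qed
      then show "\<exists>K N. \<forall>\<phi>. schwartz \<phi> \<longrightarrow> cmod (v \<phi>) \<le> K * schwartz_norm N \<phi>" by blast
    qed
    have chirp_fin: "stft_chirp_norm t h k < \<infinity>" if h: "schwartz h" for h
      using stft_chirp_L1[OF h sk] unfolding stft_chirp_norm_def by (auto intro: le_less_trans)
    \<comment> \<open>On the frequency side \<open>h\<close> times the transform of \<open>f\<close>
      is a superposition of translates of \<open>inv_fourier h\<close> with weights
      \<open>f w\<close>, so linearity produces the density.\<close>
    have pairing: "v (\<lambda>x. h x * fourier f x) = (LINT w|lborel. evolved_density t k (inv_fourier h) w * f w)"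
      if h: "schwartz h" and f: "schwartz f" for h f
    proof -
      have sh': "schwartz (inv_fourier h)" by (rule schwartz_inv_fourier[OF h])
      have "schwartz (\<lambda>x. chirp t x * inv_fourier (\<lambda>x. h x * fourier f x) x)"
        by (intro schwartz_chirp_mult schwartz_inv_fourier schwartz_mult h schwartz_fourier f)
      from u_rep[OF this] have "v (\<lambda>x. h x * fourier f x)
        = (LINT p|lborel2. W (fst p) (snd p) * stft (\<lambda>x. chirp t x * (LINT w|lborel. f w * inv_fourier h (x - w))) k (snd p) (fst p))"
        unfolding v_eq fourier_mult_modulated[OF h f] .
      then show ?thesis
        by (simp only: evolved_density_pairing[OF f sh' sk t chirp_fin[OF sh']])
    qed
    \<comment> \<open>The parametrised measurability is used with a one-point parameter
      space.\<close>
    have dens_m: "evolved_density t k h \<in> borel_measurable lborel" if "schwartz h" for h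
      using evolved_density_measurable[of "\<lambda>_ :: unit. h" "count_space UNIV" k t] schwartz_measurable[OF that] m(1)
      by (auto dest: measurable_Pair2)
    have dens_le: "(\<integral>\<^sup>+w. ennreal (norm (evolved_density t k h w)) \<partial>lborel)
       \<le> ennreal (c / (4 * pi * \<bar>t\<bar>) ^ DIM('a)) * stft_chirp_norm t h k * (\<integral>\<^sup>+y. ennreal (N y) \<partial>lborel)" if "schwartz h" for h
      by (rule evolved_density_norm_le[OF schwartz_measurable[OF that] m(1) t])
    have dens: "evolved_density t k (inv_fourier h) \<in> fourier_densities 1 (mult_distr h v)" if h: "schwartz h" for h
    proof -
      have sh': "schwartz (inv_fourier h)" by (rule schwartz_inv_fourier[OF h])
      have "(\<integral>\<^sup>+w. ennreal (norm (evolved_density t k (inv_fourier h) w)) \<partial>lborel) < \<infinity>"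
        using dens_le[OF sh'] Nfin chirp_fin[OF sh'] by (auto intro: le_less_trans simp: ennreal_mult_less_top)
      then show ?thesis
        using dens_m[OF sh'] pairing[OF h]
        by (simp add: fourier_densities_def Lp_space_def Lp_norm_1 fourier_distr_def mult_distr_def)
    qed
    have FLv: "mult_distr h v \<in> FL 1" if h: "test_function h" for h
    proof -
      have sh: "schwartz h" by (rule test_function_schwartz[OF h])
      let ?D = "evolved_density t k (inv_fourier h)"
      have "tempered (mult_distr h v)"
        unfolding tempered_def
      proof (intro conjI allI impI)
        show "mult_distr h v (\<lambda>x. \<phi> x + \<psi> x) = mult_distr h v \<phi> + mult_distr h v \<psi>"
          if "schwartz \<phi>" "schwartz \<psi>" for \<phi> \<psi>
          using tv schwartz_mult[OF sh that(1)] schwartz_mult[OF sh that(2)]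
          unfolding mult_distr_def tempered_def distrib_left by blast
        show "mult_distr h v (\<lambda>x. a * \<phi> x) = a * mult_distr h v \<phi>" if "schwartz \<phi>" for a \<phi>
          using tv schwartz_mult[OF sh that]
          unfolding mult_distr_def tempered_def mult.left_commute[of "h _" a] by blast
        have Di: "integrable lborel ?D"
          using dens[OF sh] by (auto simp: fourier_densities_def Lp_space_def Lp_norm_1 integrable_iff_bounded)
        obtain A M where A: "0 \<le> A" "\<And>f::'a \<Rightarrow> complex. schwartz f \<Longrightarrow> (LINT x|lborel. norm (f x)) \<le> A * schwartz_norm M f"
          using integral_norm_schwartz_le by blast
        \<comment> \<open>Continuity follows from the density: a test function is the transform of
          its inverse transform, whose supremum is at most the L^1 norm of the test
          function.\<close>
        have "norm (mult_distr h v \<phi>) \<le> ((LINT w|lborel. norm (?D w)) * A) * schwartz_norm M \<phi>" if s: "schwartz \<phi>" for \<phi>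
        proof -
          have b: "norm (inv_fourier \<phi> w) \<le> A * schwartz_norm M \<phi>" for w
            unfolding inv_fourier_eq_fourier by (rule order_trans[OF norm_fourier_le A(2)[OF s]])
          have "mult_distr h v \<phi> = v (\<lambda>x. h x * fourier (inv_fourier \<phi>) x)"
            by (simp add: mult_distr_def fourier_inv_fourier[OF s])
          also have "\<dots> = (LINT w|lborel. ?D w * inv_fourier \<phi> w)"
            by (rule pairing[OF sh schwartz_inv_fourier[OF s]])
          also have "norm \<dots> \<le> (LINT w|lborel. norm (?D w) * (A * schwartz_norm M \<phi>))"
          proof (rule order_trans[OF integral_norm_bound integral_mono_AE'])
            show "integrable lborel (\<lambda>w. norm (?D w) * (A * schwartz_norm M \<phi>))" using Di by simp
            show "AE w in lborel. norm (?D w * inv_fourier \<phi> w) \<le> norm (?D w) * (A * schwartz_norm M \<phi>)"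
              by (intro AE_I2) (simp add: norm_mult mult_left_mono b)
          qed (auto intro!: AE_I2 mult_nonneg_nonneg order_trans[OF norm_ge_zero b])
          finally show ?thesis by (simp add: mult.assoc)
        qed
        then show "\<exists>K N. \<forall>\<phi>. schwartz \<phi> \<longrightarrow> cmod (mult_distr h v \<phi>) \<le> K * schwartz_norm N \<phi>" by blast
      qed
      then show ?thesis using dens[OF sh] by (auto simp: FL_def)
    qed
    have tr: "schwartz (translate x g)" for x
      using schwartz_shift[OF sg, of x] by (simp add: translate_def)
    \<comment> \<open>Translating the window is modulating its inverse transform, which brings the
      local norm into the range of \<open>stft_chirp_norm_modulate\<close>.\<close>
    have inv_tr: "inv_fourier (translate x g) = (\<lambda>w. ee (x \<bullet> w) * g' w)" for x
      using fourier_shift[OF schwartz_measurable[OF sg], of x]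
      by (simp add: fun_eq_iff translate_def inv_fourier_eq_fourier g'_def)
    have loc: "local_FL_norm g 1 v x = (\<integral>\<^sup>+w. ennreal (norm (evolved_density t k (\<lambda>w. ee (x \<bullet> w) * g' w) w)) \<partial>lborel)" for x
      unfolding local_FL_norm_def using FL_1_norm_eq[OF sg g1 dens[OF tr]] by (simp only: inv_tr)
    have loc_m: "local_FL_norm g 1 v \<in> borel_measurable lborel"
    proof -
      have "(\<lambda>(x, w). evolved_density t k (\<lambda>w. ee (x \<bullet> w) * g' w) w) \<in> borel_measurable lborel2"
        by (rule evolved_density_measurable[OF _ m(1)]) measurable
      then show ?thesis unfolding loc[abs_def] by measurable
    qed
    have loc_le: "local_FL_norm g 1 v x \<le> ennreal (C * ((1 + \<bar>t\<bar>) / t\<^sup>2) powr (real DIM('a) / 2)) * amalgam_norm g \<infinity> 1 u" for x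
    proof -
      let ?r = "(1 + \<bar>t\<bar>) powr (real DIM('a) / 2)"
      have sx: "schwartz (\<lambda>w. ee (x \<bullet> w) * g' w)" using schwartz_ee[OF sg', of x] by (simp add: inner_commute)
      have "local_FL_norm g 1 v x \<le> ennreal (c / (4 * pi * \<bar>t\<bar>) ^ DIM('a)) * stft_chirp_norm t g' k * amalgam_norm g \<infinity> 1 u"
        using dens_le[OF sx] unfolding loc u_norm stft_chirp_norm_modulate[OF m(2,1)] .
      also have "\<dots> \<le> ennreal (c / (4 * pi * \<bar>t\<bar>) ^ DIM('a)) * ennreal (K * ?r) * amalgam_norm g \<infinity> 1 u"
        by (intro mult_right_mono mult_left_mono K) auto
      also have "ennreal (c / (4 * pi * \<bar>t\<bar>) ^ DIM('a)) * ennreal (K * ?r) = ennreal (c / (4 * pi * \<bar>t\<bar>) ^ DIM('a) * (K * ?r))"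
        using c K by (intro ennreal_mult[symmetric]) auto
      also have "c / (4 * pi * \<bar>t\<bar>) ^ DIM('a) * (K * ?r) \<le> C * ((1 + \<bar>t\<bar>) / t\<^sup>2) powr (real DIM('a) / 2)"
      proof -
        \<comment> \<open>This identifies the Jacobian \<open>\<bar>t\<bar> ^ d\<close> with the
          power of \<open>t\<^sup>2\<close> in the stated factor; the absolute value makes the real
          power legitimate for negative \<open>t\<close>.\<close>
        have "(t\<^sup>2) powr (real DIM('a) / 2) = \<bar>t\<bar> ^ DIM('a)"
        proof -
          have "(t\<^sup>2) powr (real DIM('a) / 2) = (\<bar>t\<bar> powr 2) powr (real DIM('a) / 2)" using t by simp
          also have "\<dots> = \<bar>t\<bar> ^ DIM('a)" using t by (simp only: powr_powr) (simp add: powr_realpow)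
          finally show ?thesis .
        qed
        then have e: "((1 + \<bar>t\<bar>) / t\<^sup>2) powr (real DIM('a) / 2) = ?r / \<bar>t\<bar> ^ DIM('a)"
          by (simp add: powr_divide)
        have "c / (4 * pi * \<bar>t\<bar>) ^ DIM('a) * (K * ?r) = c * K / (4 * pi) ^ DIM('a) * (?r / \<bar>t\<bar> ^ DIM('a))"
          by (simp add: power_mult_distrib)
        also have "\<dots> \<le> C * (?r / \<bar>t\<bar> ^ DIM('a))"
          using c by (intro mult_right_mono) (auto simp: C_def)
        finally show ?thesis unfolding e .
      qed
      finally show ?thesis by (simp add: ennreal_leI mult_right_mono)
    qed
    have am: "amalgam_norm g 1 \<infinity> v \<le> ennreal (C * ((1 + \<bar>t\<bar>) / t\<^sup>2) powr (real DIM('a) / 2)) * amalgam_norm g \<infinity> 1 u"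
      unfolding amalgam_norm_def[of g 1 \<infinity>] Lp_norm_infinity
      by (intro esssup_I loc_m AE_I2 loc_le)
    also have "\<dots> < \<infinity>" using Nfin unfolding u_norm by (simp add: ennreal_mult_less_top)
    finally have "v \<in> amalgam g 1 \<infinity>"
      unfolding amalgam_def using tv FLv loc_m by simp
    then show ?thesis using am unfolding v_def by blast
  qed
  then show ?thesis using C by blast
qed

end
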